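(* Let $G$ be a totally disconnected, locally compact group, let $H$ be a compactly generated closed subgroup of $G$, acting by conjugation, and let $K$ be a closed $H$-invariant subgroup of $G$. Then the following are equivalent: (i) $\mathrm{Dist}_K(H)$ is compact; (ii) $\mathrm{Res}_K(H)$ is compact; (iii) $H$ normalizes a compact open subgroup of $K$. Moreover, if any of the conditions (i), (ii), (iii) is satisfied, then \[ \mathrm{nub}_K(H) = \mathrm{Res}_K(H) = \mathrm{Res}^\infty_K(H) = \mathrm{Dist}_K(H) \] and $H$ acts ergodically on $\mathrm{nub}_K(H)$, with $\mathrm{nub}_K(H) = \mathrm{Dist}^*_K(H)$ in the case that $\mathrm{nub}_K(H)$ is metrizable.
   Context: Topological groups are Hausdorff. Let a group $H$ act by automorphisms on a topological group $K$ (here by conjugation). An action of $H$ by homeomorphisms on a Hausdorff space $X$ is distal if there are no distinct $x,y \in X$ for which some $(z,z)$ lies in the closure of $\{(hx,hy)\mid h\in H\}$ in $X\times X$. For a closed $H$-invariant subgroup $D$ of $K$, the action on the coset space $K/D$ is distal at $1$ if the trivial coset does not lie in the closure of the $H$-orbit of any non-trivial coset. $\mathrm{Dist}_K(H)$ (resp. $\mathrm{Dist}^*_K(H)$) is the smallest closed $H$-invariant subgroup $D$ of $K$ such that $H$ acts distally (resp. distally at $1$) on $K/D$; such a smallest subgroup exists and is the intersection of all closed $H$-invariant subgroups with that property. $\mathrm{Res}_K(H)$ is the intersection of all open $H$-invariant subgroups of $K$. Set $\mathrm{Res}^0_K(H)=K$, $\mathrm{Res}^{\alpha+1}_K(H)=\mathrm{Res}_{\mathrm{Res}^\alpha_K(H)}(H)$,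 and take intersections at limit ordinals; $\mathrm{Res}^\infty_K(H)$ is the eventual stable value (the largest closed $H$-invariant subgroup of $K$ having no proper open $H$-invariant subgroup). Tidiness and nub: for an automorphism $\alpha$ of a t.d.l.c. group $K$, a compact open subgroup $U$ is tidy for $\alpha$ if $|\alpha(U):\alpha(U)\cap U|$ is minimal among compact open subgroups of $K$. $H$ is flat on $K$ if some compact open subgroup of $K$ is tidy for all elements of $H$, and then $\mathrm{nub}_K(H)$ is the intersection of all such subgroups. (If $H$ normalizes a compact open subgroup of $K$, then $H$ is flat on $K$ and $\mathrm{nub}_K(H)$ is the intersection of all compact open $H$-invariant subgroups of $K$.) Ergodicity on a compact group refers to normalized Haar measure. *)

theory Defs
  imports "HOL-Analysis.Analysis" "HOL-Algebra.Left_Coset" "HOL-Algebra.Generated_Groups"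
begin

section \<open>Totally disconnected locally compact groups\<close>

text \<open>A group in the sense of HOL-Algebra together with a topology on its carrier. Subgroups
  carry the subspace topology, so a group \<open>K\<close> on which \<open>H\<close> acts is always given as
  a subset of the ambient group \<open>G\<close>.\<close>

definition hausdorff_topological_group :: "('a, 'b) monoid_scheme \<Rightarrow> 'a topology \<Rightarrow> bool" where
  "hausdorff_topological_group G T \<longleftrightarrow>
     group G \<and> topspace T = carrier G \<and>
     continuous_map (prod_topology T T) T (\<lambda>(x, y). x \<otimes>\<^bsub>G\<^esub> y) \<and>
     continuous_map T T (\<lambda>x. inv\<^bsub>G\<^esub> x) \<and>
     Hausdorff_space T"

definition totally_disconnected_space :: "'a topology \<Rightarrow> bool" where
  "totally_disconnected_space T \<longleftrightarrow> (\<forall>S. connectedin T S \<longrightarrow> (\<exists>a. S \<subseteq> {a}))"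

definition tdlc_group :: "('a, 'b) monoid_scheme \<Rightarrow> 'a topology \<Rightarrow> bool" where
  "tdlc_group G T \<longleftrightarrow>
     hausdorff_topological_group G T \<and> totally_disconnected_space T \<and> locally_compact_space T"

definition compactly_generated :: "('a, 'b) monoid_scheme \<Rightarrow> 'a topology \<Rightarrow> 'a set \<Rightarrow> bool" where
  "compactly_generated G T H \<longleftrightarrow> (\<exists>C. compactin T C \<and> C \<subseteq> H \<and> generate G C = H)"


section \<open>The conjugation action\<close>

definition conj_by :: "('a, 'b) monoid_scheme \<Rightarrow> 'a \<Rightarrow> 'a \<Rightarrow> 'a" where
  "conj_by G h x = h \<otimes>\<^bsub>G\<^esub> x \<otimes>\<^bsub>G\<^esub> inv\<^bsub>G\<^esub> h"

definition conj_invariant :: "('a, 'b) monoid_scheme \<Rightarrow> 'a set \<Rightarrow> 'a set \<Rightarrow> bool" where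
  "conj_invariant G H D \<longleftrightarrow> (\<forall>h\<in>H. conj_by G h ` D = D)"

definition closed_inv_subgroups ::
    "('a, 'b) monoid_scheme \<Rightarrow> 'a topology \<Rightarrow> 'a set \<Rightarrow> 'a set \<Rightarrow> 'a set set" where
  "closed_inv_subgroups G T H K =
     {D. subgroup D G \<and> closedin (subtopology T K) D \<and> conj_invariant G H D}"

definition open_inv_subgroups ::
    "('a, 'b) monoid_scheme \<Rightarrow> 'a topology \<Rightarrow> 'a set \<Rightarrow> 'a set \<Rightarrow> 'a set set" where
  "open_inv_subgroups G T H K =
     {U. subgroup U G \<and> openin (subtopology T K) U \<and> conj_invariant G H U}"

definition compact_open_subgroups ::
    "('a, 'b) monoid_scheme \<Rightarrow> 'a topology \<Rightarrow> 'a set \<Rightarrow> 'a set set" where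
  "compact_open_subgroups G T K =
     {U. subgroup U G \<and> openin (subtopology T K) U \<and> compactin T U}"


section \<open>Distal actions and the distal residuals\<close>

definition distal_action :: "'x topology \<Rightarrow> 'h set \<Rightarrow> ('h \<Rightarrow> 'x \<Rightarrow> 'x) \<Rightarrow> bool" where
  "distal_action X H act \<longleftrightarrow>
     \<not> (\<exists>x\<in>topspace X. \<exists>y\<in>topspace X. x \<noteq> y \<and>
          (\<exists>z. (z, z) \<in> prod_topology X X closure_of ((\<lambda>h. (act h x, act h y)) ` H)))"

definition distal_action_at :: "'x topology \<Rightarrow> 'h set \<Rightarrow> ('h \<Rightarrow> 'x \<Rightarrow> 'x) \<Rightarrow> 'x \<Rightarrow> bool" where
  "distal_action_at X H act p \<longleftrightarrow>
     (\<forall>x\<in>topspace X. x \<noteq> p \<longrightarrow> p \<notin> X closure_of ((\<lambda>h. act h x) ` H))"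

text \<open>The space \<open>K/D\<close> of left cosets \<open>xD\<close> with the quotient topology; its
  trivial coset is \<open>D\<close>.\<close>

definition coset_space ::
    "('a, 'b) monoid_scheme \<Rightarrow> 'a topology \<Rightarrow> 'a set \<Rightarrow> 'a set \<Rightarrow> 'a set topology" where
  "coset_space G T K D =
     topology (\<lambda>V. V \<subseteq> lcosets\<^bsub>G\<lparr>carrier := K\<rparr>\<^esub> D \<and> openin (subtopology T K) (\<Union>V))"

text \<open>For \<open>h\<close> normalizing \<open>D\<close>, the image of the coset \<open>xD\<close> under conjugation
  by \<open>h\<close> is \<open>(hxh\<inverse>)D\<close>, so the induced action on \<open>K/D\<close> is given by direct images.\<close>

definition conj_coset :: "('a, 'b) monoid_scheme \<Rightarrow> 'a \<Rightarrow> 'a set \<Rightarrow> 'a set" where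
  "conj_coset G h C = conj_by G h ` C"

definition Dist ::
    "('a, 'b) monoid_scheme \<Rightarrow> 'a topology \<Rightarrow> 'a set \<Rightarrow> 'a set \<Rightarrow> 'a set" where
  "Dist G T H K =
     \<Inter> {D \<in> closed_inv_subgroups G T H K.
          distal_action (coset_space G T K D) H (conj_coset G)}"

definition Dist_star ::
    "('a, 'b) monoid_scheme \<Rightarrow> 'a topology \<Rightarrow> 'a set \<Rightarrow> 'a set \<Rightarrow> 'a set" where
  "Dist_star G T H K =
     \<Inter> {D \<in> closed_inv_subgroups G T H K.
          distal_action_at (coset_space G T K D) H (conj_coset G) D}"


section \<open>The discrete residual and its transfinite iteration\<close>

definition Res ::
    "('a, 'b) monoid_scheme \<Rightarrow> 'a topology \<Rightarrow> 'a set \<Rightarrow> 'a set \<Rightarrow> 'a set" where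
  "Res G T H K = \<Inter> (open_inv_subgroups G T H K)"

text \<open>The set of all \<open>Res\<^sup>\<alpha>\<close>, with \<open>\<alpha>\<close> ranging over the ordinals, generated without
  mentioning ordinals. The transfinite sequence is decreasing, so an intersection of an arbitrary
  nonempty set of its members is again a member, at the supremum of the indices; conversely the
  limit steps are such intersections.\<close>

inductive_set Res_stages ::
    "('a, 'b) monoid_scheme \<Rightarrow> 'a topology \<Rightarrow> 'a set \<Rightarrow> 'a set \<Rightarrow> 'a set set"
  for G T H K where
  zero: "K \<in> Res_stages G T H K"
| succ: "R \<in> Res_stages G T H K \<Longrightarrow> Res G T H R \<in> Res_stages G T H K"
| limit: "\<C> \<noteq> {} \<Longrightarrow> (\<And>R. R \<in> \<C> \<Longrightarrow> R \<in> Res_stages G T H K) \<Longrightarrow> \<Inter>\<C> \<in> Res_stages G T H K"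

text \<open>The last stage is the stable value; see \<open>Res_infty_stable\<close> below.\<close>

definition Res_infty ::
    "('a, 'b) monoid_scheme \<Rightarrow> 'a topology \<Rightarrow> 'a set \<Rightarrow> 'a set \<Rightarrow> 'a set" where
  "Res_infty G T H K = \<Inter> (Res_stages G T H K)"


section \<open>Tidy subgroups, flatness and the nub\<close>

text \<open>For a compact open subgroup \<open>U\<close> the index \<open>|\<alpha>(U) : \<alpha>(U) \<inter> U|\<close> is finite, so
  counting cosets with \<^const>\<open>card\<close> is accurate.\<close>

definition displacement_index :: "('a, 'b) monoid_scheme \<Rightarrow> ('a \<Rightarrow> 'a) \<Rightarrow> 'a set \<Rightarrow> nat" where
  "displacement_index G \<alpha> U = card (rcosets\<^bsub>G\<lparr>carrier := \<alpha> ` U\<rparr>\<^esub> (\<alpha> ` U \<inter> U))"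

definition tidy ::
    "('a, 'b) monoid_scheme \<Rightarrow> 'a topology \<Rightarrow> 'a set \<Rightarrow> ('a \<Rightarrow> 'a) \<Rightarrow> 'a set \<Rightarrow> bool" where
  "tidy G T K \<alpha> U \<longleftrightarrow> U \<in> compact_open_subgroups G T K \<and>
     (\<forall>V \<in> compact_open_subgroups G T K. displacement_index G \<alpha> U \<le> displacement_index G \<alpha> V)"

definition flat_on ::
    "('a, 'b) monoid_scheme \<Rightarrow> 'a topology \<Rightarrow> 'a set \<Rightarrow> 'a set \<Rightarrow> bool" where
  "flat_on G T H K \<longleftrightarrow> (\<exists>U. \<forall>h\<in>H. tidy G T K (conj_by G h) U)"

definition nub ::
    "('a, 'b) monoid_scheme \<Rightarrow> 'a topology \<Rightarrow> 'a set \<Rightarrow> 'a set \<Rightarrow> 'a set" where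
  "nub G T H K = \<Inter> {U. \<forall>h\<in>H. tidy G T K (conj_by G h) U}"


section \<open>Ergodicity\<close>

text \<open>The normalized Haar measure of a compact subgroup \<open>N\<close>: the left-invariant Radon probability
  measure on its Borel \<open>\<sigma>\<close>-algebra. Regularity has to be demanded since \<open>N\<close> need not be
  metrizable.\<close>

definition normalized_haar_measure ::
    "('a, 'b) monoid_scheme \<Rightarrow> 'a topology \<Rightarrow> 'a set \<Rightarrow> 'a measure \<Rightarrow> bool" where
  "normalized_haar_measure G T N \<mu> \<longleftrightarrow>
     sets \<mu> = sets (sigma N {U. openin (subtopology T N) U}) \<and>
     emeasure \<mu> N = 1 \<and>
     (\<forall>x\<in>N. \<forall>A\<in>sets \<mu>. emeasure \<mu> (x <#\<^bsub>G\<^esub> A) = emeasure \<mu> A) \<and>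
     (\<forall>A\<in>sets \<mu>. emeasure \<mu> A = (INF U \<in> {U. openin (subtopology T N) U \<and> A \<subseteq> U}. emeasure \<mu> U)) \<and>
     (\<forall>U. openin (subtopology T N) U \<longrightarrow>
        emeasure \<mu> U = (SUP C \<in> {C. compactin (subtopology T N) C \<and> C \<subseteq> U}. emeasure \<mu> C))"

text \<open>Invariance of the test sets is required only up to null sets, which for uncountable
  \<open>H\<close> is the stronger notion; it covers strictly invariant sets. As the normalized Haar measure
  exists and is unique, the quantifier over \<open>\<mu>\<close> merely names it.\<close>

definition acts_ergodically ::
    "('a, 'b) monoid_scheme \<Rightarrow> 'a topology \<Rightarrow> 'a set \<Rightarrow> 'a set \<Rightarrow> bool" where
  "acts_ergodically G T H N \<longleftrightarrow>
     (\<exists>\<mu>. normalized_haar_measure G T N \<mu> \<and>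
        (\<forall>A\<in>sets \<mu>.
           (\<forall>h\<in>H. emeasure \<mu> (sym_diff (conj_by G h ` A) A) = 0) \<longrightarrow>
           emeasure \<mu> A = 0 \<or> emeasure \<mu> A = 1))"


section \<open>Adequacy of the encodings\<close>

lemma openin_subtopology_whole: "K \<subseteq> topspace T \<Longrightarrow> openin (subtopology T K) K"
  by (metis openin_topspace topspace_subtopology_subset)

lemma openin_coset_space:
  assumes "group G" "subgroup K G" "K \<subseteq> topspace T" "subgroup D G" "D \<subseteq> K"
  shows "openin (coset_space G T K D) V \<longleftrightarrow>
           V \<subseteq> lcosets\<^bsub>G\<lparr>carrier := K\<rparr>\<^esub> D \<and> openin (subtopology T K) (\<Union>V)"
proof -
  let ?L = "lcosets\<^bsub>G\<lparr>carrier := K\<rparr>\<^esub> D"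
  interpret K: group "G\<lparr>carrier := K\<rparr>"
    using assms(1,2) by (rule subgroup.subgroup_is_group[rotated])
  have D: "subgroup D (G\<lparr>carrier := K\<rparr>)"
    using assms by (simp add: group.subgroup_incl)
  have disj: "C = C'" if C: "C \<in> ?L" "C' \<in> ?L" "x \<in> C" "x \<in> C'" for C C' x
  proof -
    obtain a b where ab: "a \<in> K" "C = a <#\<^bsub>G\<lparr>carrier := K\<rparr>\<^esub> D"
        "b \<in> K" "C' = b <#\<^bsub>G\<lparr>carrier := K\<rparr>\<^esub> D"
      using C(1,2) by (auto simp: LCOSETS_def)
    have "a <#\<^bsub>G\<lparr>carrier := K\<rparr>\<^esub> D = x <#\<^bsub>G\<lparr>carrier := K\<rparr>\<^esub> D"
      using K.l_repr_independence[OF _ _ D] C(3) ab by auto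
    moreover have "b <#\<^bsub>G\<lparr>carrier := K\<rparr>\<^esub> D = x <#\<^bsub>G\<lparr>carrier := K\<rparr>\<^esub> D"
      using K.l_repr_independence[OF _ _ D] C(4) ab by auto
    ultimately show ?thesis using ab by simp
  qed
  have "istopology (\<lambda>V. V \<subseteq> ?L \<and> openin (subtopology T K) (\<Union>V))"
    unfolding istopology_def
  proof (intro conjI allI impI)
    fix S S' assume S: "S \<subseteq> ?L \<and> openin (subtopology T K) (\<Union>S)"
      and S': "S' \<subseteq> ?L \<and> openin (subtopology T K) (\<Union>S')"
    have "\<Union>S \<inter> \<Union>S' \<subseteq> \<Union>(S \<inter> S')"
    proof
      fix x assume "x \<in> \<Union>S \<inter> \<Union>S'"
      then obtain C C' where "C \<in> S" "C' \<in> S'" "x \<in> C" "x \<in> C'" by blast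
      moreover from this have "C = C'" using S S' by (intro disj[of C C' x]) blast+
      ultimately show "x \<in> \<Union>(S \<inter> S')" by blast
    qed
    then have "\<Union>(S \<inter> S') = \<Union>S \<inter> \<Union>S'" by blast
    then show "openin (subtopology T K) (\<Union>(S \<inter> S'))"
      using S S' by (simp add: openin_Int)
    show "S \<inter> S' \<subseteq> ?L" using S by auto
  next
    fix \<K> assume *: "\<forall>V\<in>\<K>. V \<subseteq> ?L \<and> openin (subtopology T K) (\<Union>V)"
    have "\<Union>(\<Union>\<K>) = \<Union>(Union ` \<K>)" by auto
    moreover have "openin (subtopology T K) (\<Union>(Union ` \<K>))"
      using * by (intro openin_Union) auto
    ultimately show "openin (subtopology T K) (\<Union>(\<Union>\<K>))"
      by simp
    show "\<Union>\<K> \<subseteq> ?L" using * by auto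
  qed
  then show ?thesis
    by (simp add: coset_space_def topology_inverse')
qed

lemma topspace_coset_space:
  assumes "group G" "subgroup K G" "K \<subseteq> topspace T" "subgroup D G" "D \<subseteq> K"
  shows "topspace (coset_space G T K D) = lcosets\<^bsub>G\<lparr>carrier := K\<rparr>\<^esub> D"
proof -
  interpret K: group "G\<lparr>carrier := K\<rparr>"
    using assms(1,2) by (rule subgroup.subgroup_is_group[rotated])
  have "\<Union>(lcosets\<^bsub>G\<lparr>carrier := K\<rparr>\<^esub> D) = K"
    using K.lcosets_part_G[of D] assms by (simp add: group.subgroup_incl)
  then have "openin (coset_space G T K D) (lcosets\<^bsub>G\<lparr>carrier := K\<rparr>\<^esub> D)"
    using assms openin_coset_space[OF assms]
    by (simp add: openin_subtopology_whole)
  moreover have "topspace (coset_space G T K D) \<subseteq> lcosets\<^bsub>G\<lparr>carrier := K\<rparr>\<^esub> D"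
    using openin_coset_space[OF assms, of "topspace (coset_space G T K D)"] by blast
  ultimately show ?thesis
    by (intro subset_antisym openin_subset)
qed

lemma conj_invariant_Inter:
  assumes "group G" "H \<subseteq> carrier G" "\<C> \<noteq> {}"
    and "\<And>D. D \<in> \<C> \<Longrightarrow> D \<subseteq> carrier G \<and> conj_invariant G H D"
  shows "conj_invariant G H (\<Inter>\<C>)"
  unfolding conj_invariant_def
proof
  fix h assume h: "h \<in> H"
  interpret group G by fact
  have inj: "inj_on (conj_by G h) (carrier G)"
    using h assms(2) unfolding conj_by_def by (intro inj_onI) (auto simp: m_assoc)
  obtain D0 where "D0 \<in> \<C>" using assms(3) by blast
  then have "conj_by G h ` (\<Inter>D\<in>\<C>. D) = (\<Inter>D\<in>\<C>. conj_by G h ` D)"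
    using assms(4) by (intro image_INT[OF inj]) auto
  also have "\<dots> = (\<Inter>D\<in>\<C>. D)"
    using assms(4) h by (intro INF_cong) (auto simp: conj_invariant_def)
  finally show "conj_by G h ` \<Inter>\<C> = \<Inter>\<C>" by simp
qed

lemma Res_stages_inv_subgroup:
  assumes "group G" "topspace T = carrier G" "H \<subseteq> carrier G"
    and "subgroup K G" "conj_invariant G H K" "R \<in> Res_stages G T H K"
  shows "subgroup R G \<and> conj_invariant G H R"
  using assms(6)
proof induction
  case zero
  then show ?case using assms by simp
next
  case (succ R)
  have "R \<in> open_inv_subgroups G T H R"
    using succ assms(2) subgroup.subset[of R G]
    by (auto simp: open_inv_subgroups_def openin_subtopology_whole)
  then have ne: "open_inv_subgroups G T H R \<noteq> {}" by blast
  have "subgroup U G \<and> conj_invariant G H U" if "U \<in> open_inv_subgroups G T H R" for U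
    using that by (simp add: open_inv_subgroups_def)
  then show ?case unfolding Res_def
    using conj_invariant_Inter[OF assms(1,3) ne] group.subgroups_Inter[OF assms(1) _ ne]
    by (simp add: subgroup.subset)
next
  case (limit \<C>)
  then show ?case
    using conj_invariant_Inter[OF assms(1,3) limit.hyps(1)] group.subgroups_Inter[OF assms(1)]
    by (simp add: subgroup.subset)
qed

lemma Res_infty_stable:
  assumes "group G" "topspace T = carrier G" "H \<subseteq> carrier G"
    and "subgroup K G" "conj_invariant G H K"
  shows "Res_infty G T H K \<in> Res_stages G T H K"
    and "Res G T H (Res_infty G T H K) = Res_infty G T H K"
proof -
  show 1: "Res_infty G T H K \<in> Res_stages G T H K"
    unfolding Res_infty_def by (rule Res_stages.limit) (auto intro: Res_stages.zero)
  let ?R = "Res_infty G T H K"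
  have "subgroup ?R G \<and> conj_invariant G H ?R"
    using Res_stages_inv_subgroup[OF assms 1] .
  then have "?R \<in> open_inv_subgroups G T H ?R"
    using assms(2) subgroup.subset[of ?R G]
    by (auto simp: open_inv_subgroups_def openin_subtopology_whole)
  then have "Res G T H ?R \<subseteq> ?R" unfolding Res_def by blast
  moreover have "?R \<subseteq> Res G T H ?R"
    using Res_stages.succ[OF 1] unfolding Res_infty_def by blast
  ultimately show "Res G T H ?R = ?R" by simp
qed

end

theory Submission
  imports Defs
begin

text \<open>Two ideas carry the proof. First, suppose \<open>D\<close> is compact and \<open>H\<close> acts distally on \<open>K/D\<close>, and
  let \<open>V\<close> be a compact open set of cosets containing the trivial one. If the set \<open>W\<close> of points whose
  \<open>H\<close>-orbit stays in \<open>V\<close> were not open, compact generation of \<open>H\<close> and a first-exit argument would give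
  a point \<open>y \<in> V - W\<close> whose orbit enters, for every \<open>n\<close>, the set of points that stay in \<open>V\<close> under all
  words of length \<open>n\<close>. Pointwise limits of the group elements involved form a compact right
  topological semigroup of maps \<open>W \<union> {y} \<rightarrow> W\<close>, and an idempotent \<open>u\<close> of it makes \<open>y\<close> proximal
  to \<open>u y \<in> W\<close>, against distality. So \<open>W\<close> is open, its stabilizer under right translation is a
  compact open invariant subgroup, and \<open>D\<close> has arbitrarily small such neighbourhoods. Since distality
  passes from \<open>K/R\<close> to \<open>K/V\<close> when \<open>V\<close> is open in the compact group \<open>R\<close>, the same statement shows
  that a compact residual has no proper open invariant subgroup.

  Second, on a profinite group \<open>N\<close> without proper open invariant subgroups an almost invariant set
  \<open>A\<close> gives the invariant length function \<open>x \<mapsto> \<mu>(xA \<triangle> A)\<close>, which has to vanish; so \<open>A\<close> is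
  almost translation invariant, hence independent of all clopen sets and finally of itself.\<close>

text \<open>\<open>D\<close> need not be normal, so \<open>K/D\<close> is only a space with an
  action, and in general not a compact one; the enveloping semigroup of the whole action is out of
  reach. Limits are under control only on \<open>W \<union> {y}\<close>, where their values can be
  kept in the compact image of \<open>V\<close>. They need not be continuous, but continuity in the
  left factor is all that an idempotent requires. Likewise \<open>W\<close> is a mere set; its right
  stabilizer is a group, still invariant and still containing \<open>D\<close>.

  The two residuals are linked because distality is inherited by intersections and holds for
  \<open>K/U\<close> with \<open>U\<close> open: \<open>H\<close> acts distally on
  \<open>K/Res\<close>, so \<open>Dist\<close> lies in \<open>Res\<close>, and the invariant
  neighbourhoods of a compact \<open>Dist\<close> give the converse. Without proper open invariant
  subgroups in \<open>Res\<close>, the transfinite iteration stops after one step.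

  Since the groups may be non-metrizable, Haar measure is built from coset counts on clopen sets.
  For \<open>Dist_star\<close>, metrizability provides a countable neighbourhood base of the
  identity, which turns ergodicity into a statement about almost every orbit.\<close>

no_notation (input) subset_mset (infix "<#" 50)
no_notation eq_closure_of ("closure'_of\<index>")

section \<open>Compactness and idempotents in compact semigroups\<close>

text \<open>The tube lemma: the complement is the projection of a closed set along the compact
  factor \<open>C\<close>, and such a projection is a closed map. It yields the open sets that are
  defined below by a condition over compactly many parameters.\<close>

lemma openin_tube:
  assumes f: "continuous_map (prod_topology X Y) Z f" and C: "compactin X C" and O: "openin Z O'"
  shows "openin Y {y \<in> topspace Y. \<forall>c\<in>C. f (c, y) \<in> O'}"
proof -
  let ?X = "subtopology X C"
  have CX: "C \<subseteq> topspace X"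
    using C by (rule compactin_subset_topspace)
  have f': "continuous_map (prod_topology ?X Y) Z f"
    using continuous_map_from_subtopology[OF f]
    by (simp add: prod_topology_subtopology)
  have "closedin (prod_topology ?X Y) {p \<in> topspace (prod_topology ?X Y). f p \<in> topspace Z - O'}"
    by (rule closedin_continuous_map_preimage[OF f']) (use O in auto)
  moreover have "closed_map (prod_topology ?X Y) Y snd"
    by (rule closed_map_snd) (simp add: C compact_space_subtopology)
  ultimately have "closedin Y (snd ` {p \<in> topspace (prod_topology ?X Y). f p \<in> topspace Z - O'})"
    by (simp add: closed_map_def)
  moreover have "snd ` {p \<in> topspace (prod_topology ?X Y). f p \<in> topspace Z - O'} =
      topspace Y - {y \<in> topspace Y. \<forall>c\<in>C. f (c, y) \<in> O'}" (is "?l = ?r")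
  proof
    show "?l \<subseteq> ?r" by auto
    show "?r \<subseteq> ?l"
    proof
      fix y assume "y \<in> ?r"
      then obtain c where c: "c \<in> C" "y \<in> topspace Y" "f (c, y) \<notin> O'" by auto
      then have "(c, y) \<in> topspace (prod_topology ?X Y)" using CX by auto
      moreover from this have "f (c, y) \<in> topspace Z"
        using f' by (meson continuous_map_image_subset_topspace image_subset_iff)
      ultimately show "y \<in> ?l" using c by (force intro!: image_eqI[where x="(c,y)"])
    qed
  qed
  ultimately show ?thesis
    by (simp add: openin_closedin)
qed

lemma compactin_continuous_image_Times:
  assumes f: "continuous_map (prod_topology X Y) Z f" and "compactin X C" "compactin Y D"
  shows "compactin Z (f ` (C \<times> D))"
  using assms by (intro image_compactin[OF _ f]) (simp add: compactin_Times)

text \<open>Finitely many of the open fibres cover the compact set. It serves to show that a compact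
  set meets only finitely many cosets of an open subgroup.\<close>

lemma finite_image_locally_constant:
  assumes S: "compactin X S" and f: "\<And>x. x \<in> S \<Longrightarrow> openin X {y \<in> topspace X. f y = f x}"
  shows "finite (f ` S)"
proof -
  let ?\<U> = "(\<lambda>c. {y \<in> topspace X. f y = c}) ` f ` S"
  have "S \<subseteq> \<Union>?\<U>" using compactin_subset_topspace[OF S] by auto
  moreover have "openin X U" if "U \<in> ?\<U>" for U using that f by auto
  ultimately have "\<exists>\<F>. finite \<F> \<and> \<F> \<subseteq> ?\<U> \<and> S \<subseteq> \<Union>\<F>" by (intro compactinD[OF S])
  then obtain \<F> where F: "finite \<F>" "\<F> \<subseteq> ?\<U>" "S \<subseteq> \<Union>\<F>" by auto
  then obtain A where A: "finite A" "A \<subseteq> f ` S" "\<F> = (\<lambda>c. {y \<in> topspace X. f y = c}) ` A"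
    by (meson finite_subset_image)
  have "f ` S \<subseteq> A" using F(3) unfolding A(3) by blast
  then show ?thesis using A(1) finite_subset by blast
qed

lemma compactin_nest_nonempty:
  fixes F :: "nat \<Rightarrow> 'a set"
  assumes "Hausdorff_space X" "\<And>n. compactin X (F n)" "\<And>n. F n \<noteq> {}" "\<And>n. F (Suc n) \<subseteq> F n"
  shows "(\<Inter>n. F n) \<noteq> {}"
proof -
  have dec: "decseq F" using assms(4) by (simp add: decseq_SucI)
  have F0: "F n \<subseteq> F 0" for n using dec by (simp add: decseqD)
  have "(\<Inter>n. F n) \<noteq> {}"
  proof (rule compact_space_imp_nest[of "subtopology X (F 0)"])
    show "compact_space (subtopology X (F 0))" by (simp add: assms compact_space_subtopology)
    show "closedin (subtopology X (F 0)) (F n)" for n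
      by (simp add: F0 assms closedin_subset_topspace compactin_imp_closedin)
  qed (use assms dec in auto)
  then show ?thesis .
qed

text \<open>A minimal nonempty closed subsemigroup \<open>M\<close> satisfies \<open>M u = M\<close> for each of its
  elements \<open>u\<close>, and then \<open>{m \<in> M. m u = u}\<close> is again such a subsemigroup.\<close>

lemma Ellis_Numakura:
  assumes "Hausdorff_space X" "compactin X I" "I \<noteq> {}"
    and op: "\<And>f g. f \<in> I \<Longrightarrow> g \<in> I \<Longrightarrow> m f g \<in> I"
    and assoc: "\<And>f g h. f \<in> I \<Longrightarrow> g \<in> I \<Longrightarrow> h \<in> I \<Longrightarrow> m (m f g) h = m f (m g h)"
    and cont: "\<And>g. g \<in> I \<Longrightarrow> continuous_map (subtopology X I) X (\<lambda>f. m f g)"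
  shows "\<exists>u\<in>I. m u u = u"
proof -
  define SG where "SG = {S. S \<subseteq> I \<and> S \<noteq> {} \<and> closedin X S \<and> (\<forall>f\<in>S. \<forall>g\<in>S. m f g \<in> S)}"
  have Icl: "closedin X I" using assms by (simp add: compactin_imp_closedin)
  have ISG: "I \<in> SG" using assms Icl by (auto simp: SG_def)
  \<comment> \<open>Zorn's lemma yields maximal elements, so it is applied to the complements
    \<open>I - S\<close>: a maximal complement belongs to a minimal subsemigroup.\<close>
  have "\<exists>M\<in>(\<lambda>S. I - S) ` SG. \<forall>S\<in>(\<lambda>S. I - S) ` SG. M \<subseteq> S \<longrightarrow> S = M"
  proof (rule subset_Zorn_nonempty)
    show "(\<lambda>S. I - S) ` SG \<noteq> {}" using ISG by blast
    fix \<C> assume ne: "\<C> \<noteq> {}" and ch: "subset.chain ((\<lambda>S. I - S) ` SG) \<C>"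
    define \<D> where "\<D> = {S \<in> SG. I - S \<in> \<C>}"
    have C_eq: "\<C> = (\<lambda>S. I - S) ` \<D>"
      using ch by (auto simp: subset.chain_def \<D>_def)
    have Dne: "\<D> \<noteq> {}" using ne C_eq by blast
    have Dlin: "S \<subseteq> S' \<or> S' \<subseteq> S" if "S \<in> \<D>" "S' \<in> \<D>" for S S'
    proof -
      have "I - S \<subseteq> I - S' \<or> I - S' \<subseteq> I - S"
        using ch that by (simp add: subset_chain_def \<D>_def)
      then show ?thesis using that by (auto simp: \<D>_def SG_def)
    qed
    have "\<Inter>\<D> \<noteq> {}"
    proof -
      \<comment> \<open>A finite intersection within a chain is one of its members, hence nonempty;
        compactness of \<open>I\<close> extends this to all of \<open>\<D>\<close>.\<close>
      have fin: "\<Inter>\<F> \<in> \<F>" if "finite \<F>" "\<F> \<noteq> {}" "\<F> \<subseteq> \<D>" for \<F>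
        using that
      proof (induction rule: finite_ne_induct)
        case (insert S \<F>)
        then have "S \<subseteq> \<Inter>\<F> \<or> \<Inter>\<F> \<subseteq> S" by (meson Dlin insert_subset subsetD)
        with insert show ?case by (auto simp: Int_absorb1 Int_absorb2)
      qed auto
      have "I \<inter> \<Inter>\<D> \<noteq> {}"
      proof (rule compactin_fip[THEN iffD1, OF assms(2), THEN conjunct2, rule_format])
        show "(\<forall>C\<in>\<D>. closedin X C) \<and> (\<forall>\<F>. finite \<F> \<and> \<F> \<subseteq> \<D> \<longrightarrow> I \<inter> \<Inter>\<F> \<noteq> {})"
        proof (intro conjI allI impI)
          show "\<forall>C\<in>\<D>. closedin X C" by (auto simp: \<D>_def SG_def)
          fix \<F> assume F: "finite \<F> \<and> \<F> \<subseteq> \<D>"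
          show "I \<inter> \<Inter>\<F> \<noteq> {}"
          proof (cases "\<F> = {}")
            case False
            then have "\<Inter>\<F> \<in> SG" using fin F unfolding \<D>_def by blast
            then show ?thesis by (auto simp: SG_def)
          qed (use assms in auto)
        qed
      qed
      then show ?thesis by blast
    qed
    moreover have "closedin X (\<Inter>\<D>)"
      using Dne by (intro closedin_Inter) (auto simp: \<D>_def SG_def)
    moreover have "\<Inter>\<D> \<subseteq> I" using Dne by (auto simp: \<D>_def SG_def)
    moreover have "\<forall>f\<in>\<Inter>\<D>. \<forall>g\<in>\<Inter>\<D>. m f g \<in> \<Inter>\<D>" by (auto simp: \<D>_def SG_def)
    ultimately have "\<Inter>\<D> \<in> SG" by (auto simp: SG_def)
    moreover have "\<Union>\<C> = I - \<Inter>\<D>" using Dne by (auto simp: C_eq)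
    ultimately show "\<Union>\<C> \<in> (\<lambda>S. I - S) ` SG" by blast
  qed
  then obtain M where M: "M \<in> SG" and "\<forall>S\<in>SG. I - M \<subseteq> I - S \<longrightarrow> I - S = I - M"
    by blast
  then have min: "S = M" if "S \<in> SG" "S \<subseteq> M" for S
    using that by (auto simp: SG_def)
  obtain u where u: "u \<in> M" using M by (auto simp: SG_def)
  have MI: "M \<subseteq> I" and Mop: "\<And>f g. f \<in> M \<Longrightarrow> g \<in> M \<Longrightarrow> m f g \<in> M" and Mcl: "closedin X M"
    using M by (auto simp: SG_def)
  have Mcomp: "compactin (subtopology X I) M"
    using closed_compactin[OF assms(2) MI Mcl] MI by (simp add: compactin_subtopology)
  have c: "continuous_map (subtopology X I) X (\<lambda>f. m f u)" using cont u MI by blast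
  \<comment> \<open>\<open>M u\<close> is closed as a continuous image of a compact set, and a
    semigroup because \<open>(f u)(g u) = ((f u) g) u\<close>.\<close>
  have "(\<lambda>f. m f u) ` M \<in> SG"
    unfolding SG_def
  proof (intro CollectI conjI ballI)
    show "closedin X ((\<lambda>f. m f u) ` M)"
      using assms(1) image_compactin[OF Mcomp c] by (simp add: compactin_imp_closedin)
    fix f g assume "f \<in> (\<lambda>f. m f u) ` M" "g \<in> (\<lambda>f. m f u) ` M"
    then obtain f' g' where fg: "f' \<in> M" "g' \<in> M" "f = m f' u" "g = m g' u" by auto
    then have "m f g = m (m (m f' u) g') u"
      using u MI Mop assoc by (metis subsetD)
    then show "m f g \<in> (\<lambda>f. m f u) ` M" using fg u Mop by blast
  qed (use u MI Mop in auto)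
  then have "(\<lambda>f. m f u) ` M = M" by (rule min) (use Mop u in auto)
  then obtain f0 where f0: "f0 \<in> M" "m f0 u = u" using u by (metis imageE)
  have "{f \<in> M. m f u = u} \<in> SG"
    unfolding SG_def
  proof (rule CollectI, intro conjI ballI)
    have "closedin (subtopology X I) {f \<in> topspace (subtopology X I). m f u \<in> {u}}"
      using Icl u MI assms(1)
      by (intro closedin_continuous_map_preimage[OF c] closedin_Hausdorff_singleton)
        (auto dest: closedin_subset)
    then have "closedin X {f \<in> topspace (subtopology X I). m f u \<in> {u}}"
      using Icl closedin_closed_subtopology by blast
    then have "closedin X (M \<inter> {f \<in> topspace (subtopology X I). m f u \<in> {u}})"
      using Mcl by blast
    moreover have "M \<inter> {f \<in> topspace (subtopology X I). m f u \<in> {u}} = {f \<in> M. m f u = u}"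
      using MI Icl closedin_subset by fastforce
    ultimately show "closedin X {f \<in> M. m f u = u}" by simp
    fix f g assume "f \<in> {f \<in> M. m f u = u}" "g \<in> {f \<in> M. m f u = u}"
    then show "m f g \<in> {f \<in> M. m f u = u}"
      using Mop assoc u MI by (auto simp: subset_iff)
  qed (use f0 MI in auto)
  then have "{f \<in> M. m f u = u} = M" by (rule min) auto
  then show ?thesis using u MI by blast
qed

text \<open>The pointwise limits of elements of \<open>H\<close> on \<open>W \<union> {y}\<close> that take values in \<open>W\<close> form a
  compact semigroup; an idempotent \<open>u\<close> of it satisfies \<open>u (u y) = u y\<close> with \<open>u y \<in> W\<close>.\<close>

lemma proximal_to_invariant_subset:
  fixes X :: "'x topology" and act :: "'h \<Rightarrow> 'x \<Rightarrow> 'x" and V :: "nat \<Rightarrow> 'x set"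
  assumes X: "Hausdorff_space X"
    and cont: "\<And>h. h \<in> H \<Longrightarrow> continuous_map X X (act h)"
    and comp: "\<And>h k. h \<in> H \<Longrightarrow> k \<in> H \<Longrightarrow> \<exists>l\<in>H. \<forall>x\<in>topspace X. act l x = act h (act k x)"
    and inv: "\<And>h w. h \<in> H \<Longrightarrow> w \<in> W \<Longrightarrow> act h w \<in> W"
    and V: "\<And>n. compactin X (V n)" "\<And>n. V (Suc n) \<subseteq> V n" and W: "W = (\<Inter>n. V n)"
    and y: "y \<in> topspace X" "\<And>n. \<exists>h\<in>H. act h y \<in> V n"
  shows "\<exists>w\<in>W. \<exists>z. (z, z) \<in> prod_topology X X closure_of ((\<lambda>h. (act h w, act h y)) ` H)"
proof -
  \<comment> \<open>Only these points are tracked: \<open>W\<close> is invariant and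
    \<open>y\<close> can be moved into each \<open>V n\<close>, so the relevant maps lie in compact
    products.\<close>
  define A where "A = insert y W"
  have VX: "V n \<subseteq> topspace X" for n using V(1) by (rule compactin_subset_topspace)
  have WX: "W \<subseteq> topspace X" using VX W by blast
  have AX: "A \<subseteq> topspace X" using WX y by (simp add: A_def)
  define P where "P = product_topology (\<lambda>_. X) A"
  have HP: "Hausdorff_space P" using X by (simp add: P_def Hausdorff_space_product_topology)
  define E where "E = P closure_of ((\<lambda>h. restrict (act h) A) ` H)"
  \<comment> \<open>The limits that send all of \<open>A\<close> into the compact set
    \<open>V n\<close>. Each \<open>F n\<close> contains the restriction of some \<open>h\<close> in
    \<open>H\<close>, one that moves \<open>y\<close> into \<open>V n\<close>, so compactness makes
    the intersection \<open>I\<close> nonempty.\<close>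
  define F where "F n = E \<inter> PiE A (\<lambda>_. V n)" for n
  have mono: "V m \<subseteq> V n" if "n \<le> m" for n m
    using that V(2) by (rule lift_Suc_antimono_le[rotated])
  have hP: "restrict (act h) A \<in> topspace P" if "h \<in> H" for h
    using cont[OF that] AX unfolding P_def
    by (auto simp: continuous_map_def)
  have Fcomp: "compactin P (F n)" for n
  proof -
    have "compactin P (PiE A (\<lambda>_. V n))" using V unfolding P_def by (simp add: compactin_PiE)
    moreover have "closedin P E" by (simp add: E_def)
    ultimately show ?thesis unfolding F_def by (simp add: closed_Int_compactin)
  qed
  have Fne: "F n \<noteq> {}" for n
  proof -
    obtain h where h: "h \<in> H" "act h y \<in> V n" using y by blast
    have "restrict (act h) A \<in> E"
      using h hP unfolding E_def by (meson closure_of_subset_Int imageI IntI subsetD)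
    moreover have "restrict (act h) A \<in> PiE A (\<lambda>_. V n)"
      using h inv[OF h(1)] W by (auto simp: A_def)
    ultimately show ?thesis unfolding F_def by blast
  qed
  define I where "I = E \<inter> PiE A (\<lambda>_. W)"
  have I_eq: "I = (\<Inter>n. F n)" by (auto simp: I_def F_def W PiE_iff)
  have "I \<noteq> {}" unfolding I_eq
    by (rule compactin_nest_nonempty[OF HP Fcomp Fne]) (use V(2) in \<open>auto simp: F_def PiE_iff\<close>)
  have Icomp: "compactin P I"
  proof -
    have "closedin P I"
      unfolding I_eq using Fcomp HP by (intro closedin_INT) (auto simp: compactin_imp_closedin)
    then show ?thesis by (rule closed_compactin[OF Fcomp[of 0], rotated]) (auto simp: I_eq)
  qed
  have nbhd: "\<exists>h\<in>H. \<forall>a\<in>S. act h a \<in> U a"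
    if f: "f \<in> E" and S: "finite S" "S \<subseteq> A" and U: "\<And>a. a \<in> S \<Longrightarrow> openin X (U a) \<and> f a \<in> U a" for f S U
  proof -
    define Q where "Q = PiE A (\<lambda>a. if a \<in> S then U a else topspace X)"
    have "openin P Q" unfolding P_def Q_def
      by (rule openin_PiE_gen[THEN iffD2]) (use S U finite_subset in auto)
    moreover have "f \<in> Q"
      using f U unfolding E_def Q_def by (auto simp: P_def in_closure_of PiE_iff)
    ultimately have "\<exists>g. g \<in> (\<lambda>h. restrict (act h) A) ` H \<and> g \<in> Q"
      using f unfolding E_def in_closure_of by blast
    then obtain h where "h \<in> H" "restrict (act h) A \<in> Q" by blast
    moreover have "act h a \<in> U a" if "a \<in> S" "restrict (act h) A \<in> Q" for a
      using that S by (auto simp: Q_def PiE_iff split: if_splits)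
    ultimately show ?thesis by blast
  qed
  have Emem: "f \<in> E" if f: "f \<in> topspace P"
    and *: "\<And>S U. finite S \<Longrightarrow> S \<subseteq> A \<Longrightarrow> (\<And>a. a \<in> S \<Longrightarrow> openin X (U a) \<and> f a \<in> U a) \<Longrightarrow>
        \<exists>h\<in>H. \<forall>a\<in>S. act h a \<in> U a" for f
    unfolding E_def in_closure_of
  proof (intro conjI allI impI f)
    fix Q assume Q: "f \<in> Q \<and> openin P Q"
    then obtain U where U: "finite {a \<in> A. U a \<noteq> topspace X}" "\<And>a. a \<in> A \<Longrightarrow> openin X (U a)"
        "f \<in> PiE A U" "PiE A U \<subseteq> Q"
      using openin_product_topology_alt[of "\<lambda>_. X" A Q] unfolding P_def by meson
    define S where "S = {a \<in> A. U a \<noteq> topspace X}"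
    have "finite S" "S \<subseteq> A" "openin X (U a) \<and> f a \<in> U a" if "a \<in> S" for a
      using U that by (auto simp: S_def PiE_iff)
    then obtain h where h: "h \<in> H" "\<forall>a\<in>S. act h a \<in> U a"
      using *[of S U] U(1) by (metis (no_types, lifting) S_def mem_Collect_eq subsetI)
    have "act h a \<in> U a" if "a \<in> A" for a
    proof (cases "a \<in> S")
      case False
      then have "U a = topspace X" using that by (simp add: S_def)
      then show ?thesis using hP[OF h(1)] that by (auto simp: P_def PiE_iff)
    qed (use h in blast)
    then have "restrict (act h) A \<in> Q" using U by (auto simp: PiE_iff)
    then show "\<exists>g. g \<in> (\<lambda>h. restrict (act h) A) ` H \<and> g \<in> Q" using h by blast
  qed
  have IW: "f a \<in> W" if "f \<in> I" "a \<in> A" for f a using that by (auto simp: I_def)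
  have WA: "W \<subseteq> A" by (auto simp: A_def)
  have IA: "f a \<in> A" if "f \<in> I" "a \<in> A" for f a using IW[OF that] WA by blast
  have "\<exists>u\<in>I. compose A u u = u"
  proof (rule Ellis_Numakura[OF HP Icomp \<open>I \<noteq> {}\<close>, of "compose A"])
    fix f g assume fg: "f \<in> I" "g \<in> I"
    have mW: "compose A f g \<in> PiE A (\<lambda>_. W)"
      by (rule PiE_I) (simp_all add: compose_def IW[OF fg(1) IA[OF fg(2)]])
    moreover have "compose A f g \<in> E"
    proof (rule Emem)
      show "compose A f g \<in> topspace P" using mW WX by (auto simp: P_def PiE_iff)
      fix S U assume S: "finite S" "S \<subseteq> A"
        and U: "\<And>a. a \<in> S \<Longrightarrow> openin X (U a) \<and> compose A f g a \<in> U a"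
      have U': "openin X (U a)" "f (g a) \<in> U a" if "a \<in> S" for a
        using that U[OF that] S by (auto simp: compose_def)
      \<comment> \<open>The map \<open>f\<close> is approximated first, at the finitely many points
        \<open>g a\<close>; as several \<open>a\<close> may share a value \<open>b\<close>, the
        neighbourhoods are intersected over the fibre. Once \<open>h\<close> is fixed,
        \<open>act h\<close> is continuous, and \<open>g\<close> can be approximated into the
        preimages of the \<open>U a\<close>. The order matters because \<open>f\<close> itself may
        be discontinuous.\<close>
      have "\<exists>h\<in>H. \<forall>b\<in>g ` S. act h b \<in> (\<Inter>a\<in>{a\<in>S. g a = b}. U a)"
      proof (rule nbhd)
        show "f \<in> E" using fg by (simp add: I_def)
        show "g ` S \<subseteq> A" using S IW[OF fg(2)] WA by blast
        show "openin X (\<Inter>a\<in>{a\<in>S. g a = b}. U a) \<and> f b \<in> (\<Inter>a\<in>{a\<in>S. g a = b}. U a)"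
          if "b \<in> g ` S" for b
        proof
          show "openin X (\<Inter>a\<in>{a\<in>S. g a = b}. U a)"
            using that S(1) U'(1) by (intro openin_INT2) auto
          show "f b \<in> (\<Inter>a\<in>{a\<in>S. g a = b}. U a)" using U'(2) by blast
        qed
        show "finite (g ` S)" using S(1) by (rule finite_imageI)
      qed
      then obtain h where h: "h \<in> H" "\<And>a. a \<in> S \<Longrightarrow> act h (g a) \<in> U a" by blast
      have "\<exists>k\<in>H. \<forall>a\<in>S. act k a \<in> {x \<in> topspace X. act h x \<in> U a}"
      proof (rule nbhd)
        show "g \<in> E" using fg by (simp add: I_def)
        show "openin X {x \<in> topspace X. act h x \<in> U a} \<and> g a \<in> {x \<in> topspace X. act h x \<in> U a}"
          if "a \<in> S" for a
        proof
          show "openin X {x \<in> topspace X. act h x \<in> U a}"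
            by (rule openin_continuous_map_preimage[OF cont[OF h(1)] U'(1)[OF that]])
          show "g a \<in> {x \<in> topspace X. act h x \<in> U a}"
            using h(2)[OF that] IW[OF fg(2)] S(2) WX that by blast
        qed
      qed (fact S)+
      then obtain k where k: "k \<in> H" "\<And>a. a \<in> S \<Longrightarrow> act h (act k a) \<in> U a" by blast
      obtain l where "l \<in> H" "\<forall>x\<in>topspace X. act l x = act h (act k x)"
        using comp[OF h(1) k(1)] by blast
      then show "\<exists>h\<in>H. \<forall>a\<in>S. act h a \<in> U a" using k(2) S AX by (intro bexI[of _ l]) auto
    qed
    ultimately show "compose A f g \<in> I" by (simp add: I_def)
  next
    fix f g h assume "f \<in> I" "g \<in> I" "h \<in> I"
    then show "compose A (compose A f g) h = compose A f (compose A g h)"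
      by (intro ext) (simp add: compose_def IA)
  next
    fix g assume g: "g \<in> I"
    \<comment> \<open>In the coordinate \<open>a\<close> the right factor \<open>g\<close> merely
      selects the point \<open>g a\<close> of \<open>A\<close>, so the map is a projection of the
      product.\<close>
    show "continuous_map (subtopology P I) P (\<lambda>f. compose A f g)"
      unfolding P_def continuous_map_componentwise
    proof (intro conjI ballI)
      show "(\<lambda>f. compose A f g) ` topspace (subtopology (product_topology (\<lambda>_. X) A) I) \<subseteq> extensional A"
        by (auto simp: compose_def)
      fix a assume a: "a \<in> A"
      have "continuous_map (product_topology (\<lambda>_. X) A) X (\<lambda>f. f (g a))"
        using IW[OF g a] WA by (intro continuous_map_product_projection) auto
      then show "continuous_map (subtopology (product_topology (\<lambda>_. X) A) I) X (\<lambda>f. compose A f g a)"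
        using a by (simp add: compose_def continuous_map_from_subtopology)
    qed
  qed
  then obtain u where u: "u \<in> I" "compose A u u = u" by blast
  have yA: "y \<in> A" by (simp add: A_def)
  define w where "w = u y"
  have wW: "w \<in> W" using IW[OF u(1) yA] by (simp add: w_def)
  have uw: "u w = w" using u(2) yA by (metis compose_eq w_def)
  \<comment> \<open>Since \<open>u w = w = u y\<close>, a single \<open>h\<close> approximating
    \<open>u\<close> at \<open>w\<close> and at \<open>y\<close> brings both points close to
    \<open>w\<close>.\<close>
  have "(w, w) \<in> prod_topology X X closure_of ((\<lambda>h. (act h w, act h y)) ` H)"
    unfolding in_closure_of
  proof (intro conjI allI impI)
    show "(w, w) \<in> topspace (prod_topology X X)" using wW WX by auto
    fix Q assume Q: "(w, w) \<in> Q \<and> openin (prod_topology X X) Q"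
    then obtain U1 U2 where U: "openin X U1" "openin X U2" "w \<in> U1" "w \<in> U2" "U1 \<times> U2 \<subseteq> Q"
      unfolding openin_prod_topology_alt by blast
    have "\<exists>h\<in>H. \<forall>a\<in>{w, y}. act h a \<in> U1 \<inter> U2"
      by (rule nbhd[where f=u]) (use u U wW uw w_def in \<open>auto simp: I_def A_def\<close>)
    then show "\<exists>p. p \<in> (\<lambda>h. (act h w, act h y)) ` H \<and> p \<in> Q" using U by blast
  qed
  then show ?thesis using wW by blast
qed

section \<open>Topological groups and van Dantzig's theorem\<close>

lemma openin_inverse_image:
  assumes "continuous_map X X g" "\<And>x. x \<in> topspace X \<Longrightarrow> f x \<in> topspace X"
    "\<And>x. x \<in> topspace X \<Longrightarrow> g (f x) = x" "\<And>x. x \<in> topspace X \<Longrightarrow> f (g x) = x" "openin X S"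
  shows "openin X (f ` S)"
proof -
  have "f ` S = {x \<in> topspace X. g x \<in> S}"
    using assms openin_subset[OF assms(5)] by (force simp: image_iff)
  then show ?thesis using openin_continuous_map_preimage[OF assms(1,5)] by simp
qed

context group
begin

lemma conj_by_closed [simp]: "h \<in> carrier G \<Longrightarrow> x \<in> carrier G \<Longrightarrow> conj_by G h x \<in> carrier G"
  by (simp add: conj_by_def)

lemma conj_by_one [simp]: "x \<in> carrier G \<Longrightarrow> conj_by G \<one> x = x"
  by (simp add: conj_by_def)

lemma conj_by_one_right [simp]: "h \<in> carrier G \<Longrightarrow> conj_by G h \<one> = \<one>"
  by (simp add: conj_by_def)

lemma inv_mult_cancel [simp]:
  "x \<in> carrier G \<Longrightarrow> y \<in> carrier G \<Longrightarrow> inv x \<otimes> (x \<otimes> y) = y"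
  "x \<in> carrier G \<Longrightarrow> y \<in> carrier G \<Longrightarrow> x \<otimes> (inv x \<otimes> y) = y"
  by (simp_all add: m_assoc[symmetric])

lemma conj_by_mult:
  "h \<in> carrier G \<Longrightarrow> x \<in> carrier G \<Longrightarrow> y \<in> carrier G \<Longrightarrow>
     conj_by G h (x \<otimes> y) = conj_by G h x \<otimes> conj_by G h y"
  by (simp add: conj_by_def m_assoc)

lemma conj_by_inv:
  "h \<in> carrier G \<Longrightarrow> x \<in> carrier G \<Longrightarrow> conj_by G h (inv x) = inv (conj_by G h x)"
  by (simp add: conj_by_def inv_mult_group m_assoc)

lemma conj_by_comp:
  "h \<in> carrier G \<Longrightarrow> k \<in> carrier G \<Longrightarrow> x \<in> carrier G \<Longrightarrow>
     conj_by G (h \<otimes> k) x = conj_by G h (conj_by G k x)"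
  by (simp add: conj_by_def inv_mult_group m_assoc)

lemma conj_by_cancel [simp]:
  assumes "h \<in> carrier G" "x \<in> carrier G"
  shows "conj_by G (inv h) (conj_by G h x) = x" "conj_by G h (conj_by G (inv h) x) = x"
  using conj_by_comp[of "inv h" h x] conj_by_comp[of h "inv h" x] assms by simp_all

lemma conj_invariantD: "conj_invariant G H D \<Longrightarrow> h \<in> H \<Longrightarrow> x \<in> D \<Longrightarrow> conj_by G h x \<in> D"
  by (auto simp: conj_invariant_def)

text \<open>\<open>H\<close> contains inverses, so the inclusion for \<open>inv h\<close> supplies
  the reverse inclusion for \<open>h\<close>.\<close>

lemma conj_invariantI:
  assumes "subgroup H G" "D \<subseteq> carrier G" "\<And>h x. h \<in> H \<Longrightarrow> x \<in> D \<Longrightarrow> conj_by G h x \<in> D"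
  shows "conj_invariant G H D"
  unfolding conj_invariant_def
proof (intro ballI equalityI)
  fix h assume h: "h \<in> H"
  show "conj_by G h ` D \<subseteq> D" using assms h by blast
  show "D \<subseteq> conj_by G h ` D"
  proof
    fix x assume x: "x \<in> D"
    then have "conj_by G (inv h) x \<in> D" using assms h by (simp add: subgroup.m_inv_closed)
    moreover have "x = conj_by G h (conj_by G (inv h) x)"
      using assms h x by (metis conj_by_cancel(2) subgroup.mem_carrier subsetD)
    ultimately show "x \<in> conj_by G h ` D" by blast
  qed
qed

lemma conj_by_set_mult:
  assumes "h \<in> carrier G" "A \<subseteq> carrier G" "B \<subseteq> carrier G"
  shows "conj_by G h ` (A <#> B) = conj_by G h ` A <#> conj_by G h ` B"
proof -
  have *: "conj_by G h (a \<otimes> b) = conj_by G h a \<otimes> conj_by G h b" if "a \<in> A" "b \<in> B" for a b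
    using that assms by (intro conj_by_mult) auto
  show ?thesis
  proof (intro equalityI subsetI)
    fix x assume "x \<in> conj_by G h ` (A <#> B)"
    then obtain a b where "a \<in> A" "b \<in> B" "x = conj_by G h (a \<otimes> b)"
      unfolding set_mult_def by blast
    then show "x \<in> conj_by G h ` A <#> conj_by G h ` B"
      using *[of a b] unfolding set_mult_def by blast
  next
    fix x assume "x \<in> conj_by G h ` A <#> conj_by G h ` B"
    then obtain a b where "a \<in> A" "b \<in> B" "x = conj_by G h a \<otimes> conj_by G h b"
      unfolding set_mult_def by blast
    then show "x \<in> conj_by G h ` (A <#> B)"
      using *[of a b, symmetric] unfolding set_mult_def by blast
  qed
qed

lemma conj_by_l_coset:
  assumes "h \<in> carrier G" "x \<in> carrier G" "D \<subseteq> carrier G" "conj_by G h ` D = D"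
  shows "conj_by G h ` (x <# D) = conj_by G h x <# D"
  using conj_by_set_mult[of h "{x}" D] assms by (simp add: l_coset_eq_set_mult)

lemma l_coset_eq_iff:
  assumes "subgroup D G" "x \<in> carrier G" "y \<in> carrier G"
  shows "x <# D = y <# D \<longleftrightarrow> inv x \<otimes> y \<in> D"
proof
  assume "x <# D = y <# D"
  then have "y \<in> x <# D" using assms lcos_self by blast
  then obtain d where "d \<in> D" "y = x \<otimes> d" by (auto simp: l_coset_def)
  then show "inv x \<otimes> y \<in> D" using assms by (simp add: m_assoc[symmetric] subgroup.mem_carrier)
next
  assume "inv x \<otimes> y \<in> D"
  moreover have "y = x \<otimes> (inv x \<otimes> y)" using assms by (simp add: m_assoc[symmetric])
  ultimately have "y \<in> x <# D" unfolding l_coset_def by blast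
  then show "x <# D = y <# D" using assms by (intro l_repr_independence)
qed

lemma mem_set_mult_subgroup_iff:
  assumes "subgroup D G" "A \<subseteq> carrier G" "x \<in> carrier G"
  shows "x \<in> A <#> D \<longleftrightarrow> (\<exists>a\<in>A. x <# D = a <# D)"
proof
  assume "x \<in> A <#> D"
  then obtain a d where "a \<in> A" "d \<in> D" "x = a \<otimes> d" by (auto simp: set_mult_def)
  moreover from this have "x \<in> a <# D" by (auto simp: l_coset_def)
  ultimately show "\<exists>a\<in>A. x <# D = a <# D"
    using assms l_repr_independence[of x a D] by (metis subsetD)
next
  assume "\<exists>a\<in>A. x <# D = a <# D"
  then obtain a where "a \<in> A" "x \<in> a <# D" using lcos_self[OF assms(3,1)] by auto
  then show "x \<in> A <#> D" by (auto simp: set_mult_def l_coset_def)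
qed

end

locale top_group = group G for G (structure) +
  fixes T
  assumes top_group: "hausdorff_topological_group G T"
begin

lemma topspace_T [simp]: "topspace T = carrier G"
  and cont_mult: "continuous_map (prod_topology T T) T (\<lambda>(x, y). x \<otimes> y)"
  and cont_inv: "continuous_map T T (\<lambda>x. inv x)"
  and Hausdorff_T: "Hausdorff_space T"
  using top_group by (auto simp: hausdorff_topological_group_def)

lemma cont_mult':
  "continuous_map X T f \<Longrightarrow> continuous_map X T g \<Longrightarrow> continuous_map X T (\<lambda>x. f x \<otimes> g x)"
  using continuous_map_compose[OF _ cont_mult, of X "\<lambda>x. (f x, g x)"]
  by (simp add: o_def continuous_map_pairwise)

lemma cont_inv': "continuous_map X T f \<Longrightarrow> continuous_map X T (\<lambda>x. inv (f x))"
  using continuous_map_compose[OF _ cont_inv, of X f] by (simp add: o_def)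

lemma cont_conj_by: "continuous_map (prod_topology T T) T (\<lambda>(h, x). conj_by G h x)"
  unfolding conj_by_def case_prod_unfold
  by (intro cont_mult' cont_inv' continuous_map_fst continuous_map_snd)

lemma cont_lmult: "x \<in> carrier G \<Longrightarrow> continuous_map T T (\<lambda>y. x \<otimes> y)"
  by (intro cont_mult') auto

lemma cont_rmult: "x \<in> carrier G \<Longrightarrow> continuous_map T T (\<lambda>y. y \<otimes> x)"
  by (intro cont_mult') auto

lemma cont_conj_by1: "h \<in> carrier G \<Longrightarrow> continuous_map T T (conj_by G h)"
  unfolding conj_by_def[abs_def] by (intro cont_mult' cont_inv') auto

lemma compactin_set_mult:
  "compactin T A \<Longrightarrow> compactin T B \<Longrightarrow> compactin T (A <#> B)"
proof -
  have eq: "A <#> B = (\<lambda>(x, y). x \<otimes> y) ` (A \<times> B)" by (auto simp: set_mult_def)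
  show "compactin T A \<Longrightarrow> compactin T B \<Longrightarrow> compactin T (A <#> B)"
    unfolding eq by (rule compactin_continuous_image_Times[OF cont_mult])
qed

end

section \<open>Closed subgroups of totally disconnected locally compact groups\<close>

locale tdlc_subgroup = top_group G T for G (structure) and T +
  fixes K
  assumes td: "totally_disconnected_space T" and lc: "locally_compact_space T"
    and K: "subgroup K G" and K_closed: "closedin T K"
begin

abbreviation "TK \<equiv> subtopology T K"

lemma K_sub: "K \<subseteq> carrier G" using K by (rule subgroup.subset)

lemma K_carrier [simp]: "x \<in> K \<Longrightarrow> x \<in> carrier G" using K_sub by blast

lemma K_mult [simp]: "x \<in> K \<Longrightarrow> y \<in> K \<Longrightarrow> x \<otimes> y \<in> K" using K by (rule subgroup.m_closed)

lemma K_inv [simp]: "x \<in> K \<Longrightarrow> inv x \<in> K" using K by (rule subgroup.m_inv_closed)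

lemma K_one [simp]: "\<one> \<in> K" using K by (rule subgroup.one_closed)

lemma topspace_TK [simp]: "topspace TK = K" using K_sub by auto

lemma carrier_Int_K [simp]: "carrier G \<inter> K = K" using K_sub by blast

lemma openin_TK_subset: "openin TK V \<Longrightarrow> V \<subseteq> K" using openin_subset by fastforce

lemma Hausdorff_TK: "Hausdorff_space TK" by (simp add: Hausdorff_T Hausdorff_space_subtopology)

lemma lc_TK: "locally_compact_space TK"
  by (simp add: K_closed lc locally_compact_space_closed_subset)

lemma compactin_TK: "compactin TK V \<longleftrightarrow> compactin T V \<and> V \<subseteq> K"
  by (simp add: compactin_subtopology)

lemma cont_TK: "continuous_map T T f \<Longrightarrow> (\<And>x. x \<in> K \<Longrightarrow> f x \<in> K) \<Longrightarrow> continuous_map TK TK f"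
  by (simp add: continuous_map_in_subtopology continuous_map_from_subtopology image_subset_iff)

lemma openin_lmult: 
  assumes "x \<in> K" "openin TK V" shows "openin TK ((\<lambda>y. x \<otimes> y) ` V)"
  by (rule openin_inverse_image[of _ "\<lambda>y. inv x \<otimes> y"])
    (use assms in \<open>auto simp: m_assoc[symmetric] intro!: cont_TK cont_lmult\<close>)

lemma openin_rmult: 
  assumes "x \<in> K" "openin TK V" shows "openin TK ((\<lambda>y. y \<otimes> x) ` V)"
  by (rule openin_inverse_image[of _ "\<lambda>y. y \<otimes> inv x"])
    (use assms in \<open>auto simp: m_assoc intro!: cont_TK cont_rmult\<close>)

lemma openin_set_mult_left:
  assumes "openin TK V" "D \<subseteq> K" shows "openin TK (V <#> D)"
proof -
  have "V <#> D = (\<Union>d\<in>D. (\<lambda>y. y \<otimes> d) ` V)" by (auto simp: set_mult_def)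
  then show ?thesis using assms by (auto intro!: openin_Union openin_rmult)
qed

lemma openin_set_mult_right:
  assumes "openin TK V" "D \<subseteq> K" shows "openin TK (D <#> V)"
proof -
  have "D <#> V = (\<Union>d\<in>D. (\<lambda>y. d \<otimes> y) ` V)" by (auto simp: set_mult_def)
  then show ?thesis using assms by (auto intro!: openin_Union openin_lmult)
qed

text \<open>The tube lemma relative to \<open>K\<close>. The parameter space \<open>X\<close> is
  kept arbitrary because the parameters come from \<open>K\<close>, from \<open>H\<close> or from a
  product of groups.\<close>

lemma openin_tube_TK:
  assumes f: "continuous_map (prod_topology X T) T f" and C: "compactin X C"
    and fK: "\<And>c y. c \<in> C \<Longrightarrow> y \<in> K \<Longrightarrow> f (c, y) \<in> K" and O: "openin TK V"
  shows "openin TK {y \<in> K. \<forall>c\<in>C. f (c, y) \<in> V}"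
proof -
  obtain V' where V': "openin T V'" "V = V' \<inter> K" using O by (auto simp: openin_subtopology)
  have "openin T {y \<in> topspace T. \<forall>c\<in>C. f (c, y) \<in> V'}" by (rule openin_tube[OF f C V'(1)])
  moreover have "{y \<in> K. \<forall>c\<in>C. f (c, y) \<in> V} = {y \<in> topspace T. \<forall>c\<in>C. f (c, y) \<in> V'} \<inter> K"
    using V' fK K_sub by auto
  ultimately show ?thesis by (auto simp: openin_subtopology)
qed

text \<open>The complement is a union of left translates of \<open>U\<close>, hence open.\<close>

lemma open_subgroup_closed:
  assumes "subgroup U G" "openin TK U" shows "closedin TK U"
proof -
  have UK: "U \<subseteq> K" using assms openin_TK_subset by blast
  have "K - U = (K - U) <#> U"
  proof
    show "K - U \<subseteq> (K - U) <#> U"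
    proof
      fix x assume "x \<in> K - U"
      then have "x = x \<otimes> \<one>" "\<one> \<in> U" using assms(1) by (auto simp: subgroup.one_closed)
      with \<open>x \<in> K - U\<close> show "x \<in> (K - U) <#> U" unfolding set_mult_def by blast
    qed
    show "(K - U) <#> U \<subseteq> K - U"
    proof
      fix x assume "x \<in> (K - U) <#> U"
      then obtain k u where ku: "k \<in> K" "k \<notin> U" "u \<in> U" "x = k \<otimes> u" by (auto simp: set_mult_def)
      have "x \<notin> U"
      proof
        assume "x \<in> U"
        then have "x \<otimes> inv u \<in> U" using assms ku by (simp add: subgroup.m_closed subgroup.m_inv_closed)
        then show False using ku UK by (auto simp: m_assoc subset_iff)
      qed
      then show "x \<in> K - U" using ku UK by auto
    qed
  qed
  moreover have "(K - U) <#> U = (\<Union>k\<in>K-U. (\<lambda>u. k \<otimes> u) ` U)" by (auto simp: set_mult_def)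
  moreover have "openin TK (\<Union>k\<in>K-U. (\<lambda>u. k \<otimes> u) ` U)"
    using assms by (auto intro!: openin_Union openin_lmult)
  ultimately show ?thesis using UK by (simp add: closedin_def)
qed

text \<open>Total disconnectedness makes \<open>{x}\<close> a compact connected component, and in a
  locally compact Hausdorff space such a component has arbitrarily small clopen neighbourhoods;
  those inside a compact set are compact.\<close>

lemma clopen_nbhd:
  assumes "openin TK V" "x \<in> V"
  obtains W where "openin TK W" "compactin T W" "x \<in> W" "W \<subseteq> V"
proof -
  obtain U C where UC: "openin TK U" "compactin TK C" "x \<in> U" "U \<subseteq> C" "C \<subseteq> V"
  proof -
    have "neighbourhood_base_of (compactin TK) TK"
      using lc_TK Hausdorff_TK by (simp add: locally_compact_space_neighbourhood_base)
    then have "\<exists>U C. openin TK U \<and> compactin TK C \<and> x \<in> U \<and> U \<subseteq> C \<and> C \<subseteq> V"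
      using assms unfolding neighbourhood_base_of by blast
    then show ?thesis using that by blast
  qed
  have xK: "x \<in> K" using assms openin_TK_subset by blast
  have "connected_component_of_set TK x = {x}"
  proof -
    have "connectedin T (connected_component_of_set TK x)"
      using connectedin_connected_component_of[of TK x] by (simp add: connectedin_subtopology)
    moreover have "x \<in> connected_component_of_set TK x"
      using xK by (simp add: connected_component_of_refl)
    moreover obtain a where "connected_component_of_set TK x \<subseteq> {a}"
      using td calculation(1) unfolding totally_disconnected_space_def by auto
    ultimately show ?thesis by blast
  qed
  then have "{x} \<in> connected_components_of TK"
    using xK by (metis connected_component_in_connected_components_of topspace_TK)
  then obtain W W' where W: "openin TK W" "openin TK W'" "disjnt W W'" "W \<union> W' = topspace TK"
      "{x} \<subseteq> W" "W \<subseteq> U"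
    using wilder_locally_compact_component_thm[OF lc_TK Hausdorff_TK, of "{x}" U] UC xK
    by (auto simp: finite_imp_compactin)
  have "W = topspace TK - W'" using W by (auto simp: disjnt_iff)
  then have "closedin TK W" using W(2) by (metis closedin_diff closedin_topspace)
  then have "compactin TK W" using closed_compactin[OF UC(2)] W UC by blast
  then show ?thesis using that[of W] W UC by (auto simp: compactin_TK)
qed

text \<open>The \<open>g\<close> with \<open>V g = V\<close>; imposing the condition on
  \<open>inv g\<close> as well makes this a group for every subset \<open>V\<close> of
  \<open>K\<close>.\<close>

definition "right_stab V = {g \<in> K. \<forall>x\<in>V. x \<otimes> g \<in> V \<and> x \<otimes> inv g \<in> V}"

lemma subgroup_right_stab:
  assumes "V \<subseteq> K" shows "subgroup (right_stab V) G"
proof (rule subgroupI)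
  show "right_stab V \<noteq> {}" using assms by (auto simp: right_stab_def intro!: exI[of _ \<one>])
  fix a b assume "a \<in> right_stab V" "b \<in> right_stab V"
  then show "a \<otimes> b \<in> right_stab V"
    using assms by (auto simp: right_stab_def inv_mult_group m_assoc[symmetric] subset_iff)
qed (auto simp: right_stab_def)

lemma openin_right_stab:
  assumes "openin TK V" "compactin T V" shows "openin TK (right_stab V)"
proof -
  have VK: "V \<subseteq> K" using assms openin_TK_subset by blast
  have "openin TK {g \<in> K. \<forall>x\<in>V. (\<lambda>(x, g). x \<otimes> g) (x, g) \<in> V}"
    by (rule openin_tube_TK[OF cont_mult assms(2) _ assms(1)]) (use VK in auto)
  moreover have "openin TK {g \<in> K. \<forall>x\<in>V. (\<lambda>(x, g). x \<otimes> inv g) (x, g) \<in> V}"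
  proof (rule openin_tube_TK[OF _ assms(2) _ assms(1)])
    show "continuous_map (prod_topology T T) T (\<lambda>(x, g). x \<otimes> inv g)"
      unfolding case_prod_unfold by (intro cont_mult' cont_inv' continuous_map_fst continuous_map_snd)
  qed (use VK in auto)
  ultimately have "openin TK ({g \<in> K. \<forall>x\<in>V. x \<otimes> g \<in> V} \<inter> {g \<in> K. \<forall>x\<in>V. x \<otimes> inv g \<in> V})"
    by (simp add: openin_Int)
  moreover have "{g \<in> K. \<forall>x\<in>V. x \<otimes> g \<in> V} \<inter> {g \<in> K. \<forall>x\<in>V. x \<otimes> inv g \<in> V} = right_stab V"
    by (auto simp: right_stab_def)
  ultimately show ?thesis by simp
qed

lemma right_stab_subset: "\<one> \<in> V \<Longrightarrow> right_stab V \<subseteq> V"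
  by (auto simp: right_stab_def)

lemma open_subgroup_compact:
  assumes "subgroup U G" "openin TK U" "U \<subseteq> V" "compactin T V"
  shows "U \<in> compact_open_subgroups G T K"
proof -
  have "closedin T U" using open_subgroup_closed[OF assms(1,2)] K_closed closedin_trans_full by blast
  then have "compactin T U" using assms closed_compactin by blast
  then show ?thesis using assms by (simp add: compact_open_subgroups_def)
qed

text \<open>A compact open neighbourhood \<open>W\<close> of \<open>\<one>\<close> has an open
  stabilizer under right translation, and applying the stabilizer to \<open>\<one>\<close> shows
  that it lies in \<open>W\<close>.\<close>

lemma van_Dantzig:
  assumes "openin TK V" "\<one> \<in> V"
  obtains U where "U \<in> compact_open_subgroups G T K" "U \<subseteq> V"
proof -
  obtain W where W: "openin TK W" "compactin T W" "\<one> \<in> W" "W \<subseteq> V"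
    using clopen_nbhd[OF assms] .
  have "right_stab W \<in> compact_open_subgroups G T K"
    by (rule open_subgroup_compact[OF subgroup_right_stab openin_right_stab right_stab_subset])
      (use W openin_TK_subset in auto)
  then show ?thesis using that right_stab_subset W by blast
qed

lemma compact_open_subgroupsD:
  assumes "U \<in> compact_open_subgroups G T K"
  shows "subgroup U G" "openin TK U" "compactin T U" "U \<subseteq> K" "\<one> \<in> U"
proof -
  show *: "subgroup U G" "openin TK U" "compactin T U"
    using assms unfolding compact_open_subgroups_def by blast+
  show "U \<subseteq> K" using *(2) by (rule openin_TK_subset)
  show "\<one> \<in> U" using *(1) by (rule subgroup.one_closed)
qed

end

section \<open>Coset spaces\<close>

locale conj_action = tdlc_subgroup G T K for G (structure) and T K +
  fixes H
  assumes H: "subgroup H G" and H_K: "conj_invariant G H K"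
begin

lemma H_carrier [simp]: "h \<in> H \<Longrightarrow> h \<in> carrier G"
  using H by (rule subgroup.mem_carrier)

lemma H_mult [simp]: "h \<in> H \<Longrightarrow> k \<in> H \<Longrightarrow> h \<otimes> k \<in> H"
  using H by (rule subgroup.m_closed)

lemma H_inv [simp]: "h \<in> H \<Longrightarrow> inv h \<in> H"
  using H by (rule subgroup.m_inv_closed)

lemma H_one [simp]: "\<one> \<in> H"
  using H by (rule subgroup.one_closed)

lemma conj_by_K [simp]: "h \<in> H \<Longrightarrow> x \<in> K \<Longrightarrow> conj_by G h x \<in> K"
  using H_K by (rule conj_invariantD)

lemma openin_conj_by:
  assumes "h \<in> H" "openin TK V" shows "openin TK (conj_by G h ` V)"
  by (rule openin_inverse_image[of _ "conj_by G (inv h)"])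
    (use assms in \<open>auto intro!: cont_TK cont_conj_by1\<close>)

text \<open>The largest \<open>H\<close>-invariant subset of \<open>V \<inter> K\<close>.\<close>

definition "core V = {x \<in> K. \<forall>h\<in>H. conj_by G h x \<in> V}"

lemma core_subset: "core V \<subseteq> V"
proof
  fix x assume "x \<in> core V"
  then have "conj_by G \<one> x \<in> V" "x \<in> K" unfolding core_def using H_one by blast+
  then show "x \<in> V" by simp
qed

lemma core_invariant: "conj_invariant G H (core V)"
proof (rule conj_invariantI[OF H])
  show "core V \<subseteq> carrier G" using K_sub by (auto simp: core_def)
  fix h x assume h: "h \<in> H" and x: "x \<in> core V"
  have "conj_by G k (conj_by G h x) \<in> V" if "k \<in> H" for k
  proof -
    have "conj_by G (k \<otimes> h) x \<in> V" using x H_mult[OF that h] by (simp add: core_def)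
    then show ?thesis using conj_by_comp[of k h x] x h that by (simp add: core_def)
  qed
  then show "conj_by G h x \<in> core V" using h x by (simp add: core_def)
qed

lemma closed_inv_subgroupsD:
  assumes "D \<in> closed_inv_subgroups G T H K"
  shows "subgroup D G" "closedin TK D" "conj_invariant G H D" "D \<subseteq> K"
    "\<And>h x. h \<in> H \<Longrightarrow> x \<in> D \<Longrightarrow> conj_by G h x \<in> D"
  using assms closedin_subset[of TK D] by (auto simp: closed_inv_subgroups_def conj_invariantD)

lemma open_inv_subgroup_closed:
  "U \<in> open_inv_subgroups G T H K \<Longrightarrow> U \<in> closed_inv_subgroups G T H K"
  using open_subgroup_closed by (auto simp: open_inv_subgroups_def closed_inv_subgroups_def)

lemma lcosets_eq: "lcosets\<^bsub>G\<lparr>carrier := K\<rparr>\<^esub> D = (\<lambda>x. x <# D) ` K"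
  by (auto simp: LCOSETS_def l_coset_def)

context
  fixes D assumes D: "D \<in> closed_inv_subgroups G T H K"
begin

lemma topspace_coset: "topspace (coset_space G T K D) = (\<lambda>x. x <# D) ` K"
  using topspace_coset_space[OF is_group K _ _ closed_inv_subgroupsD(4)[OF D]] closed_inv_subgroupsD(1)[OF D] K_sub
  by (simp add: lcosets_eq)

lemma openin_coset_iff:
  "openin (coset_space G T K D) \<V> \<longleftrightarrow> \<V> \<subseteq> (\<lambda>x. x <# D) ` K \<and> openin TK (\<Union>\<V>)"
  using openin_coset_space[OF is_group K _ _ closed_inv_subgroupsD(4)[OF D]] closed_inv_subgroupsD(1)[OF D] K_sub
  by (simp add: lcosets_eq)

lemma mem_coset_self: "x \<in> carrier G \<Longrightarrow> x \<in> x <# D"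
  using lcos_self closed_inv_subgroupsD(1)[OF D] by blast

lemma coset_eq_iff: "x \<in> K \<Longrightarrow> y \<in> K \<Longrightarrow> x <# D = y <# D \<longleftrightarrow> inv x \<otimes> y \<in> D"
  using l_coset_eq_iff[OF closed_inv_subgroupsD(1)[OF D]] by simp

lemma Union_cosets: "\<Union>((\<lambda>x. x <# D) ` S) = S <#> D"
  by (auto simp: set_mult_def l_coset_def)

lemma mem_set_mult_iff:
  "S \<subseteq> K \<Longrightarrow> x \<in> K \<Longrightarrow> x \<in> S <#> D \<longleftrightarrow> x <# D \<in> (\<lambda>x. x <# D) ` S"
  using mem_set_mult_subgroup_iff[OF closed_inv_subgroupsD(1)[OF D], of S x] K_sub by (auto simp: image_iff)

lemma openin_cosets: "openin TK S \<Longrightarrow> openin (coset_space G T K D) ((\<lambda>x. x <# D) ` S)"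
  unfolding openin_coset_iff Union_cosets
  using openin_set_mult_left openin_TK_subset closed_inv_subgroupsD(4)[OF D] by blast

lemma mem_Union_open_coset:
  assumes "openin (coset_space G T K D) \<V>" "x \<in> K"
  shows "x <# D \<in> \<V> \<longleftrightarrow> x \<in> \<Union>\<V>"
proof
  assume "x <# D \<in> \<V>"
  then show "x \<in> \<Union>\<V>" using mem_coset_self[of x] assms by auto
next
  assume "x \<in> \<Union>\<V>"
  then obtain y where y: "y \<in> K" "y <# D \<in> \<V>" "x \<in> y <# D"
    using assms by (auto simp: openin_coset_iff)
  then have "y <# D = x <# D"
    using l_repr_independence closed_inv_subgroupsD(1)[OF D] by simp
  then show "x <# D \<in> \<V>" using y by simp
qed

lemma continuous_coset_map: "continuous_map TK (coset_space G T K D) (\<lambda>x. x <# D)"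
  unfolding continuous_map_def
proof (intro conjI allI impI)
  show "(\<lambda>x. x <# D) \<in> topspace TK \<rightarrow> topspace (coset_space G T K D)" by (simp add: topspace_coset)
  fix \<V> assume V: "openin (coset_space G T K D) \<V>"
  then have "{x \<in> topspace TK. x <# D \<in> \<V>} = \<Union>\<V>"
    using mem_Union_open_coset[OF V] openin_TK_subset[of "\<Union>\<V>"] by (auto simp: openin_coset_iff)
  then show "openin TK {x \<in> topspace TK. x <# D \<in> \<V>}" using V by (simp add: openin_coset_iff)
qed

lemma conj_coset_eq: "h \<in> H \<Longrightarrow> x \<in> K \<Longrightarrow> conj_coset G h (x <# D) = conj_by G h x <# D"
  unfolding conj_coset_def
  using closed_inv_subgroupsD[OF D] K_sub by (intro conj_by_l_coset) (auto simp: conj_invariant_def)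

lemma continuous_conj_coset:
  assumes "h \<in> H"
  shows "continuous_map (coset_space G T K D) (coset_space G T K D) (conj_coset G h)"
  unfolding continuous_map_def
proof (intro conjI allI impI)
  show "conj_coset G h \<in> topspace (coset_space G T K D) \<rightarrow> topspace (coset_space G T K D)"
    using assms by (auto simp: topspace_coset conj_coset_eq)
  fix \<V> assume V: "openin (coset_space G T K D) \<V>"
  let ?S = "{x \<in> K. conj_by G h x \<in> \<Union>\<V>}"
  have "continuous_map TK TK (conj_by G h)" using assms by (intro cont_TK cont_conj_by1) auto
  then have "openin TK ?S"
    using V openin_continuous_map_preimage[of TK TK "conj_by G h" "\<Union>\<V>"] by (simp add: openin_coset_iff)
  moreover have "{c \<in> topspace (coset_space G T K D). conj_coset G h c \<in> \<V>} = (\<lambda>x. x <# D) ` ?S"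
    using assms mem_Union_open_coset[OF V] by (auto simp: topspace_coset conj_coset_eq)
  ultimately show "openin (coset_space G T K D) {c \<in> topspace (coset_space G T K D). conj_coset G h c \<in> \<V>}"
    by (simp add: openin_cosets)
qed

text \<open>For distinct cosets \<open>inv x \<otimes> y\<close> lies outside the closed set
  \<open>D\<close>, and so does \<open>inv x \<otimes> u \<otimes> y\<close> for all
  \<open>u\<close> in a small compact open subgroup \<open>U\<close>. Then \<open>U x D\<close> and
  \<open>U y D\<close> are disjoint, because a common coset would give such a \<open>u\<close> of
  the form \<open>inv u' \<otimes> v'\<close> with \<open>u'\<close>, \<open>v'\<close> in
  \<open>U\<close>.\<close>

lemma Hausdorff_coset_space: "Hausdorff_space (coset_space G T K D)"
  unfolding Hausdorff_space_def
proof (intro allI impI)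
  fix c c' assume "c \<in> topspace (coset_space G T K D) \<and> c' \<in> topspace (coset_space G T K D) \<and> c \<noteq> c'"
  then obtain x y where xy: "x \<in> K" "c = x <# D" "y \<in> K" "c' = y <# D" and "x <# D \<noteq> y <# D"
    by (auto simp: topspace_coset)
  then have xyD: "inv x \<otimes> y \<notin> D" by (simp add: coset_eq_iff)
  have "continuous_map TK TK (\<lambda>u. inv x \<otimes> u \<otimes> y)"
    using xy by (intro cont_TK cont_mult') auto
  then have "openin TK {u \<in> topspace TK. inv x \<otimes> u \<otimes> y \<in> K - D}"
    by (rule openin_continuous_map_preimage)
      (use closed_inv_subgroupsD(2)[OF D] in \<open>metis closedin_def topspace_TK\<close>)
  moreover have "\<one> \<in> {u \<in> topspace TK. inv x \<otimes> u \<otimes> y \<in> K - D}" using xy xyD by simp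
  ultimately obtain U where U: "U \<in> compact_open_subgroups G T K"
      "U \<subseteq> {u \<in> topspace TK. inv x \<otimes> u \<otimes> y \<in> K - D}"
    by (rule van_Dantzig)
  note U' = compact_open_subgroupsD[OF U(1)]
  have open': "openin TK (U <#> {z})" if "z \<in> K" for z
    using that U' by (intro openin_set_mult_left) auto
  have mem: "z \<in> U <#> {z}" if "z \<in> K" for z
    using U'(5) that by (auto simp: set_mult_def intro!: bexI[of _ \<one>])
  have "disjnt ((\<lambda>x. x <# D) ` (U <#> {x})) ((\<lambda>x. x <# D) ` (U <#> {y}))"
  proof (rule ccontr)
    assume "\<not> ?thesis"
    then obtain c s t where "s \<in> U <#> {x}" "t \<in> U <#> {y}" "c = s <# D" "c = t <# D"
      unfolding disjnt_iff by blast
    then have "s \<in> U <#> {x}" "t \<in> U <#> {y}" "t <# D = s <# D" by simp_all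
    then obtain u v where uv: "u \<in> U" "v \<in> U" "(v \<otimes> y) <# D = (u \<otimes> x) <# D"
      unfolding set_mult_def by blast
    have K': "u \<in> K" "v \<in> K" using uv U'(4) by auto
    have "inv (u \<otimes> x) \<otimes> (v \<otimes> y) \<in> D"
      using uv(3) xy K' coset_eq_iff[of "u \<otimes> x" "v \<otimes> y"] by simp
    moreover have "inv (u \<otimes> x) \<otimes> (v \<otimes> y) = inv x \<otimes> (inv u \<otimes> v) \<otimes> y"
      using xy K' by (simp add: inv_mult_group m_assoc)
    moreover have "inv u \<otimes> v \<in> U" using uv U'(1) by (simp add: subgroup.m_closed subgroup.m_inv_closed)
    ultimately show False using U(2) by auto
  qed
  then show "\<exists>U V. openin (coset_space G T K D) U \<and> openin (coset_space G T K D) V \<and>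
      c \<in> U \<and> c' \<in> V \<and> disjnt U V"
    using open' mem xy openin_cosets by (metis imageI)
qed

text \<open>The sets \<open>V <#> D\<close> with \<open>V\<close> open are the preimages of the open
  sets of cosets, and one \<open>V\<close> serves both coordinates because the limit lies on the
  diagonal.\<close>

lemma closure_coset_space_iff:
  assumes "x \<in> K" "y \<in> K" "z \<in> K"
  shows "(z <# D, z <# D) \<in> prod_topology (coset_space G T K D) (coset_space G T K D) closure_of
           ((\<lambda>h. (conj_coset G h (x <# D), conj_coset G h (y <# D))) ` H) \<longleftrightarrow>
         (\<forall>V. openin TK V \<and> z \<in> V \<longrightarrow> (\<exists>h\<in>H. conj_by G h x \<in> V <#> D \<and> conj_by G h y \<in> V <#> D))"
    (is "?L \<longleftrightarrow> ?R")
proof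
  let ?X = "coset_space G T K D"
  assume L: ?L
  show ?R
  proof (intro allI impI)
    fix V assume V: "openin TK V \<and> z \<in> V"
    let ?V = "(\<lambda>x. x <# D) ` V"
    have VK: "V \<subseteq> K" using V openin_TK_subset by blast
    have "(z <# D, z <# D) \<in> ?V \<times> ?V" "openin (prod_topology ?X ?X) (?V \<times> ?V)"
      using V openin_cosets by (auto simp: openin_prod_Times_iff)
    then obtain p where "p \<in> (\<lambda>h. (conj_coset G h (x <# D), conj_coset G h (y <# D))) ` H" "p \<in> ?V \<times> ?V"
      using L[unfolded in_closure_of, THEN conjunct2, rule_format, of "?V \<times> ?V"] by auto
    then obtain h where h: "h \<in> H" "conj_coset G h (x <# D) \<in> ?V" "conj_coset G h (y <# D) \<in> ?V"
      by blast
    then have "conj_by G h x \<in> V <#> D" "conj_by G h y \<in> V <#> D"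
      using assms mem_set_mult_iff[OF VK] by (simp_all add: conj_coset_eq)
    then show "\<exists>h\<in>H. conj_by G h x \<in> V <#> D \<and> conj_by G h y \<in> V <#> D" using h by blast
  qed
next
  let ?X = "coset_space G T K D"
  assume R: ?R
  show ?L
    unfolding in_closure_of
  proof (intro conjI allI impI)
    show "(z <# D, z <# D) \<in> topspace (prod_topology ?X ?X)" using assms by (simp add: topspace_coset)
    fix Q assume Q: "(z <# D, z <# D) \<in> Q \<and> openin (prod_topology ?X ?X) Q"
    then obtain V1 V2 where V: "openin ?X V1" "openin ?X V2" "z <# D \<in> V1" "z <# D \<in> V2" "V1 \<times> V2 \<subseteq> Q"
      unfolding openin_prod_topology_alt by blast
    define \<V> where "\<V> = V1 \<inter> V2"
    have \<V>: "openin ?X \<V>" "z <# D \<in> \<V>" using V by (auto simp: \<V>_def)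
    then have "openin TK (\<Union>\<V>)" "z \<in> \<Union>\<V>"
      using mem_Union_open_coset[OF \<V>(1) assms(3)] by (auto simp: openin_coset_iff)
    then obtain h where h: "h \<in> H" "conj_by G h x \<in> \<Union>\<V> <#> D" "conj_by G h y \<in> \<Union>\<V> <#> D"
      using R by blast
    have VK: "\<Union>\<V> \<subseteq> K" using \<open>openin TK (\<Union>\<V>)\<close> openin_TK_subset by blast
    have "conj_by G h w <# D \<in> \<V>" if w: "w \<in> K" and "conj_by G h w \<in> \<Union>\<V> <#> D" for w
    proof -
      have "conj_by G h w <# D \<in> (\<lambda>x. x <# D) ` \<Union>\<V>"
        using that h(1) mem_set_mult_iff[OF VK] by simp
      then obtain v where "v \<in> \<Union>\<V>" "conj_by G h w <# D = v <# D" by blast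
      then show ?thesis using mem_Union_open_coset[OF \<V>(1), of v] VK by auto
    qed
    then have "conj_coset G h (x <# D) \<in> \<V>" "conj_coset G h (y <# D) \<in> \<V>"
      using h assms by (auto simp: conj_coset_eq)
    then show "\<exists>p. p \<in> (\<lambda>h. (conj_coset G h (x <# D), conj_coset G h (y <# D))) ` H \<and> p \<in> Q"
      using h V by (intro exI[of _ "(conj_coset G h (x <# D), conj_coset G h (y <# D))"]) (auto simp: \<V>_def)
  qed
qed

text \<open>Distality is moved from \<open>K/D\<close> to elements of \<open>K\<close>. In this form
  different subgroups \<open>D\<close> can be compared, since only the sets \<open>V <#> D\<close>
  and the conclusion change.\<close>

lemma distal_action_iff:
  "distal_action (coset_space G T K D) H (conj_coset G) \<longleftrightarrow>
     (\<forall>x\<in>K. \<forall>y\<in>K. \<forall>z\<in>K.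
        (\<forall>V. openin TK V \<and> z \<in> V \<longrightarrow> (\<exists>h\<in>H. conj_by G h x \<in> V <#> D \<and> conj_by G h y \<in> V <#> D)) \<longrightarrow>
        inv x \<otimes> y \<in> D)"
    (is "?L \<longleftrightarrow> ?R")
proof
  assume L: ?L
  show ?R
  proof (intro ballI impI)
    fix x y z assume xyz: "x \<in> K" "y \<in> K" "z \<in> K"
      and *: "\<forall>V. openin TK V \<and> z \<in> V \<longrightarrow> (\<exists>h\<in>H. conj_by G h x \<in> V <#> D \<and> conj_by G h y \<in> V <#> D)"
    then have "x <# D = y <# D"
      using L closure_coset_space_iff[OF xyz] unfolding distal_action_def topspace_coset by blast
    then show "inv x \<otimes> y \<in> D" using xyz coset_eq_iff by simp
  qed
next
  assume R: ?R
  show ?L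
    unfolding distal_action_def topspace_coset
  proof (intro notI, elim bexE conjE exE)
    fix c c' e assume c: "c \<in> (\<lambda>x. x <# D) ` K" "c' \<in> (\<lambda>x. x <# D) ` K" "c \<noteq> c'"
      and e: "(e, e) \<in> prod_topology (coset_space G T K D) (coset_space G T K D) closure_of
           ((\<lambda>h. (conj_coset G h c, conj_coset G h c')) ` H)"
    obtain x y where xy: "x \<in> K" "y \<in> K" "c = x <# D" "c' = y <# D" using c by blast
    have "e \<in> topspace (coset_space G T K D)" using e by (simp add: in_closure_of)
    then obtain z where z: "z \<in> K" "e = z <# D" by (auto simp: topspace_coset)
    have "inv x \<otimes> y \<in> D"
      using R xy z e closure_coset_space_iff[OF xy(1,2) z(1)] by blast
    then show False using c xy coset_eq_iff by simp
  qed
qed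

lemma distal_action_at_iff:
  "distal_action_at (coset_space G T K D) H (conj_coset G) D \<longleftrightarrow>
     (\<forall>x\<in>K. (\<forall>V. openin TK V \<and> \<one> \<in> V \<longrightarrow> (\<exists>h\<in>H. conj_by G h x \<in> V <#> D)) \<longrightarrow> x \<in> D)"
proof -
  have one: "\<one> <# D = D" using subgroup.subset[OF closed_inv_subgroupsD(1)[OF D]] by (rule lcos_mult_one)
  have mem: "x <# D = D \<longleftrightarrow> x \<in> D" if "x \<in> K" for x
    using coset_eq_iff[of \<one> x] that by (auto simp: one)
  have clos: "D \<in> coset_space G T K D closure_of ((\<lambda>h. conj_coset G h (x <# D)) ` H) \<longleftrightarrow>
      (\<forall>V. openin TK V \<and> \<one> \<in> V \<longrightarrow> (\<exists>h\<in>H. conj_by G h x \<in> V <#> D))" (is "?L \<longleftrightarrow> ?R") if x: "x \<in> K" for x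
  proof
    assume L: ?L
    show ?R
    proof (intro allI impI)
      fix V assume V: "openin TK V \<and> \<one> \<in> V"
      then have "D \<in> (\<lambda>x. x <# D) ` V" "V \<subseteq> K" using one openin_TK_subset by (auto simp: image_iff)
      then obtain h where "h \<in> H" "conj_coset G h (x <# D) \<in> (\<lambda>x. x <# D) ` V"
        using L[unfolded in_closure_of, THEN conjunct2, rule_format, of "(\<lambda>x. x <# D) ` V"] openin_cosets V
        by auto
      then show "\<exists>h\<in>H. conj_by G h x \<in> V <#> D"
        using x \<open>V \<subseteq> K\<close> mem_set_mult_iff by (auto simp: conj_coset_eq)
    qed
  next
    assume R: ?R
    show ?L unfolding in_closure_of
    proof (intro conjI allI impI)
      show "D \<in> topspace (coset_space G T K D)" using one by (auto simp: topspace_coset intro!: image_eqI[of _ _ \<one>])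
      fix \<V> assume V: "D \<in> \<V> \<and> openin (coset_space G T K D) \<V>"
      then have V': "openin TK (\<Union>\<V>)" "\<one> \<in> \<Union>\<V>" "\<Union>\<V> \<subseteq> K"
        using mem_Union_open_coset[of \<V> \<one>] one openin_TK_subset by (auto simp: openin_coset_iff)
      then obtain h where h: "h \<in> H" "conj_by G h x \<in> \<Union>\<V> <#> D" using R by blast
      then have "conj_by G h x <# D \<in> (\<lambda>x. x <# D) ` \<Union>\<V>" using x V' mem_set_mult_iff by simp
      then obtain v where "v \<in> \<Union>\<V>" "conj_by G h x <# D = v <# D" by blast
      then have "conj_by G h x <# D \<in> \<V>" using mem_Union_open_coset[of \<V> v] V V' by auto
      then show "\<exists>y. y \<in> (\<lambda>h. conj_coset G h (x <# D)) ` H \<and> y \<in> \<V>"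
        using h x conj_coset_eq by (metis imageI)
    qed
  qed
  show ?thesis
    unfolding distal_action_at_def topspace_coset ball_simps
    by (intro ball_cong refl) (use clos mem in blast)
qed

end

end

section \<open>Small invariant neighbourhoods of distal subgroups\<close>

locale cg_conj_action = conj_action G T K H for G (structure) and T K H +
  assumes cg: "compactly_generated G T H"
begin

definition "stay S V = {x \<in> K. \<forall>k\<in>S. conj_by G k x \<in> V}"

text \<open>If the decreasing sequence \<open>stay (B n) V\<close> does not stabilize, points of \<open>stay (B n) V\<close> can
  be moved by a word of length \<open>n\<close> to the compact set of points of \<open>V\<close> that leave \<open>V\<close> at the next
  step; \<open>y\<close> is an accumulation point there.\<close>

lemma escaping_point:
  assumes V: "openin TK V" "compactin T V" and "\<not> openin TK (core V)"
  obtains B y where "\<And>n::nat. B n \<subseteq> B (Suc n)" "(\<Union>n. B n) = H" "\<And>n. compactin T (stay (B n) V)"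
    "y \<in> V" "y \<notin> core V" "\<And>n. \<exists>h\<in>H. conj_by G h y \<in> stay (B n) V"
proof -
  obtain C0 where C0: "compactin T C0" "C0 \<subseteq> H" "generate G C0 = H"
    using cg unfolding compactly_generated_def by blast
  \<comment> \<open>With inverses and the identity added, the powers \<open>B n\<close> of
    \<open>C\<close> are an increasing sequence of symmetric compact sets exhausting
    \<open>H\<close>.\<close>
  define C where "C = insert \<one> (C0 \<union> (\<lambda>x. inv x) ` C0)"
  have C: "compactin T C" "\<one> \<in> C" "C \<subseteq> H"
  proof -
    have "compactin T ((\<lambda>x. inv x) ` C0)" by (rule image_compactin[OF C0(1) cont_inv])
    then have "compactin T ({\<one>} \<union> (C0 \<union> (\<lambda>x. inv x) ` C0))"
      using C0(1) by (intro compactin_Un) (auto simp: finite_imp_compactin)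
    then show "compactin T C" by (simp add: C_def)
    show "\<one> \<in> C" by (simp add: C_def)
    show "C \<subseteq> H" using C0(2) by (auto simp: C_def)
  qed
  have Hc: "H \<subseteq> carrier G" using H by (rule subgroup.subset)
  have C_inv: "inv c \<in> C" if "c \<in> C" for c
    using that C0(2) Hc by (auto simp: C_def subset_iff)
  define B where "B n = ((\<lambda>S. C <#> S) ^^ n) {\<one>}" for n
  have B0: "B 0 = {\<one>}" and BS: "B (Suc n) = C <#> B n" for n by (simp_all add: B_def)
  have BH: "B n \<subseteq> H" for n
  proof (induction n)
    case (Suc n)
    then show ?case using C(3) unfolding BS set_mult_def by (auto simp: subset_iff)
  qed (simp add: B0)
  have Bcomp: "compactin T (B n)" for n
    by (induction n) (auto simp: B0 BS finite_imp_compactin C(1) compactin_set_mult)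
  have Cc: "C \<subseteq> carrier G" and Bc: "B n \<subseteq> carrier G" for n using C(3) BH Hc by auto
  \<comment> \<open>Letters have to be split off at both ends: \<open>WS\<close> and
    \<open>Ydec\<close> separate the one that acts first, \<open>Yne\<close> the one that acts
    last.\<close>
  have BS': "B (Suc n) = B n <#> C" for n
  proof (induction n)
    case 0
    have "C <#> {\<one>} = {\<one>} <#> C" using Cc by (force simp: set_mult_def)
    then show ?case by (simp add: BS B0)
  next
    case (Suc n)
    then show ?case using set_mult_assoc[OF Cc Bc Cc, of n] by (metis BS)
  qed
  have Bmono: "B n \<subseteq> B (Suc n)" for n
  proof
    fix x assume x: "x \<in> B n"
    then have "x = \<one> \<otimes> x" using Bc[of n] by auto
    then show "x \<in> B (Suc n)" using C(2) x unfolding BS set_mult_def by blast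
  qed
  have B1: "\<one> \<in> B n" for n
    by (induction n) (use B0 Bmono in auto)
  have Binv: "inv b \<in> B n" if "b \<in> B n" for b n
    using that
  proof (induction n arbitrary: b)
    case (Suc n)
    then obtain c d where cd: "c \<in> C" "d \<in> B n" "b = c \<otimes> d" by (auto simp: BS set_mult_def)
    then have "inv b = inv d \<otimes> inv c" using Cc Bc[of n] by (auto simp: inv_mult_group subset_iff)
    then show ?case using Suc.IH[OF cd(2)] C_inv[OF cd(1)] unfolding BS' set_mult_def by blast
  qed (simp add: B0)
  have Bmult: "a \<otimes> b \<in> B (m + n)" if "a \<in> B m" "b \<in> B n" for a b m n
    using that
  proof (induction m arbitrary: a)
    case 0
    then show ?case using Bc[of n] by (auto simp: B0)
  next
    case (Suc m)
    then obtain c d where cd: "c \<in> C" "d \<in> B m" "a = c \<otimes> d" by (auto simp: BS set_mult_def)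
    then have "a \<otimes> b = c \<otimes> (d \<otimes> b)" using Cc Bc[of n] Bc[of m] Suc.prems(2) by (auto simp: m_assoc subset_iff)
    then show ?case using Suc.IH[OF cd(2) Suc.prems(2)] cd(1)
      unfolding add_Suc BS set_mult_def by blast
  qed
  have UB: "(\<Union>n. B n) = H"
  proof
    show "(\<Union>n. B n) \<subseteq> H" using BH by blast
    have "subgroup (\<Union>n. B n) G"
    proof (rule subgroupI)
      show "(\<Union>n. B n) \<subseteq> carrier G" using Bc by blast
      show "(\<Union>n. B n) \<noteq> {}" using B1[of 0] by blast
      fix a assume "a \<in> (\<Union>n. B n)"
      then obtain m where a: "a \<in> B m" by blast
      then show "inv a \<in> (\<Union>n. B n)" using Binv[OF a] by blast
      fix b assume "b \<in> (\<Union>n. B n)"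
      then obtain n where b: "b \<in> B n" by blast
      then show "a \<otimes> b \<in> (\<Union>n. B n)" using Bmult[OF a b] by blast
    qed
    moreover have "C0 \<subseteq> (\<Union>n. B n)"
    proof
      fix c assume "c \<in> C0"
      then have "c \<in> C" "c = c \<otimes> \<one>" using Cc by (auto simp: C_def)
      then have "c \<in> B 1" using B0 unfolding One_nat_def BS set_mult_def by blast
      then show "c \<in> (\<Union>n. B n)" by blast
    qed
    ultimately have "generate G C0 \<subseteq> (\<Union>n. B n)" by (rule generate_subgroup_incl[rotated])
    then show "H \<subseteq> (\<Union>n. B n)" using C0 by simp
  qed
  define W where "W n = stay (B n) V" for n
  have VK: "V \<subseteq> K" using V openin_TK_subset by blast
  have BK: "conj_by G b x \<in> K" if "b \<in> B n" "x \<in> K" for b x n using that BH[of n] by auto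
  have Wopen: "openin TK (W n)" for n
  proof -
    have "openin TK {y \<in> K. \<forall>c\<in>B n. (\<lambda>(h, x). conj_by G h x) (c, y) \<in> V}"
      by (rule openin_tube_TK[OF cont_conj_by Bcomp _ V(1)]) (use BK in auto)
    then show ?thesis by (simp add: W_def stay_def)
  qed
  have WV: "W n \<subseteq> V" for n using B1[of n] by (force simp: W_def stay_def)
  have Wcl: "closedin TK (W n)" for n
  proof -
    have "W n = (\<Inter>k\<in>B n. {x \<in> topspace TK. conj_by G k x \<in> V})"
      using B1[of n] by (auto simp: W_def stay_def)
    moreover have "closedin TK {x \<in> topspace TK. conj_by G k x \<in> V}" if "k \<in> B n" for k
    proof (rule closedin_continuous_map_preimage)
      show "continuous_map TK TK (conj_by G k)" using that BH[of n] by (intro cont_TK cont_conj_by1) auto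
      show "closedin TK V" using V VK Hausdorff_TK by (simp add: compactin_TK compactin_imp_closedin)
    qed
    ultimately show ?thesis using B1[of n] by auto
  qed
  have Wcomp: "compactin TK (W n)" for n
    using closed_compactin[OF _ WV Wcl] V VK by (simp add: compactin_TK)
  have WS: "x \<in> W (Suc n) \<longleftrightarrow> x \<in> K \<and> (\<forall>c\<in>C. conj_by G c x \<in> W n)" for x n
  proof
    assume x: "x \<in> W (Suc n)"
    then have xK: "x \<in> K" by (simp add: W_def stay_def)
    moreover have "conj_by G c x \<in> W n" if c: "c \<in> C" for c
    proof -
      have "conj_by G b (conj_by G c x) \<in> V" if b: "b \<in> B n" for b
      proof -
        have "b \<otimes> c \<in> B (Suc n)" using b c unfolding BS' set_mult_def by blast
        then have "conj_by G (b \<otimes> c) x \<in> V" using x by (simp add: W_def stay_def)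
        then show ?thesis using conj_by_comp[of b c x] b c Bc[of n] Cc xK by (auto simp: subset_iff)
      qed
      moreover have "conj_by G c x \<in> K" using c C(3) xK by auto
      ultimately show ?thesis by (simp add: W_def stay_def)
    qed
    ultimately show "x \<in> K \<and> (\<forall>c\<in>C. conj_by G c x \<in> W n)" by blast
  next
    assume x: "x \<in> K \<and> (\<forall>c\<in>C. conj_by G c x \<in> W n)"
    have "conj_by G k x \<in> V" if k: "k \<in> B (Suc n)" for k
    proof -
      obtain b c where bc: "b \<in> B n" "c \<in> C" "k = b \<otimes> c" using k by (auto simp: BS' set_mult_def)
      then have "conj_by G b (conj_by G c x) \<in> V" using x by (auto simp: W_def stay_def)
      then show ?thesis using conj_by_comp[of b c x] bc Bc[of n] Cc x by (auto simp: subset_iff)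
    qed
    then show "x \<in> W (Suc n)" using x by (simp add: W_def stay_def)
  qed
  have W0: "W 0 = V" using VK by (auto simp: W_def stay_def B0)
  have Wdec: "W (Suc n) \<subseteq> W n" for n using Bmono by (auto simp: W_def stay_def)
  have core_eq: "core V = (\<Inter>n. W n)" 
  proof -
    have "core V = {x \<in> K. \<forall>k\<in>\<Union>n. B n. conj_by G k x \<in> V}" by (simp add: core_def UB)
    then show ?thesis unfolding W_def stay_def by blast
  qed
  \<comment> \<open>By \<open>WS\<close> each \<open>W n\<close> determines the next one, so a
    single repetition makes the sequence constant from there on; \<open>core V\<close> would then be
    the open set \<open>W n\<close>.\<close>
  have Wne: "W n \<noteq> W (Suc n)" for n
  proof
    assume eq: "W n = W (Suc n)"
    have *: "W (n + m) = W n" for m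
    proof (induction m)
      case (Suc m)
      have "x \<in> W (n + Suc m) \<longleftrightarrow> x \<in> W (Suc n)" for x using Suc WS by simp
      then show ?case using eq by blast
    qed simp
    have "W n \<subseteq> W m" for m
    proof (cases "n \<le> m")
      case True
      then show ?thesis using *[of "m - n"] by simp
    next
      case False
      then show ?thesis using lift_Suc_antimono_le[of W m n] Wdec by simp
    qed
    then have "core V = W n" unfolding core_eq by blast
    then show False using assms(3) Wopen by simp
  qed
  \<comment> \<open>The exit points, in \<open>V\<close> but not in \<open>W 1\<close>, that some
    element of \<open>B n\<close> reaches from \<open>W n\<close>. Applying the inverse element
    moves such a point into \<open>W n\<close>, as needed for \<open>y\<close>.\<close>
  define Y where "Y n = (V - W 1) \<inter> (\<lambda>(b, x). conj_by G b x) ` (B n \<times> W n)" for n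
  have Ycomp: "compactin TK (Y n)" for n
  proof -
    have "compactin T ((\<lambda>(b, x). conj_by G b x) ` (B n \<times> W n))"
      by (rule compactin_continuous_image_Times[OF cont_conj_by]) (use Bcomp Wcomp compactin_TK in auto)
    moreover have "(\<lambda>(b, x). conj_by G b x) ` (B n \<times> W n) \<subseteq> K" using BK[of _ n] WV[of n] VK by auto
    ultimately have "compactin TK ((\<lambda>(b, x). conj_by G b x) ` (B n \<times> W n))" by (simp add: compactin_TK)
    moreover have "closedin TK (V - W 1)" using Wcl[of 0] Wopen W0 by (simp add: closedin_diff)
    ultimately show ?thesis unfolding Y_def by (simp add: closed_Int_compactin)
  qed
  have Yne: "Y n \<noteq> {}" for n
  proof -
    obtain x where x: "x \<in> W n" "x \<notin> W (Suc n)" using Wne[of n] Wdec[of n] by blast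
    then have xK: "x \<in> K" using WV VK by blast
    then obtain k where k: "k \<in> B (Suc n)" "conj_by G k x \<notin> V"
      using x by (auto simp: W_def stay_def)
    then obtain c b where cb: "c \<in> C" "b \<in> B n" "k = c \<otimes> b" by (auto simp: BS set_mult_def)
    let ?y = "conj_by G b x"
    have "?y \<in> V" using x cb by (simp add: W_def stay_def)
    moreover have "conj_by G c ?y \<notin> V"
      using k cb conj_by_comp[of c b x] xK Cc Bc[of n] by (auto simp: subset_iff)
    then have "?y \<notin> W 1" using WS[of ?y 0] cb(1) W0 by auto
    ultimately have "?y \<in> Y n" using cb x unfolding Y_def by blast
    then show ?thesis by blast
  qed
  \<comment> \<open>Letting the first letter act moves the starting point from
    \<open>W (Suc n)\<close> to \<open>W n\<close> and leaves a word of length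
    \<open>n\<close>.\<close>
  have Ydec: "Y (Suc n) \<subseteq> Y n" for n
  proof
    fix y assume "y \<in> Y (Suc n)"
    then obtain b x where y: "y \<in> V - W 1" and b: "b \<in> B (Suc n)" and x: "x \<in> W (Suc n)" "y = conj_by G b x"
      by (auto simp: Y_def)
    obtain d c where dc: "d \<in> B n" "c \<in> C" "b = d \<otimes> c" using b by (auto simp: BS' set_mult_def)
    have "conj_by G c x \<in> W n" "x \<in> K" using x dc WS[of x n] by auto
    moreover have "y = conj_by G d (conj_by G c x)"
      using x(2) dc conj_by_comp[of d c x] \<open>x \<in> K\<close> Cc Bc[of n] by (auto simp: subset_iff)
    ultimately show "y \<in> Y n" using y dc(1) unfolding Y_def by blast
  qed
  have "(\<Inter>n. Y n) \<noteq> {}"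
    by (rule compactin_nest_nonempty[where F=Y, OF Hausdorff_TK Ycomp Yne Ydec])
  then obtain y where y: "\<And>n. y \<in> Y n" by blast
  show ?thesis
  proof (rule that[of B y])
    show "compactin T (stay (B n) V)" for n using Wcomp[of n] by (simp add: W_def compactin_TK)
    show "y \<in> V" using y[of 0] by (simp add: Y_def)
    show "y \<notin> core V" using y[of 0] unfolding Y_def core_eq by blast
    show "\<exists>h\<in>H. conj_by G h y \<in> stay (B n) V" for n
    proof -
      obtain b x where bx: "b \<in> B n" "x \<in> W n" "y = conj_by G b x" using y[of n] by (auto simp: Y_def)
      then have "conj_by G (inv b) y = x" using Bc[of n] WV VK by (auto simp: subset_iff)
      then show ?thesis using bx BH H_inv unfolding W_def by blast
    qed
  qed (use Bmono UB in auto)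
qed

text \<open>The set \<open>V = U D\<close> is a union of cosets of \<open>D\<close>, hence so are
  all sets of points staying in it. Membership in \<open>core V\<close> therefore depends only on
  the coset, and the pair that distality forces to coincide in \<open>K/D\<close> puts
  \<open>y\<close> into the core.\<close>

lemma distal_imp_small_invariant_subgroup:
  assumes D: "D \<in> closed_inv_subgroups G T H K" and Dcomp: "compactin T D"
    and distal: "distal_action (coset_space G T K D) H (conj_coset G)"
    and Q: "openin TK Q" "D \<subseteq> Q"
  obtains S where "S \<in> compact_open_subgroups G T K" "conj_invariant G H S" "D \<subseteq> S" "S \<subseteq> Q"
proof -
  note D' = closed_inv_subgroupsD[OF D]
  have Dc: "D \<subseteq> carrier G" using D'(1) by (rule subgroup.subset)
  have "openin TK {u \<in> K. \<forall>d\<in>D. (\<lambda>(d, u). u \<otimes> d) (d, u) \<in> Q}"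
  proof (rule openin_tube_TK[OF _ Dcomp _ Q(1)])
    show "continuous_map (prod_topology T T) T (\<lambda>(d, u). u \<otimes> d)"
      unfolding case_prod_unfold by (intro cont_mult' continuous_map_fst continuous_map_snd)
  qed (use D'(4) in auto)
  then obtain U where U: "U \<in> compact_open_subgroups G T K" "U \<subseteq> {u \<in> K. \<forall>d\<in>D. u \<otimes> d \<in> Q}"
    by (rule van_Dantzig) (use Q(2) Dc in \<open>simp_all add: subset_iff\<close>)
  note U' = compact_open_subgroupsD[OF U(1)]
  define V where "V = U <#> D"
  have VQ: "V \<subseteq> Q" using U(2) by (auto simp: V_def set_mult_def)
  have Vo: "openin TK V" unfolding V_def by (rule openin_set_mult_left[OF U'(2) D'(4)])
  have Vc: "compactin T V" unfolding V_def by (rule compactin_set_mult[OF U'(3) Dcomp])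
  have VK: "V \<subseteq> K" using Vo openin_TK_subset by blast
  have VD: "x \<otimes> d \<in> V" if xd: "x \<in> V" "d \<in> D" for x d
  proof -
    obtain u e where ue: "u \<in> U" "e \<in> D" "x = u \<otimes> e" using xd(1) by (auto simp: V_def set_mult_def)
    then have "x \<otimes> d = u \<otimes> (e \<otimes> d)" using that U'(4) Dc by (auto simp: m_assoc subset_iff)
    then show ?thesis using ue that(2) subgroup.m_closed[OF D'(1)] unfolding V_def set_mult_def by blast
  qed
  have V1: "\<one> \<in> V" using U'(5) subgroup.one_closed[OF D'(1)] by (force simp: V_def set_mult_def)
  have stayD: "x \<otimes> d \<in> stay S V" if "S \<subseteq> H" "x \<in> stay S V" "d \<in> D" for S x d
  proof -
    have "conj_by G k (x \<otimes> d) \<in> V" if "k \<in> S" for k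
    proof -
      have "conj_by G k (x \<otimes> d) = conj_by G k x \<otimes> conj_by G k d"
        using \<open>x \<in> stay S V\<close> \<open>d \<in> D\<close> \<open>S \<subseteq> H\<close> that Dc by (intro conj_by_mult) (auto simp: stay_def)
      moreover have "conj_by G k x \<in> V" using \<open>x \<in> stay S V\<close> that by (simp add: stay_def)
      moreover have "conj_by G k d \<in> D" using \<open>S \<subseteq> H\<close> \<open>d \<in> D\<close> that by (intro D'(5)) auto
      ultimately show ?thesis using VD by simp
    qed
    then show ?thesis using that D'(4) by (auto simp: stay_def)
  qed
  have core_stay: "core V = stay H V" by (simp add: core_def stay_def)
  have sat: "x' \<in> stay S V" if "S \<subseteq> H" "x \<in> stay S V" "x' \<in> K" "x <# D = x' <# D" for S x x'
  proof -
    have "x \<in> K" using that by (simp add: stay_def)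
    then have "inv x \<otimes> x' \<in> D" using that coset_eq_iff[OF D] by simp
    then have "x \<otimes> (inv x \<otimes> x') \<in> stay S V" using stayD that by blast
    then show ?thesis using \<open>x \<in> K\<close> that(3) by simp
  qed
  have core_open: "openin TK (core V)"
  proof (rule ccontr)
    assume "\<not> openin TK (core V)"
    then obtain B y where B: "\<And>n::nat. B n \<subseteq> B (Suc n)" "(\<Union>n. B n) = H" "\<And>n. compactin T (stay (B n) V)"
      and y: "y \<in> V" "y \<notin> core V" "\<And>n. \<exists>h\<in>H. conj_by G h y \<in> stay (B n) V"
      using escaping_point[OF Vo Vc] by metis
    have BH: "B n \<subseteq> H" for n using B by blast
    have sK: "stay S V \<subseteq> K" for S by (auto simp: stay_def)
    have yK: "y \<in> K" using y VK by blast
    let ?X = "coset_space G T K D" and ?q = "\<lambda>x. x <# D"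
    \<comment> \<open>The image of an intersection is the intersection of the images here because
      every \<open>stay (B n) V\<close> is a union of cosets.\<close>
    have eq: "?q ` core V = (\<Inter>n. ?q ` stay (B n) V)"
    proof
      show "?q ` core V \<subseteq> (\<Inter>n. ?q ` stay (B n) V)"
        using BH by (force simp: core_stay stay_def)
      show "(\<Inter>n. ?q ` stay (B n) V) \<subseteq> ?q ` core V"
      proof
        fix c assume c: "c \<in> (\<Inter>n. ?q ` stay (B n) V)"
        then obtain x where x: "x \<in> stay (B 0) V" "c = x <# D" by blast
        have xK: "x \<in> K" using x sK by blast
        have "x \<in> stay (B n) V" for n
        proof -
          have "c \<in> ?q ` stay (B n) V" using c by blast
          then show ?thesis using sat[OF BH _ xK] x by auto
        qed
        then have "x \<in> core V" using xK B(2) by (auto simp: core_def stay_def)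
        then show "c \<in> ?q ` core V" using x by blast
      qed
    qed
    have "\<exists>w\<in>?q ` core V. \<exists>z. (z, z) \<in> prod_topology ?X ?X closure_of
        ((\<lambda>h. (conj_coset G h w, conj_coset G h (?q y))) ` H)"
    proof (rule proximal_to_invariant_subset[OF Hausdorff_coset_space[OF D] continuous_conj_coset[OF D] _ _ _ _ eq])
      show "\<exists>l\<in>H. \<forall>x\<in>topspace ?X. conj_coset G l x = conj_coset G h (conj_coset G k x)"
        if "h \<in> H" "k \<in> H" for h k
        using that by (intro bexI[of _ "h \<otimes> k"]) (auto simp: topspace_coset[OF D] conj_coset_eq[OF D] conj_by_comp)
      show "conj_coset G h w \<in> ?q ` core V" if h: "h \<in> H" and w: "w \<in> ?q ` core V" for h w
      proof -
        obtain x where x: "x \<in> core V" "w = ?q x" using w by blast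
        then have "x \<in> K" by (simp add: core_def)
        then have "conj_coset G h w = ?q (conj_by G h x)" using x h conj_coset_eq[OF D] by simp
        then show ?thesis using conj_invariantD[OF core_invariant h x(1)] by blast
      qed
      show "compactin ?X (?q ` stay (B n) V)" for n
        by (rule image_compactin[OF _ continuous_coset_map[OF D]]) (use B sK in \<open>auto simp: compactin_TK\<close>)
      show "?q ` stay (B (Suc n)) V \<subseteq> ?q ` stay (B n) V" for n
        using B(1)[of n] by (intro image_mono) (auto simp: stay_def)
      show "?q y \<in> topspace ?X" using yK by (auto simp: topspace_coset[OF D])
      show "\<exists>h\<in>H. conj_coset G h (?q y) \<in> ?q ` stay (B n) V" for n
        using y(3)[of n] yK conj_coset_eq[OF D] by fastforce
    qed
    then obtain x z where x: "x \<in> core V" and z: "(z, z) \<in> prod_topology ?X ?X closure_of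
        ((\<lambda>h. (conj_coset G h (?q x), conj_coset G h (?q y))) ` H)" by blast
    have xK: "x \<in> K" using x by (simp add: core_def)
    have "?q x = ?q y"
      using distal z xK yK unfolding distal_action_def topspace_coset[OF D] by blast
    then have "y \<in> core V" using sat[OF order_refl] x yK unfolding core_stay by blast
    then show False using y by blast
  qed
  have core_cl: "closedin TK (core V)"
  proof -
    have "core V = (\<Inter>h\<in>H. {x \<in> topspace TK. conj_by G h x \<in> V})"
      unfolding core_def topspace_TK using H_one by blast
    moreover have "closedin TK {x \<in> topspace TK. conj_by G h x \<in> V}" if "h \<in> H" for h
    proof (rule closedin_continuous_map_preimage)
      show "continuous_map TK TK (conj_by G h)" using that by (intro cont_TK cont_conj_by1) auto
      show "closedin TK V" using Vc VK Hausdorff_TK by (simp add: compactin_TK compactin_imp_closedin)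
    qed
    moreover have "H \<noteq> {}" using H_one by blast
    ultimately show ?thesis by (auto intro!: closedin_INT)
  qed
  have core_comp: "compactin T (core V)"
    using closed_compactin[OF _ core_subset core_cl] Vc VK by (simp add: compactin_TK)
  have core_K: "core V \<subseteq> K" by (auto simp: core_def)
  \<comment> \<open>\<open>core V\<close> contains \<open>\<one>\<close>, which gives
    \<open>S \<subseteq> core V\<close>, and is stable under right multiplication by
    \<open>D\<close>, which gives \<open>D \<subseteq> S\<close>.\<close>
  define S where "S = right_stab (core V)"
  have Sc: "S \<subseteq> core V" unfolding S_def by (rule right_stab_subset) (use V1 in \<open>auto simp: core_def\<close>)
  show ?thesis
  proof (rule that[of S])
    show "S \<in> compact_open_subgroups G T K"
      by (rule open_subgroup_compact[OF _ _ Sc core_comp])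
        (simp_all add: S_def subgroup_right_stab[OF core_K] openin_right_stab[OF core_open core_comp])
    show "S \<subseteq> Q" using Sc core_subset VQ by blast
    show "D \<subseteq> S"
    proof
      fix d assume d: "d \<in> D"
      then have "inv d \<in> D" using D'(1) by (simp add: subgroup.m_inv_closed)
      then show "d \<in> S" using d D'(4) stayD[OF order_refl]
        by (auto simp: S_def right_stab_def core_stay)
    qed
    show "conj_invariant G H S"
    proof (rule conj_invariantI[OF H])
      show "S \<subseteq> carrier G" using K_sub by (auto simp: S_def right_stab_def)
      fix h g assume h: "h \<in> H" and g: "g \<in> S"
      then have gK: "g \<in> K" by (simp add: S_def right_stab_def)
      \<comment> \<open>Both halves of the stabilizer condition at once, with \<open>g'\<close>
        being \<open>g\<close> or \<open>inv g\<close>: conjugate \<open>x\<close> by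
        \<open>inv h\<close>, multiply by \<open>g'\<close>, conjugate by \<open>h\<close>; each
        step stays in the invariant set \<open>core V\<close>.\<close>
      have *: "x \<otimes> conj_by G h g' \<in> core V" if x: "x \<in> core V" and g': "g' \<in> K" "\<And>w. w \<in> core V \<Longrightarrow> w \<otimes> g' \<in> core V" for x g'
      proof -
        have xK: "x \<in> K" using x core_K by blast
        have "conj_by G (inv h) x \<in> core V" using conj_invariantD[OF core_invariant _ x] h by simp
        then have "conj_by G h (conj_by G (inv h) x \<otimes> g') \<in> core V"
          using conj_invariantD[OF core_invariant h] g' by blast
        moreover have "conj_by G h (conj_by G (inv h) x \<otimes> g') = x \<otimes> conj_by G h g'"
          using h xK g' by (simp add: conj_by_mult)
        ultimately show ?thesis by simp
      qed
      have "x \<otimes> conj_by G h g \<in> core V" if "x \<in> core V" for x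
        using *[OF that gK] g by (simp add: S_def right_stab_def)
      moreover have "x \<otimes> inv (conj_by G h g) \<in> core V" if "x \<in> core V" for x
        using *[OF that, of "inv g"] g gK h by (simp add: S_def right_stab_def conj_by_inv)
      ultimately show "conj_by G h g \<in> S" using h gK by (simp add: S_def right_stab_def)
    qed
  qed
qed

end

section \<open>Distal and discrete residuals\<close>

context conj_action
begin

lemma distal_actionD:
  assumes D: "D \<in> closed_inv_subgroups G T H K"
    and d: "distal_action (coset_space G T K D) H (conj_coset G)"
    and xyz: "x \<in> K" "y \<in> K" "z \<in> K"
    and *: "\<And>V. openin TK V \<Longrightarrow> z \<in> V \<Longrightarrow> \<exists>h\<in>H. conj_by G h x \<in> V <#> D \<and> conj_by G h y \<in> V <#> D"
  shows "inv x \<otimes> y \<in> D"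
proof (rule bspec[OF bspec[OF bspec[OF d[unfolded distal_action_iff[OF D]] xyz(1)] xyz(2)] xyz(3), THEN mp])
  show "\<forall>V. openin TK V \<and> z \<in> V \<longrightarrow> (\<exists>h\<in>H. conj_by G h x \<in> V <#> D \<and> conj_by G h y \<in> V <#> D)"
    using * by simp
qed

lemma open_inv_subgroupsD:
  assumes "U \<in> open_inv_subgroups G T H K"
  shows "subgroup U G" "openin TK U" "conj_invariant G H U" "U \<subseteq> K"
    "\<And>h x. h \<in> H \<Longrightarrow> x \<in> U \<Longrightarrow> conj_by G h x \<in> U"
  using assms openin_TK_subset by (auto simp: open_inv_subgroups_def conj_invariantD)

lemma whole_open_inv: "K \<in> open_inv_subgroups G T H K"
  using K H_K openin_subtopology_whole[of K T] K_sub by (simp add: open_inv_subgroups_def)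

lemma Inter_closed_inv_subgroups:
  assumes "\<C> \<noteq> {}" "\<C> \<subseteq> closed_inv_subgroups G T H K"
  shows "\<Inter>\<C> \<in> closed_inv_subgroups G T H K"
proof -
  have C: "subgroup D G" "closedin TK D" "conj_invariant G H D" "D \<subseteq> carrier G" if "D \<in> \<C>" for D
    using assms that closed_inv_subgroupsD[of D] K_sub by blast+
  have "subgroup (\<Inter>\<C>) G" using C(1) assms(1) by (intro subgroups_Inter) auto
  moreover have "closedin TK (\<Inter>\<C>)" using C(2) assms(1) by (intro closedin_Inter) auto
  moreover have "conj_invariant G H (\<Inter>\<C>)"
    using C assms(1) subgroup.subset[OF H] by (intro conj_invariant_Inter) auto
  ultimately show ?thesis by (simp add: closed_inv_subgroups_def)
qed

text \<open>\<open>K/U\<close> is discrete, so a limit is attained: some \<open>h\<close> moves both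
  points into \<open>z U\<close>. Then \<open>inv x \<otimes> y\<close> is conjugated into
  \<open>U\<close> by \<open>h\<close>, and invariance of \<open>U\<close> brings it back.\<close>

lemma distal_open_inv_subgroup:
  assumes U: "U \<in> open_inv_subgroups G T H K"
  shows "distal_action (coset_space G T K U) H (conj_coset G)"
  unfolding distal_action_iff[OF open_inv_subgroup_closed[OF U]]
proof (intro ballI impI)
  note U' = open_inv_subgroupsD[OF U]
  fix x y z assume xyz: "x \<in> K" "y \<in> K" "z \<in> K"
    and *: "\<forall>V. openin TK V \<and> z \<in> V \<longrightarrow> (\<exists>h\<in>H. conj_by G h x \<in> V <#> U \<and> conj_by G h y \<in> V <#> U)"
  have "openin TK ((\<lambda>u. z \<otimes> u) ` U)" by (rule openin_lmult[OF xyz(3) U'(2)])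
  moreover have "z \<in> (\<lambda>u. z \<otimes> u) ` U"
    using xyz subgroup.one_closed[OF U'(1)] by (intro image_eqI[of _ _ \<one>]) auto
  ultimately obtain h where h: "h \<in> H" "conj_by G h x \<in> (\<lambda>u. z \<otimes> u) ` U <#> U"
      "conj_by G h y \<in> (\<lambda>u. z \<otimes> u) ` U <#> U"
    using * by blast
  obtain a b where ab: "a \<in> U" "b \<in> U" "conj_by G h x = z \<otimes> a \<otimes> b"
    using h(2) by (auto simp: set_mult_def)
  obtain c d where cd: "c \<in> U" "d \<in> U" "conj_by G h y = z \<otimes> c \<otimes> d"
    using h(3) by (auto simp: set_mult_def)
  have UK: "u \<in> K" if "u \<in> U" for u using that U'(4) by blast
  have "conj_by G h (inv x \<otimes> y) = inv (conj_by G h x) \<otimes> conj_by G h y"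
    using h xyz by (simp add: conj_by_mult conj_by_inv)
  also have "\<dots> = inv (a \<otimes> b) \<otimes> (c \<otimes> d)"
    using ab cd xyz UK by (simp add: inv_mult_group m_assoc)
  also have "\<dots> \<in> U" using ab cd U'(1) by (simp add: subgroup.m_closed subgroup.m_inv_closed)
  finally have "conj_by G h (inv x \<otimes> y) \<in> U" .
  then have "conj_by G (inv h) (conj_by G h (inv x \<otimes> y)) \<in> U" by (rule U'(5)[OF H_inv[OF h(1)]])
  then show "inv x \<otimes> y \<in> U" using h xyz by simp
qed

text \<open>A pair proximal modulo \<open>\<Inter>\<C>\<close> is proximal modulo each member
  \<open>D\<close>, because \<open>V <#> \<Inter>\<C> \<subseteq> V <#> D\<close>; so its cosets
  agree modulo every \<open>D\<close>.\<close>

lemma distal_Inter: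
  assumes ne: "\<C> \<noteq> {}" and C: "\<C> \<subseteq> closed_inv_subgroups G T H K"
    and d: "\<And>D. D \<in> \<C> \<Longrightarrow> distal_action (coset_space G T K D) H (conj_coset G)"
  shows "distal_action (coset_space G T K (\<Inter>\<C>)) H (conj_coset G)"
  unfolding distal_action_iff[OF Inter_closed_inv_subgroups[OF ne C]]
proof (intro ballI impI InterI)
  fix x y z D assume xyz: "x \<in> K" "y \<in> K" "z \<in> K" and D: "D \<in> \<C>"
    and *: "\<forall>V. openin TK V \<and> z \<in> V \<longrightarrow> (\<exists>h\<in>H. conj_by G h x \<in> V <#> \<Inter>\<C> \<and> conj_by G h y \<in> V <#> \<Inter>\<C>)"
  have sub: "V <#> \<Inter>\<C> \<subseteq> V <#> D" for V using D by (auto simp: set_mult_def)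
  show "inv x \<otimes> y \<in> D"
  proof (rule distal_actionD[OF _ d[OF D] xyz])
    show "D \<in> closed_inv_subgroups G T H K" using C D by blast
    fix V assume "openin TK V" "z \<in> V"
    then obtain h where "h \<in> H" "conj_by G h x \<in> V <#> \<Inter>\<C>" "conj_by G h y \<in> V <#> \<Inter>\<C>"
      using *[rule_format, of V] by auto
    then show "\<exists>h\<in>H. conj_by G h x \<in> V <#> D \<and> conj_by G h y \<in> V <#> D"
      using sub by (intro bexI[of _ h]) auto
  qed
qed

text \<open>The identity is fixed by \<open>H\<close>, so an orbit accumulating at the trivial coset
  is proximal to that coset.\<close>

lemma distal_imp_distal_at:
  assumes D: "D \<in> closed_inv_subgroups G T H K"
    and "distal_action (coset_space G T K D) H (conj_coset G)"
  shows "distal_action_at (coset_space G T K D) H (conj_coset G) D"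
  unfolding distal_action_at_iff[OF D]
proof (intro ballI impI)
  fix x assume x: "x \<in> K"
    and *: "\<forall>V. openin TK V \<and> \<one> \<in> V \<longrightarrow> (\<exists>h\<in>H. conj_by G h x \<in> V <#> D)"
  have "\<one> \<in> V <#> D" if "\<one> \<in> V" for V
    using that subgroup.one_closed[OF closed_inv_subgroupsD(1)[OF D]] by (force simp: set_mult_def)
  then have "inv \<one> \<otimes> x \<in> D"
    using * by (intro distal_actionD[OF assms K_one x K_one]) simp
  then show "x \<in> D" using x by simp
qed

definition "distal_family =
  {D \<in> closed_inv_subgroups G T H K. distal_action (coset_space G T K D) H (conj_coset G)}"

lemma open_inv_in_distal_family: "U \<in> open_inv_subgroups G T H K \<Longrightarrow> U \<in> distal_family"
  using distal_open_inv_subgroup open_inv_subgroup_closed by (simp add: distal_family_def)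

lemma Dist_in_distal_family: "Dist G T H K \<in> distal_family"
proof -
  have ne: "distal_family \<noteq> {}" using open_inv_in_distal_family[OF whole_open_inv] by blast
  have "Dist G T H K = \<Inter>distal_family" by (simp add: Dist_def distal_family_def)
  moreover have "distal_family \<subseteq> closed_inv_subgroups G T H K" by (auto simp: distal_family_def)
  ultimately show ?thesis
    using ne distal_Inter Inter_closed_inv_subgroups
    by (metis (mono_tags, lifting) distal_family_def mem_Collect_eq)
qed

lemma Dist_subset_Res: "Dist G T H K \<subseteq> Res G T H K"
  using open_inv_in_distal_family unfolding Dist_def Res_def distal_family_def by blast

text \<open>An intersection of open invariant subgroups inherits distality even when it is not open.
  The argument for small invariant subgroups thus applies at \<open>Res\<close> itself,
  independently of its equality with \<open>Dist\<close>.\<close>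

lemma Res_in_distal_family: "Res G T H K \<in> distal_family"
proof -
  have ne: "open_inv_subgroups G T H K \<noteq> {}" using whole_open_inv by blast
  have sub: "open_inv_subgroups G T H K \<subseteq> closed_inv_subgroups G T H K"
    using open_inv_subgroup_closed by blast
  show ?thesis unfolding Res_def distal_family_def
    using distal_Inter[OF ne sub distal_open_inv_subgroup] Inter_closed_inv_subgroups[OF ne sub] by simp
qed

lemma Dist_star_subset_Dist: "Dist_star G T H K \<subseteq> Dist G T H K"
  using distal_imp_distal_at unfolding Dist_def Dist_star_def by blast

lemma closed_inv_compact:
  assumes "D \<in> closed_inv_subgroups G T H K" "D \<subseteq> C" "compactin T C"
  shows "compactin T D"
  using closed_compactin[OF assms(3,2)] closedin_trans_full[OF closed_inv_subgroupsD(2)[OF assms(1)] K_closed] .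

lemma Res_subset: "U \<in> open_inv_subgroups G T H K \<Longrightarrow> Res G T H K \<subseteq> U"
  by (auto simp: Res_def)

lemma compact_Res_of_small:
  assumes "U \<in> compact_open_subgroups G T K" "conj_invariant G H U"
  shows "compactin T (Res G T H K)"
proof -
  have "U \<in> open_inv_subgroups G T H K"
    using assms by (simp add: compact_open_subgroups_def open_inv_subgroups_def)
  then have "Res G T H K \<subseteq> U" by (rule Res_subset)
  then show ?thesis
    using closed_inv_compact Res_in_distal_family compact_open_subgroupsD(3)[OF assms(1)]
    by (auto simp: distal_family_def)
qed

section \<open>Displacement index, tidy subgroups and the nub\<close>

lemma displacement_index:
  assumes V: "V \<in> compact_open_subgroups G T K" and h: "h \<in> H"
  shows "1 \<le> displacement_index G (conj_by G h) V"
    and "displacement_index G (conj_by G h) V \<le> 1 \<longleftrightarrow> conj_by G h ` V \<subseteq> V"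
proof -
  note V' = compact_open_subgroupsD[OF V]
  define A where "A = conj_by G h ` V"
  define L where "L = A \<inter> V"
  have Vc: "V \<subseteq> carrier G" using V'(4) K_sub by blast
  have AK: "A \<subseteq> K" using h V'(4) by (auto simp: A_def)
  have Ac: "A \<subseteq> carrier G" using AK K_sub by blast
  have A: "subgroup A G"
  proof (rule subgroupI)
    show "A \<subseteq> carrier G" by (rule Ac)
    show "A \<noteq> {}" using V'(5) by (auto simp: A_def)
    fix a assume a: "a \<in> A"
    then obtain v where v: "v \<in> V" "a = conj_by G h v" by (auto simp: A_def)
    then have "inv a = conj_by G h (inv v)" using h Vc by (auto simp: conj_by_inv subset_iff)
    then show "inv a \<in> A" using v subgroup.m_inv_closed[OF V'(1)] by (simp add: A_def)
    fix b assume "b \<in> A"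
    then obtain w where w: "w \<in> V" "b = conj_by G h w" by (auto simp: A_def)
    then have "a \<otimes> b = conj_by G h (v \<otimes> w)" using v h Vc by (auto simp: conj_by_mult subset_iff)
    then show "a \<otimes> b \<in> A" using v w subgroup.m_closed[OF V'(1)] by (simp add: A_def)
  qed
  have L: "subgroup L G" unfolding L_def by (rule subgroups_Inter_pair[OF A V'(1)])
  have Lo: "openin TK L" using openin_conj_by[OF h V'(2)] V'(2) unfolding L_def A_def by (rule openin_Int)
  have rc: "L #> x = L #> y \<longleftrightarrow> x \<in> L #> y" if "x \<in> K" "y \<in> K" for x y
    using that L rcos_self repr_independence by (metis K_carrier)
  have eq: "rcosets\<^bsub>G\<lparr>carrier := A\<rparr>\<^esub> L = (\<lambda>x. L #> x) ` A"
    by (auto simp: RCOSETS_def r_coset_def)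
  \<comment> \<open>Finiteness, from compactness of \<open>A\<close> and openness of
    \<open>L\<close>, excludes the default value 0 that \<open>card\<close> takes on infinite
    sets.\<close>
  have fin: "finite ((\<lambda>x. L #> x) ` A)"
  proof (rule finite_image_locally_constant)
    have "compactin T A" using image_compactin[OF V'(3) cont_conj_by1] h by (simp add: A_def)
    then show "compactin TK A" using AK by (simp add: compactin_TK)
    fix x assume "x \<in> A"
    then have x: "x \<in> K" using AK by blast
    have "{y \<in> topspace TK. L #> y = L #> x} = {y \<in> K. y \<in> L #> x}"
      using rc[OF _ x] by auto
    also have "\<dots> = (\<lambda>l. l \<otimes> x) ` L"
      unfolding r_coset_def using x openin_TK_subset[OF Lo] by auto
    finally have "{y \<in> topspace TK. L #> y = L #> x} = (\<lambda>l. l \<otimes> x) ` L" .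
    then show "openin TK {y \<in> topspace TK. L #> y = L #> x}" using openin_rmult[OF x Lo] by simp
  qed
  have one: "\<one> \<in> A" using A by (rule subgroup.one_closed)
  have idx: "displacement_index G (conj_by G h) V = card ((\<lambda>x. L #> x) ` A)"
    unfolding displacement_index_def A_def[symmetric] L_def[symmetric] eq ..
  show "1 \<le> displacement_index G (conj_by G h) V"
    using fin one card_gt_0_iff[of "(\<lambda>x. L #> x) ` A"] unfolding idx by (simp add: Suc_le_eq) blast
  show "displacement_index G (conj_by G h) V \<le> 1 \<longleftrightarrow> conj_by G h ` V \<subseteq> V"
    unfolding idx A_def[symmetric]
  proof
    assume "card ((\<lambda>x. L #> x) ` A) \<le> 1"
    then have "card ((\<lambda>x. L #> x) ` A) \<le> Suc 0" by (simp only: One_nat_def)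
    then have "\<forall>a\<in>(\<lambda>x. L #> x) ` A. \<forall>b\<in>(\<lambda>x. L #> x) ` A. a = b"
      by (rule card_le_Suc0_iff_eq[OF fin, THEN iffD1])
    then have "L #> x = L #> \<one>" if "x \<in> A" for x using one that by blast
    moreover have "L #> \<one> = L" by (rule coset_mult_one[OF subgroup.subset[OF L]])
    moreover have "x \<in> L #> x" if "x \<in> A" for x using that Ac by (intro rcos_self[OF _ L]) auto
    ultimately have "x \<in> L" if "x \<in> A" for x using that by metis
    then show "A \<subseteq> V" by (auto simp: L_def)
  next
    assume "A \<subseteq> V"
    then have "L = A" by (auto simp: L_def)
    then have "(\<lambda>x. L #> x) ` A \<subseteq> {A}"
      using subgroup.rcos_const[OF A is_group] by auto
    then show "card ((\<lambda>x. L #> x) ` A) \<le> 1"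
      using card_mono[of "{A}" "(\<lambda>x. L #> x) ` A"] by simp
  qed
qed

text \<open>The invariant subgroup \<open>U0\<close> attains the index 1, the least possible value.
  Minimality for all of \<open>H\<close> thus means that every \<open>h\<close> conjugates
  \<open>U\<close> into itself, which is invariance because \<open>H\<close> is a group.\<close>

lemma tidy_iff_invariant:
  assumes U0: "U0 \<in> compact_open_subgroups G T K" "conj_invariant G H U0"
  shows "(\<forall>h\<in>H. tidy G T K (conj_by G h) U) \<longleftrightarrow>
    U \<in> compact_open_subgroups G T K \<and> conj_invariant G H U"
proof
  have U0i: "displacement_index G (conj_by G h) U0 \<le> 1" if "h \<in> H" for h
    using displacement_index(2)[OF U0(1) that] U0(2) that by (auto simp: conj_invariant_def)
  assume t: "\<forall>h\<in>H. tidy G T K (conj_by G h) U"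
  then have U: "U \<in> compact_open_subgroups G T K" using H_one unfolding tidy_def by blast
  have "conj_by G h ` U \<subseteq> U" if "h \<in> H" for h
    using displacement_index(2)[OF U that] t U0i[OF that] U0(1) that unfolding tidy_def
    by (meson le_trans)
  then have "conj_invariant G H U"
    using compact_open_subgroupsD(4)[OF U] K_sub by (intro conj_invariantI[OF H]) auto
  then show "U \<in> compact_open_subgroups G T K \<and> conj_invariant G H U" using U by blast
next
  assume U: "U \<in> compact_open_subgroups G T K \<and> conj_invariant G H U"
  show "\<forall>h\<in>H. tidy G T K (conj_by G h) U"
  proof
    fix h assume h: "h \<in> H"
    have "displacement_index G (conj_by G h) U \<le> 1"
      using displacement_index(2)[of U h] U h by (auto simp: conj_invariant_def)
    then show "tidy G T K (conj_by G h) U"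
      using displacement_index(1)[OF _ h] U unfolding tidy_def by (meson le_trans)
  qed
qed

text \<open>Intersecting with \<open>U0\<close> makes any open invariant subgroup compact, so the
  compact open invariant subgroups already have intersection \<open>Res\<close>.\<close>

lemma flat_and_nub_eq_Res:
  assumes U0: "U0 \<in> compact_open_subgroups G T K" "conj_invariant G H U0"
  shows "flat_on G T H K" "nub G T H K = Res G T H K"
proof -
  note tidy = tidy_iff_invariant[OF U0]
  show "flat_on G T H K" unfolding flat_on_def tidy using U0 by blast
  show "nub G T H K = Res G T H K"
  proof
    show "Res G T H K \<subseteq> nub G T H K"
      unfolding nub_def tidy Res_def open_inv_subgroups_def compact_open_subgroups_def by blast
    show "nub G T H K \<subseteq> Res G T H K"
      unfolding Res_def
    proof (rule Inter_greatest)
      fix W assume W: "W \<in> open_inv_subgroups G T H K"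
      note W' = open_inv_subgroupsD[OF W] and U0' = compact_open_subgroupsD[OF U0(1)]
      have "W \<inter> U0 \<in> compact_open_subgroups G T K"
        by (rule open_subgroup_compact[OF subgroups_Inter_pair openin_Int _ U0'(3)]) (use W' U0' in auto)
      moreover have "conj_invariant G H (W \<inter> U0)"
        using W'(4,5) K_sub conj_invariantD[OF U0(2)] by (intro conj_invariantI[OF H]) auto
      ultimately have "nub G T H K \<subseteq> W \<inter> U0" unfolding nub_def tidy by blast
      then show "nub G T H K \<subseteq> W" by blast
    qed
  qed
qed

end

section \<open>Compact residuals of a compactly generated group\<close>

context cg_conj_action
begin

text \<open>For \<open>x\<close> outside \<open>Dist\<close>, the open set \<open>K - {x}\<close>
  contains an open invariant subgroup around \<open>Dist\<close>; it contains \<open>Res\<close> and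
  misses \<open>x\<close>. The choice of \<open>K\<close> as neighbourhood gives the first
  claim.\<close>

lemma small_of_compact_Dist:
  assumes "compactin T (Dist G T H K)"
  shows "\<exists>U\<in>compact_open_subgroups G T K. conj_invariant G H U"
    and "Res G T H K = Dist G T H K"
proof -
  have D: "Dist G T H K \<in> closed_inv_subgroups G T H K"
      "distal_action (coset_space G T K (Dist G T H K)) H (conj_coset G)"
    using Dist_in_distal_family by (auto simp: distal_family_def)
  note small = distal_imp_small_invariant_subgroup[OF D(1) assms D(2)]
  have KK: "openin TK K" using openin_topspace[of TK] by simp
  show "\<exists>U\<in>compact_open_subgroups G T K. conj_invariant G H U"
    by (rule small[OF KK closed_inv_subgroupsD(4)[OF D(1)]]) blast
  show "Res G T H K = Dist G T H K"
  proof (intro equalityI Dist_subset_Res subsetI)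
    fix x assume x: "x \<in> Res G T H K"
    show "x \<in> Dist G T H K"
    proof (rule ccontr)
      assume nx: "x \<notin> Dist G T H K"
      have xK: "x \<in> K" using x Res_subset[OF whole_open_inv] by blast
      have "openin TK (K - {x})"
        using closedin_Hausdorff_singleton[OF Hausdorff_TK, of x] xK by (simp add: closedin_def)
      moreover have "Dist G T H K \<subseteq> K - {x}" using closed_inv_subgroupsD(4)[OF D(1)] nx by blast
      ultimately obtain S where S: "S \<in> compact_open_subgroups G T K" "conj_invariant G H S" "S \<subseteq> K - {x}"
        by (rule small)
      then have "S \<in> open_inv_subgroups G T H K"
        by (simp add: compact_open_subgroups_def open_inv_subgroups_def)
      then show False using Res_subset S(3) x by blast
    qed
  qed
qed

text \<open>What needs proof is that \<open>K/V\<close> is distal. A pair proximal modulo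
  \<open>V\<close> is proximal modulo \<open>R\<close>, so \<open>inv x \<otimes> y\<close> lies in
  \<open>R\<close>; moreover it has an \<open>H\<close>-conjugate in the neighbourhood
  \<open>E\<close> of \<open>V\<close>, and \<open>E\<close> meets \<open>R\<close> only in
  \<open>V\<close>.\<close>

lemma Res_no_proper_open_inv_subgroup:
  assumes comp: "compactin T (Res G T H K)" and V: "V \<in> open_inv_subgroups G T H (Res G T H K)"
  shows "V = Res G T H K"
proof -
  define R where "R = Res G T H K"
  have R: "R \<in> closed_inv_subgroups G T H K"
    and Rd: "distal_action (coset_space G T K R) H (conj_coset G)"
    using Res_in_distal_family by (auto simp: R_def distal_family_def)
  note R' = closed_inv_subgroupsD[OF R]
  have RT: "closedin T R" using closedin_trans_full[OF R'(2) K_closed] .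
  interpret R: conj_action G T R H
    by (intro conj_action.intro tdlc_subgroup.intro top_group_axioms tdlc_subgroup_axioms.intro
        conj_action_axioms.intro td lc R' RT H)
  note V' = R.open_inv_subgroupsD[OF V[folded R_def]]
  have "V \<in> closed_inv_subgroups G T H R" using R.open_inv_subgroup_closed V R_def by blast
  then have VR: "closedin (subtopology T R) V" by (simp add: closed_inv_subgroups_def)
  have VT: "closedin T V" using closedin_trans_full[OF VR RT] .
  have VK: "V \<subseteq> K" using V'(4) R'(4) by blast
  have Vcl: "V \<in> closed_inv_subgroups G T H K"
    using V'(1,3) VT VK by (simp add: closed_inv_subgroups_def closedin_subset_topspace)
  have Vcomp: "compactin T V" using closed_compactin[OF comp[folded R_def] V'(4) VT] .
  \<comment> \<open>As \<open>V\<close> is open in the closed group \<open>R\<close>, the set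
    \<open>R - V\<close> is closed; so \<open>E\<close> is an open neighbourhood of \<open>V\<close>
    with \<open>E \<inter> R = V\<close>.\<close>
  define E where "E = K - (R - V)"
  have Eo: "openin TK E"
  proof -
    have "closedin (subtopology T R) (R - V)"
      using closedin_diff[OF closedin_topspace V'(2)] by simp
    then have "closedin T (R - V)" using RT by (rule closedin_trans_full)
    then have "closedin TK (R - V)" using R'(4) by (intro closedin_subset_topspace) auto
    then show ?thesis unfolding E_def by (simp add: closedin_def)
  qed
  have VE: "V \<subseteq> E" using VK by (auto simp: E_def)
  have Vd: "distal_action (coset_space G T K V) H (conj_coset G)"
    unfolding distal_action_iff[OF Vcl]
  proof (intro ballI impI)
    fix x y z assume xyz: "x \<in> K" "y \<in> K" "z \<in> K"
      and *: "\<forall>Q. openin TK Q \<and> z \<in> Q \<longrightarrow> (\<exists>h\<in>H. conj_by G h x \<in> Q <#> V \<and> conj_by G h y \<in> Q <#> V)"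
    have sub: "Q <#> V \<subseteq> Q <#> R" for Q using V'(4) by (auto simp: set_mult_def)
    have rR: "inv x \<otimes> y \<in> R"
    proof (rule distal_actionD[OF R Rd xyz])
      fix Q assume "openin TK Q" "z \<in> Q"
      then obtain h where "h \<in> H" "conj_by G h x \<in> Q <#> V" "conj_by G h y \<in> Q <#> V"
        using *[rule_format, of Q] by auto
      then show "\<exists>h\<in>H. conj_by G h x \<in> Q <#> R \<and> conj_by G h y \<in> Q <#> R"
        using sub by (intro bexI[of _ h]) auto
    qed
    have Vin: "a \<in> carrier G" if "a \<in> V" for a using that VK by auto
    \<comment> \<open>\<open>N\<close> is chosen with \<open>V N V \<subseteq> E\<close>: the
      quotient of two points of \<open>z N V\<close> has the form
      \<open>inv v \<otimes> (inv n \<otimes> m) \<otimes> w\<close>, with a factor from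
      \<open>V\<close> on either side.\<close>
    have "openin TK {n \<in> K. \<forall>p\<in>V \<times> V. (\<lambda>(p, n). fst p \<otimes> n \<otimes> snd p) (p, n) \<in> E}"
    proof (rule openin_tube_TK[OF _ _ _ Eo])
      show "continuous_map (prod_topology (prod_topology T T) T) T (\<lambda>(p, n). fst p \<otimes> n \<otimes> snd p)"
        using continuous_map_compose[OF continuous_map_fst[of "prod_topology T T" T] continuous_map_fst[of T T]]
          continuous_map_compose[OF continuous_map_fst[of "prod_topology T T" T] continuous_map_snd[of T T]]
        unfolding case_prod_unfold o_def by (intro cont_mult' continuous_map_snd)
      show "compactin (prod_topology T T) (V \<times> V)" using Vcomp by (simp add: compactin_Times)
    qed (use VK in \<open>auto simp: subset_iff\<close>)
    moreover have "\<one> \<in> {n \<in> K. \<forall>p\<in>V \<times> V. (\<lambda>(p, n). fst p \<otimes> n \<otimes> snd p) (p, n) \<in> E}"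
      using VE subgroup.m_closed[OF V'(1)] Vin by auto
    ultimately obtain N where N: "N \<in> compact_open_subgroups G T K"
      "N \<subseteq> {n \<in> K. \<forall>p\<in>V \<times> V. (\<lambda>(p, n). fst p \<otimes> n \<otimes> snd p) (p, n) \<in> E}"
      by (rule van_Dantzig)
    note N' = compact_open_subgroupsD[OF N(1)]
    have NE: "v \<otimes> n \<otimes> w \<in> E" if "n \<in> N" "v \<in> V" "w \<in> V" for n v w using N(2) that by fastforce
    have Nin: "n \<in> carrier G" if "n \<in> N" for n using that N'(4) by auto
    have "openin TK ((\<lambda>n. z \<otimes> n) ` N)" by (rule openin_lmult[OF xyz(3) N'(2)])
    moreover have "z \<in> (\<lambda>n. z \<otimes> n) ` N" using N'(5) xyz by (intro image_eqI[of _ _ \<one>]) auto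
    ultimately obtain h where h: "h \<in> H" "conj_by G h x \<in> (\<lambda>n. z \<otimes> n) ` N <#> V"
        "conj_by G h y \<in> (\<lambda>n. z \<otimes> n) ` N <#> V"
      using * by blast
    obtain n v where nv: "n \<in> N" "v \<in> V" "conj_by G h x = z \<otimes> n \<otimes> v"
      using h(2) by (auto simp: set_mult_def)
    obtain m w where mw: "m \<in> N" "w \<in> V" "conj_by G h y = z \<otimes> m \<otimes> w"
      using h(3) by (auto simp: set_mult_def)
    have "conj_by G h (inv x \<otimes> y) = inv (conj_by G h x) \<otimes> conj_by G h y"
      using h xyz by (simp add: conj_by_mult conj_by_inv)
    also have "\<dots> = inv v \<otimes> (inv n \<otimes> m) \<otimes> w"
      using nv mw xyz Nin Vin by (simp add: inv_mult_group m_assoc)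
    also have "\<dots> \<in> E"
      using nv mw subgroup.m_closed[OF N'(1)] subgroup.m_inv_closed[OF N'(1)] subgroup.m_inv_closed[OF V'(1)]
      by (intro NE) auto
    finally have "conj_by G h (inv x \<otimes> y) \<in> V"
      using R'(5)[OF h(1) rR] by (auto simp: E_def)
    then have "conj_by G (inv h) (conj_by G h (inv x \<otimes> y)) \<in> V" by (rule V'(5)[OF H_inv[OF h(1)]])
    then show "inv x \<otimes> y \<in> V" using h xyz by simp
  qed
  obtain S where S: "S \<in> compact_open_subgroups G T K" "conj_invariant G H S" "V \<subseteq> S" "S \<subseteq> E"
    by (rule distal_imp_small_invariant_subgroup[OF Vcl Vcomp Vd Eo VE])
  then have "S \<in> open_inv_subgroups G T H K"
    by (simp add: compact_open_subgroups_def open_inv_subgroups_def)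
  then have "R \<subseteq> E" using Res_subset[of S] S(4) by (simp add: R_def)
  then have "R \<subseteq> V" by (auto simp: E_def)
  then show ?thesis using V'(4) R_def by blast
qed

text \<open>By induction every stage contains \<open>R\<close>: if \<open>U\<close> is open and
  invariant in a stage \<open>S\<close> containing \<open>R\<close>, then
  \<open>U \<inter> R\<close> is open and invariant in \<open>R\<close>, hence all of
  \<open>R\<close>.\<close>

lemma Res_eq_Res_infty:
  assumes comp: "compactin T (Res G T H K)"
  shows "Res_infty G T H K = Res G T H K"
proof
  show "Res_infty G T H K \<subseteq> Res G T H K"
    unfolding Res_infty_def using Res_stages.succ[OF Res_stages.zero] by blast
  define R where "R = Res G T H K"
  have "R \<in> closed_inv_subgroups G T H K"
    using Res_in_distal_family by (auto simp: R_def distal_family_def)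
  note R' = closed_inv_subgroupsD[OF this]
  have "R \<subseteq> S" if "S \<in> Res_stages G T H K" for S
    using that
  proof induction
    case zero
    then show ?case by (rule R'(4))
  next
    case (succ S)
    show ?case unfolding Res_def[of G T H S]
    proof (rule Inter_greatest)
      fix U assume U: "U \<in> open_inv_subgroups G T H S"
      then have U': "subgroup U G" "openin (subtopology T S) U" "conj_invariant G H U"
        by (auto simp: open_inv_subgroups_def)
      have "subgroup (U \<inter> R) G" using U'(1) R'(1) by (rule subgroups_Inter_pair)
      moreover have "openin (subtopology T R) (U \<inter> R)"
      proof -
        obtain Q where "openin T Q" "U = Q \<inter> S" using U'(2) by (auto simp: openin_subtopology)
        then show ?thesis using succ.IH by (auto simp: openin_subtopology intro!: exI[of _ Q])
      qed
      moreover have "conj_invariant G H (U \<inter> R)"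
        using conj_invariantD[OF U'(3)] R'(4,5) K_sub by (intro conj_invariantI[OF H]) auto
      ultimately have "U \<inter> R \<in> open_inv_subgroups G T H R" by (simp add: open_inv_subgroups_def)
      then have "U \<inter> R = R" using Res_no_proper_open_inv_subgroup[OF comp] by (simp add: R_def)
      then show "R \<subseteq> U" by blast
    qed
  next
    case (limit \<C>)
    then show ?case by blast
  qed
  then show "Res G T H K \<subseteq> Res_infty G T H K" unfolding Res_infty_def R_def by blast
qed

end

section \<open>Haar measure of a profinite group\<close>

locale profinite_subgroup = tdlc_subgroup G T K for G :: "('a, 'b) monoid_scheme" (structure) and T K +
  assumes K_comp: "compactin T K"
begin

lemma closed_compactin_K: "closedin TK C \<Longrightarrow> compactin TK C"
  using closed_compactin[of TK K C] K_comp closedin_subset[of TK C] by (simp add: compactin_TK)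

lemma compactin_closed_K: "compactin TK C \<Longrightarrow> closedin TK C"
  using Hausdorff_TK by (rule compactin_imp_closedin)

section \<open>Counting cosets: the volume of a clopen set\<close>

definition "open_subgroup U \<longleftrightarrow> subgroup U G \<and> openin TK U"

definition "clopen C \<longleftrightarrow> openin TK C \<and> closedin TK C"

definition saturated :: "'a set \<Rightarrow> 'a set \<Rightarrow> bool" where
  "saturated U C \<longleftrightarrow> (\<forall>x\<in>C. x <# U \<subseteq> C)"

definition ncosets :: "'a set \<Rightarrow> 'a set \<Rightarrow> nat" where
  "ncosets U C = card ((\<lambda>x. x <# U) ` C)"

definition "coset_density U C = real (ncosets U C) / real (ncosets U K)"

text \<open>\<open>right_stab C\<close> is the largest subgroup of \<open>K\<close> for which
  \<open>C\<close> is a union of left cosets, a canonical level for counting;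
  \<open>coset_density_eq_cvol\<close> gives the same value at all other admissible levels.\<close>

definition "cvol C = coset_density (right_stab C) C"

lemma open_subgroupD:
  assumes "open_subgroup U"
  shows "subgroup U G" "openin TK U" "U \<subseteq> K" "\<one> \<in> U" "U \<subseteq> carrier G"
  using assms openin_TK_subset[of U] subgroup.one_closed[of U G] subgroup.subset[of U G]
  by (auto simp: open_subgroup_def)

lemma open_subgroup_Int: "open_subgroup U \<Longrightarrow> open_subgroup V \<Longrightarrow> open_subgroup (U \<inter> V)"
  by (auto simp: open_subgroup_def subgroups_Inter_pair)

lemma open_subgroup_right_stab: "clopen C \<Longrightarrow> open_subgroup (right_stab C)"
  unfolding open_subgroup_def clopen_def
  using openin_right_stab subgroup_right_stab openin_TK_subset closed_compactin_K
  by (simp add: compactin_TK)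

lemma saturated_right_stab: "saturated (right_stab C) C"
  by (auto simp: saturated_def right_stab_def l_coset_def)

lemma saturated_mono: "saturated U C \<Longrightarrow> V \<subseteq> U \<Longrightarrow> saturated V C"
  by (fastforce simp: saturated_def l_coset_def)

lemma l_coset_eq_image: "x <# (U::'a set) = (\<lambda>u. x \<otimes> u) ` U"
  by (auto simp: l_coset_def)

lemma coset_eq:
  assumes "open_subgroup U" "x \<in> K" "y \<in> x <# U"
  shows "y <# U = x <# U"
  using l_repr_independence[OF assms(3)] open_subgroupD(1)[OF assms(1)] assms(2) by simp

lemma coset_self: "open_subgroup U \<Longrightarrow> x \<in> K \<Longrightarrow> x \<in> x <# U"
  using lcos_self open_subgroupD(1) by simp

lemma coset_subset_K: "open_subgroup U \<Longrightarrow> x \<in> K \<Longrightarrow> x <# U \<subseteq> K"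
  using open_subgroupD(3) by (fastforce simp: l_coset_def)

lemma openin_coset: "open_subgroup U \<Longrightarrow> x \<in> K \<Longrightarrow> openin TK (x <# U)"
  using openin_lmult[of x U] open_subgroupD(2) by (simp add: l_coset_eq_image)

lemma finite_cosets:
  assumes U: "open_subgroup U" and C: "C \<subseteq> K"
  shows "finite ((\<lambda>x. x <# U) ` C)"
proof -
  have "finite ((\<lambda>x. x <# U) ` K)"
  proof (rule finite_image_locally_constant)
    show "compactin TK K" using K_comp by (simp add: compactin_TK)
    fix x assume x: "x \<in> K"
    have "{y \<in> topspace TK. y <# U = x <# U} = x <# U"
      using coset_eq[OF U x] coset_self[OF U] coset_subset_K[OF U x] by auto
    then show "openin TK {y \<in> topspace TK. y <# U = x <# U}" using openin_coset[OF U x] by simp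
  qed
  then show ?thesis using C by (meson finite_subset image_mono)
qed

lemma ncosets_K_pos: "open_subgroup U \<Longrightarrow> 0 < ncosets U K"
  using finite_cosets[of U K] K_one unfolding ncosets_def card_gt_0_iff by blast

text \<open>Each coset of \<open>U\<close> inside \<open>C\<close> is a translate of
  \<open>U\<close>, so it splits into as many cosets of \<open>V\<close> as \<open>U\<close>
  does.\<close>

lemma ncosets_refine:
  assumes U: "open_subgroup U" and V: "open_subgroup V" "V \<subseteq> U" and C: "C \<subseteq> K" "saturated U C"
  shows "ncosets V C = ncosets U C * ncosets V U"
proof -
  have UC: "C = \<Union>((\<lambda>x. x <# U) ` C)"
    using C coset_self[OF U] by (auto simp: saturated_def subset_iff)
  have card_c: "card ((\<lambda>x. x <# V) ` c) = ncosets V U" if "c \<in> (\<lambda>x. x <# U) ` C" for c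
  proof -
    obtain x where x: "x \<in> K" "c = x <# U" using \<open>c \<in> _\<close> C by blast
    have "(\<lambda>y. y <# V) ` c = (\<lambda>d. x <# d) ` (\<lambda>u. u <# V) ` U"
      unfolding image_image x(2) l_coset_def[of _ x U]
      using lcos_m_assoc[OF open_subgroupD(5)[OF V(1)], of x] x open_subgroupD(5)[OF U]
      by (auto simp: image_iff subset_iff)
    moreover have "inj_on (\<lambda>d. x <# d) ((\<lambda>u. u <# V) ` U)"
    proof (rule inj_on_inverseI[of _ "\<lambda>d. inv x <# d"])
      fix d assume "d \<in> (\<lambda>u. u <# V) ` U"
      then have "d \<subseteq> carrier G"
        using open_subgroupD(5)[OF U] open_subgroupD(5)[OF V(1)] by (auto simp: l_coset_def)
      then show "inv x <# (x <# d) = d" using x by (simp add: lcos_m_assoc lcos_mult_one)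
    qed
    ultimately show ?thesis by (simp add: card_image ncosets_def)
  qed
  have "ncosets V C = card (\<Union>c\<in>(\<lambda>x. x <# U) ` C. (\<lambda>x. x <# V) ` c)"
    unfolding ncosets_def by (subst UC) (simp only: image_Union image_image)
  also have "\<dots> = (\<Sum>c\<in>(\<lambda>x. x <# U) ` C. card ((\<lambda>x. x <# V) ` c))"
  proof (rule card_UN_disjoint)
    show "finite ((\<lambda>x. x <# U) ` C)" by (rule finite_cosets[OF U C(1)])
    show "\<forall>c\<in>(\<lambda>x. x <# U) ` C. finite ((\<lambda>x. x <# V) ` c)"
      using finite_cosets[OF V(1)] coset_subset_K[OF U] C(1) by blast
    show "\<forall>c\<in>(\<lambda>x. x <# U) ` C. \<forall>d\<in>(\<lambda>x. x <# U) ` C. c \<noteq> d \<longrightarrow>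
        (\<lambda>x. x <# V) ` c \<inter> (\<lambda>x. x <# V) ` d = {}"
    proof (intro ballI impI, rule ccontr)
      fix c d assume cd: "c \<in> (\<lambda>x. x <# U) ` C" "d \<in> (\<lambda>x. x <# U) ` C" "c \<noteq> d"
        and ne: "(\<lambda>x. x <# V) ` c \<inter> (\<lambda>x. x <# V) ` d \<noteq> {}"
      obtain x y where xy: "x \<in> K" "c = x <# U" "y \<in> K" "d = y <# U" using cd C(1) by blast
      obtain a b where ab: "a \<in> c" "b \<in> d" "a <# V = b <# V" using ne by auto
      have "a \<in> K" "b \<in> K" using ab xy coset_subset_K[OF U] by blast+
      have "b <# V \<subseteq> b <# U" using V(2) by (auto simp: l_coset_def)
      then have "a \<in> b <# U" using ab(3) coset_self[OF V(1) \<open>a \<in> K\<close>] by blast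
      then have "a <# U = b <# U" by (rule coset_eq[OF U \<open>b \<in> K\<close>])
      moreover have "a <# U = c" using coset_eq[OF U xy(1), of a] ab(1) xy(2) by simp
      moreover have "b <# U = d" using coset_eq[OF U xy(3), of b] ab(2) xy(4) by simp
      ultimately show False using cd(3) by simp
    qed
  qed
  also have "\<dots> = ncosets U C * ncosets V U" using card_c by (simp add: ncosets_def)
  finally show ?thesis .
qed

lemma saturated_K: "open_subgroup U \<Longrightarrow> saturated U K"
  using coset_subset_K by (auto simp: saturated_def)

lemma coset_density_refine:
  assumes "open_subgroup U" "open_subgroup V" "V \<subseteq> U" "C \<subseteq> K" "saturated U C"
  shows "coset_density V C = coset_density U C"
proof -
  have "ncosets V K = ncosets U K * ncosets V U"
    by (rule ncosets_refine) (use assms saturated_K in auto)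
  then show ?thesis
    using ncosets_K_pos[OF assms(2)] ncosets_refine[OF assms] by (simp add: coset_density_def)
qed

text \<open>Both levels of counting are compared with their common refinement
  \<open>U \<inter> right_stab C\<close>.\<close>

lemma coset_density_eq_cvol:
  assumes C: "clopen C" and U: "open_subgroup U" "saturated U C"
  shows "coset_density U C = cvol C"
proof -
  have CK: "C \<subseteq> K" using C openin_TK_subset by (auto simp: clopen_def)
  note R = open_subgroup_right_stab[OF C]
  have "coset_density (U \<inter> right_stab C) C = coset_density U C"
    by (rule coset_density_refine) (use U R CK in \<open>auto intro: open_subgroup_Int\<close>)
  moreover have "coset_density (U \<inter> right_stab C) C = coset_density (right_stab C) C"
    by (rule coset_density_refine) (use U R CK saturated_right_stab in \<open>auto intro: open_subgroup_Int\<close>)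
  ultimately show ?thesis by (simp add: cvol_def)
qed

lemma cvol_nonneg: "0 \<le> cvol C"
  by (simp add: cvol_def coset_density_def)

lemma clopen_K: "clopen K" and clopen_empty: "clopen {}"
  using openin_topspace[of TK] closedin_topspace[of TK] by (auto simp: clopen_def)

lemma clopen_Un: "clopen A \<Longrightarrow> clopen B \<Longrightarrow> clopen (A \<union> B)"
  and clopen_Diff: "clopen A \<Longrightarrow> clopen B \<Longrightarrow> clopen (A - B)"
  by (auto simp: clopen_def openin_diff closedin_diff)

lemma clopen_subset: "clopen C \<Longrightarrow> C \<subseteq> K"
  using openin_TK_subset by (auto simp: clopen_def)

lemma cvol_K: "cvol K = 1"
  using ncosets_K_pos[OF open_subgroup_right_stab[OF clopen_K]]
  by (simp add: cvol_def coset_density_def)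

lemma cvol_Un:
  assumes A: "clopen A" and B: "clopen B" and disj: "A \<inter> B = {}"
  shows "cvol (A \<union> B) = cvol A + cvol B"
proof -
  define U where "U = right_stab A \<inter> right_stab B"
  have U: "open_subgroup U"
    unfolding U_def by (intro open_subgroup_Int open_subgroup_right_stab A B)
  have sA: "saturated U A" and sB: "saturated U B"
    using saturated_mono[OF saturated_right_stab] by (auto simp: U_def)
  then have sAB: "saturated U (A \<union> B)" by (auto simp: saturated_def)
  have AK: "A \<subseteq> K" and BK: "B \<subseteq> K" using A B clopen_subset by auto
  have "(\<lambda>x. x <# U) ` A \<inter> (\<lambda>x. x <# U) ` B = {}"
  proof (rule ccontr)
    assume "(\<lambda>x. x <# U) ` A \<inter> (\<lambda>x. x <# U) ` B \<noteq> {}"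
    then obtain a b where "a \<in> A" "b \<in> B" "a <# U = b <# U" by auto
    moreover from this have "b \<in> a <# U" using coset_self[OF U, of b] BK by auto
    ultimately show False using disj sA unfolding saturated_def by blast
  qed
  then have "ncosets U (A \<union> B) = ncosets U A + ncosets U B"
    using finite_cosets[OF U] AK BK by (simp add: ncosets_def image_Un card_Un_disjoint)
  then have "coset_density U (A \<union> B) = coset_density U A + coset_density U B"
    by (simp add: coset_density_def add_divide_distrib)
  then show ?thesis
    using coset_density_eq_cvol[OF A U sA] coset_density_eq_cvol[OF B U sB]
      coset_density_eq_cvol[OF clopen_Un[OF A B] U sAB] by simp
qed

lemma cvol_empty [simp]: "cvol {} = 0"
  by (simp add: cvol_def coset_density_def ncosets_def)

lemma cvol_mono: "clopen A \<Longrightarrow> clopen B \<Longrightarrow> A \<subseteq> B \<Longrightarrow> cvol A \<le> cvol B"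
  using cvol_Un[of A "B - A"] clopen_Diff[of B A] cvol_nonneg[of "B - A"]
  by (simp add: Un_absorb1)

text \<open>A bijection that carries the cosets of \<open>U\<close> to those of some
  \<open>V\<close> preserves the coset counts of \<open>C\<close> and of \<open>K\<close>. The coset
  condition replaces the homomorphism property, so that translations and conjugations are covered
  alike.\<close>

lemma cvol_image:
  assumes C: "clopen C" and fC: "clopen (f ` C)" and inj: "inj_on f K" and fK: "f ` K = K"
    and U: "\<And>U. open_subgroup U \<Longrightarrow> \<exists>V. open_subgroup V \<and> (\<forall>x\<in>K. f ` (x <# U) = f x <# V)"
  shows "cvol (f ` C) = cvol C"
proof -
  define U where "U = right_stab C"
  have oU: "open_subgroup U" unfolding U_def by (rule open_subgroup_right_stab[OF C])
  have sU: "saturated U C" unfolding U_def by (rule saturated_right_stab)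
  obtain V where V: "open_subgroup V" "\<And>x. x \<in> K \<Longrightarrow> f ` (x <# U) = f x <# V" using U[OF oU] by blast
  have CK: "C \<subseteq> K" using C by (rule clopen_subset)
  have sV: "saturated V (f ` C)"
    unfolding saturated_def
  proof
    fix y assume "y \<in> f ` C"
    then obtain x where x: "x \<in> C" "y = f x" by blast
    then have "y <# V = f ` (x <# U)" using V(2) CK by auto
    then show "y <# V \<subseteq> f ` C" using sU x(1) by (auto simp: saturated_def)
  qed
  have nc: "ncosets V (f ` A) = ncosets U A" if A: "A \<subseteq> K" for A
  proof -
    have "(\<lambda>y. y <# V) ` f ` A = (\<lambda>c. f ` c) ` (\<lambda>x. x <# U) ` A"
      unfolding image_image using V(2) A by (intro image_cong) auto
    moreover have "inj_on (\<lambda>c. f ` c) ((\<lambda>x. x <# U) ` A)"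
      using coset_subset_K[OF oU] A
      by (intro inj_on_subset[OF inj_on_image_Pow[OF inj]]) auto
    ultimately show ?thesis by (simp add: ncosets_def card_image)
  qed
  have "coset_density V (f ` C) = coset_density U C"
    using nc[OF CK] nc[of K] fK by (simp add: coset_density_def)
  then show ?thesis
    using coset_density_eq_cvol[OF fC V(1) sV] coset_density_eq_cvol[OF C oU sU] by simp
qed

text \<open>For a small compact open subgroup \<open>U\<close>, the set \<open>U <#> A\<close> is
  open as a union of translates and compact as a product of compact sets, hence also closed.\<close>

lemma clopen_between:
  assumes A: "closedin TK A" and Q: "openin TK Q" "A \<subseteq> Q"
  obtains C where "clopen C" "A \<subseteq> C" "C \<subseteq> Q"
proof -
  have AK: "A \<subseteq> K" using closedin_subset[OF A] by simp
  have comp: "compactin T A" using closed_compactin_K[OF A] by (simp add: compactin_TK)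
  have "openin TK {u \<in> K. \<forall>a\<in>A. (\<lambda>(a, u). u \<otimes> a) (a, u) \<in> Q}"
  proof (rule openin_tube_TK[OF _ comp _ Q(1)])
    show "continuous_map (prod_topology T T) T (\<lambda>(a, u). u \<otimes> a)"
      unfolding case_prod_unfold by (intro cont_mult' continuous_map_fst continuous_map_snd)
  qed (use AK in auto)
  then obtain U where U: "U \<in> compact_open_subgroups G T K" "U \<subseteq> {u \<in> K. \<forall>a\<in>A. u \<otimes> a \<in> Q}"
    by (rule van_Dantzig) (use Q(2) AK K_sub in \<open>auto simp: subset_iff\<close>)
  note U' = compact_open_subgroupsD[OF U(1)]
  have o: "openin TK (U <#> A)" by (rule openin_set_mult_left[OF U'(2) AK])
  have "compactin TK (U <#> A)"
    using compactin_set_mult[OF U'(3) comp] openin_TK_subset[OF o] by (simp add: compactin_TK)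
  then have "clopen (U <#> A)" using o compactin_closed_K by (simp add: clopen_def)
  moreover have "a \<in> U <#> A" if "a \<in> A" for a
  proof -
    have "a = \<one> \<otimes> a" using that AK by auto
    then show ?thesis using that U'(5) unfolding set_mult_def by blast
  qed
  moreover have "U <#> A \<subseteq> Q" using U(2) by (auto simp: set_mult_def)
  ultimately show ?thesis using that by blast
qed

section \<open>Extension of the volume to Borel sets\<close>

definition lam :: "'a set \<Rightarrow> ennreal" where
  "lam Q = (SUP C\<in>{C. clopen C \<and> C \<subseteq> Q}. ennreal (cvol C))"

text \<open>Extending from inside to open sets by \<open>lam\<close> and then from outside to all
  sets makes both regularity clauses of \<open>normalized_haar_measure\<close> immediate.\<close>

definition haar_outer :: "'a set \<Rightarrow> ennreal" where
  "haar_outer A = (INF Q\<in>{Q. openin TK Q \<and> A \<subseteq> Q}. lam Q)"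

lemma lam_upper: "clopen C \<Longrightarrow> C \<subseteq> Q \<Longrightarrow> ennreal (cvol C) \<le> lam Q"
  unfolding lam_def by (rule SUP_upper) simp

lemma lam_mono: "P \<subseteq> Q \<Longrightarrow> lam P \<le> lam Q"
  unfolding lam_def by (rule SUP_subset_mono) auto

lemma lam_clopen:
  assumes "clopen C" shows "lam C = ennreal (cvol C)"
proof (rule antisym)
  show "lam C \<le> ennreal (cvol C)"
    unfolding lam_def by (rule SUP_least) (use assms cvol_mono in \<open>auto intro: ennreal_leI\<close>)
  show "ennreal (cvol C) \<le> lam C" using assms by (intro lam_upper) auto
qed

text \<open>A clopen \<open>C\<close> in the union is cut along a clopen \<open>E\<close> with
  \<open>C - P \<subseteq> E \<subseteq> Q\<close>; the remainder \<open>C - E\<close> lies in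
  \<open>P\<close>.\<close>

lemma lam_Un:
  assumes P: "openin TK P" and Q: "openin TK Q"
  shows "lam (P \<union> Q) \<le> lam P + lam Q"
  unfolding lam_def[of "P \<union> Q"]
proof (rule SUP_least)
  fix C assume "C \<in> {C. clopen C \<and> C \<subseteq> P \<union> Q}"
  then have C: "clopen C" "C \<subseteq> P \<union> Q" by auto
  have "closedin TK (C - P)" using C P by (auto simp: clopen_def intro: closedin_diff)
  then obtain E where E: "clopen E" "C - P \<subseteq> E" "E \<subseteq> Q"
    by (rule clopen_between[OF _ Q]) (use C in auto)
  have "cvol C \<le> cvol (C - E) + cvol E"
  proof -
    have "cvol C \<le> cvol ((C - E) \<union> E)"
      using C(1) E(1) by (intro cvol_mono clopen_Un clopen_Diff) auto
    also have "\<dots> = cvol (C - E) + cvol E"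
      using C(1) E(1) by (intro cvol_Un clopen_Diff) auto
    finally show ?thesis .
  qed
  then have "ennreal (cvol C) \<le> ennreal (cvol (C - E)) + ennreal (cvol E)"
    by (simp add: cvol_nonneg ennreal_plus[symmetric] ennreal_leI del: ennreal_plus)
  also have "\<dots> \<le> lam P + lam Q"
    using C E by (intro add_mono lam_upper clopen_Diff) auto
  finally show "ennreal (cvol C) \<le> lam P + lam Q" .
qed

lemma lam_empty [simp]: "lam {} = 0"
  using lam_clopen[OF clopen_empty] by simp

lemma lam_UN_lessThan:
  assumes "\<And>i::nat. openin TK (Q i)"
  shows "lam (\<Union>i<n. Q i) \<le> (\<Sum>i<n. lam (Q i))"
proof (induction n)
  case (Suc n)
  have "lam (\<Union>i<Suc n. Q i) \<le> lam (\<Union>i<n. Q i) + lam (Q n)"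
    using lam_Un[of "\<Union>i<n. Q i" "Q n"] assms by (auto simp: lessThan_Suc Un_commute)
  also have "\<dots> \<le> (\<Sum>i<Suc n. lam (Q i))" using Suc by (simp add: add_right_mono)
  finally show ?case .
qed simp

text \<open>Compactness of a clopen subset reduces the countable cover to a finite one.\<close>

lemma lam_UN:
  assumes Q: "\<And>i::nat. openin TK (Q i)"
  shows "lam (\<Union>i. Q i) \<le> (\<Sum>i. lam (Q i))"
  unfolding lam_def[of "\<Union>i. Q i"]
proof (rule SUP_least)
  fix C assume "C \<in> {C. clopen C \<and> C \<subseteq> (\<Union>i. Q i)}"
  then have C: "clopen C" "C \<subseteq> (\<Union>i. Q i)" by auto
  then have "compactin TK C" by (simp add: clopen_def closed_compactin_K)
  then have "\<exists>\<F>. finite \<F> \<and> \<F> \<subseteq> range Q \<and> C \<subseteq> \<Union>\<F>"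
    using Q C by (intro compactinD) auto
  then obtain \<F> where "finite \<F>" "\<F> \<subseteq> range Q" "C \<subseteq> \<Union>\<F>" by blast
  then obtain I where I: "finite I" "\<F> = Q ` I" "C \<subseteq> \<Union>(Q ` I)"
    using finite_subset_image[of \<F> Q UNIV] by auto
  obtain n where "I \<subseteq> {..<n}" using I(1) finite_nat_iff_bounded by auto
  then have "C \<subseteq> (\<Union>i<n. Q i)" using I(3) by blast
  then have "ennreal (cvol C) \<le> lam (\<Union>i<n. Q i)" by (rule lam_upper[OF C(1)])
  also have "\<dots> \<le> (\<Sum>i<n. lam (Q i))" by (rule lam_UN_lessThan[OF Q])
  also have "\<dots> \<le> (\<Sum>i. lam (Q i))" by (rule sum_le_suminf) auto
  finally show "ennreal (cvol C) \<le> (\<Sum>i. lam (Q i))" .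
qed

lemma haar_outer_le: "openin TK Q \<Longrightarrow> A \<subseteq> Q \<Longrightarrow> haar_outer A \<le> lam Q"
  unfolding haar_outer_def by (rule INF_lower) simp

lemma haar_outer_open: "openin TK Q \<Longrightarrow> haar_outer Q = lam Q"
  by (rule antisym[OF haar_outer_le]) (auto simp: haar_outer_def intro!: INF_greatest lam_mono)

lemma haar_outer_mono: "A \<subseteq> B \<Longrightarrow> haar_outer A \<le> haar_outer B"
  unfolding haar_outer_def by (rule INF_superset_mono) auto

lemma haar_outer_close:
  assumes "haar_outer A < e"
  obtains Q where "openin TK Q" "A \<subseteq> Q" "lam Q < e"
  using assms unfolding haar_outer_def INF_less_iff by auto

lemma outer_measure_space_haar_outer: "outer_measure_space (Pow K) haar_outer"
  unfolding outer_measure_space_def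
proof (intro conjI)
  show "positive (Pow K) haar_outer" by (simp add: positive_def haar_outer_open)
  show "increasing (Pow K) haar_outer" by (simp add: increasing_def haar_outer_mono)
  show "countably_subadditive (Pow K) haar_outer"
    unfolding countably_subadditive_def
  proof (intro allI impI)
    fix A :: "nat \<Rightarrow> 'a set"
    show "haar_outer (\<Union>i. A i) \<le> (\<Sum>n. haar_outer (A n))"
    proof (rule ennreal_le_epsilon)
      fix e :: real assume e: "0 < e" "(\<Sum>n. haar_outer (A n)) < Orderings.top"
      then have *: "\<And>n. haar_outer (A n) < haar_outer (A n) + e * (1/2)^Suc n"
        by (auto simp add: less_top dest!: ennreal_suminf_lessD)
      have "\<exists>Q. openin TK Q \<and> A n \<subseteq> Q \<and> lam Q < haar_outer (A n) + e * (1/2)^Suc n" for n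
        using haar_outer_close[OF *[of n]] by metis
      then obtain Q where Q: "\<And>n. openin TK (Q n)" "\<And>n. A n \<subseteq> Q n"
          "\<And>n. lam (Q n) < haar_outer (A n) + e * (1/2)^Suc n"
        by metis
      have "haar_outer (\<Union>i. A i) \<le> lam (\<Union>i. Q i)"
        using Q by (intro haar_outer_le) blast+
      also have "\<dots> \<le> (\<Sum>n. lam (Q n))" by (rule lam_UN[OF Q(1)])
      also have "\<dots> \<le> (\<Sum>n. haar_outer (A n) + e * (1/2) ^ Suc n)"
        using Q(3) by (intro suminf_le) (auto intro: less_imp_le)
      also have "\<dots> = (\<Sum>n. haar_outer (A n)) + (\<Sum>n. ennreal e * ennreal ((1/2) ^ Suc n))"
        using \<open>0 < e\<close> by (subst suminf_add[symmetric])
          (auto simp del: ennreal_suminf_cmult simp add: ennreal_mult[symmetric])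
      also have "\<dots> = (\<Sum>n. haar_outer (A n)) + e"
        unfolding ennreal_suminf_cmult
        by (subst suminf_ennreal_eq[OF zero_le_power power_half_series]) auto
      finally show "haar_outer (\<Union>i. A i) \<le> (\<Sum>n. haar_outer (A n)) + e" .
    qed
  qed
qed

text \<open>The substantial half of Caratheodory's criterion, for an open test set \<open>P\<close>:
  a clopen \<open>C\<close> inside \<open>Q \<inter> P\<close> leaves the open set
  \<open>P - C\<close>, which contains \<open>P - Q\<close>, and the volumes of disjoint clopen sets
  add up inside \<open>P\<close>.\<close>

lemma lam_split:
  assumes "openin TK P" "openin TK Q"
  shows "lam (Q \<inter> P) + haar_outer (P - Q) \<le> lam P"
proof -
  have *: "ennreal (cvol C) + haar_outer (P - Q) \<le> lam P" if C: "clopen C" "C \<subseteq> Q \<inter> P" for C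
  proof -
    have o: "openin TK (P - C)" using assms C by (auto simp: clopen_def intro: openin_diff)
    have "haar_outer (P - Q) \<le> lam (P - C)" using C by (intro haar_outer_le[OF o]) auto
    also have "ennreal (cvol C) + lam (P - C) \<le> lam P"
    proof -
      have "ennreal (cvol C) + ennreal (cvol E) \<le> lam P" if E: "clopen E" "E \<subseteq> P - C" for E
      proof -
        have "ennreal (cvol C) + ennreal (cvol E) = ennreal (cvol (C \<union> E))"
          using E C by (subst cvol_Un) (auto simp: ennreal_plus cvol_nonneg)
        also have "\<dots> \<le> lam P" using E C by (intro lam_upper clopen_Un) auto
        finally show ?thesis .
      qed
      moreover have ne: "{E. clopen E \<and> E \<subseteq> P - C} \<noteq> {}" using clopen_empty by blast
      have "ennreal (cvol C) + lam (P - C) =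
          (SUP E\<in>{E. clopen E \<and> E \<subseteq> P - C}. ennreal (cvol C) + ennreal (cvol E))"
        unfolding lam_def[of "P - C"] by (rule ennreal_SUP_add_right[OF ne])
      ultimately show ?thesis by (auto intro!: SUP_least)
    qed
    finally (add_left_mono[THEN order_trans]) show ?thesis .
  qed
  have ne: "{C. clopen C \<and> C \<subseteq> Q \<inter> P} \<noteq> {}" using clopen_empty by blast
  have "lam (Q \<inter> P) + haar_outer (P - Q) =
      (SUP C\<in>{C. clopen C \<and> C \<subseteq> Q \<inter> P}. ennreal (cvol C) + haar_outer (P - Q))"
    unfolding lam_def[of "Q \<inter> P"] by (rule ennreal_SUP_add_left[OF ne, symmetric])
  then show ?thesis using * by (auto intro!: SUP_least)
qed

lemma open_in_lambda_system:
  assumes Q: "openin TK Q"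
  shows "Q \<in> lambda_system K (Pow K) haar_outer"
  unfolding lambda_system_def
proof (intro CollectI conjI ballI antisym)
  show "Q \<in> Pow K" using Q openin_TK_subset by blast
  fix A assume A: "A \<in> Pow K"
  show "haar_outer (Q \<inter> A) + haar_outer ((K - Q) \<inter> A) \<le> haar_outer A"
    unfolding haar_outer_def[of A]
  proof (rule INF_greatest)
    fix P assume "P \<in> {P. openin TK P \<and> A \<subseteq> P}"
    then have P: "openin TK P" "A \<subseteq> P" by auto
    have "haar_outer (Q \<inter> A) \<le> lam (Q \<inter> P)"
      using P Q by (intro haar_outer_le openin_Int) auto
    moreover have "haar_outer ((K - Q) \<inter> A) \<le> haar_outer (P - Q)"
      using P by (intro haar_outer_mono) auto
    ultimately have "haar_outer (Q \<inter> A) + haar_outer ((K - Q) \<inter> A) \<le> lam (Q \<inter> P) + haar_outer (P - Q)"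
      by (rule add_mono)
    also have "\<dots> \<le> lam P" by (rule lam_split[OF P(1) Q])
    finally show "haar_outer (Q \<inter> A) + haar_outer ((K - Q) \<inter> A) \<le> lam P" .
  qed
  have "A = (Q \<inter> A) \<union> ((K - Q) \<inter> A)" using A by auto
  moreover have "subadditive (Pow K) haar_outer"
  proof (rule ring_of_sets.countably_subadditive_subadditive)
    show "ring_of_sets K (Pow K)" by (rule ring_of_sets_Pow)
  qed (use outer_measure_space_haar_outer in \<open>auto simp: outer_measure_space_def\<close>)
  then have "haar_outer ((Q \<inter> A) \<union> ((K - Q) \<inter> A)) \<le> haar_outer (Q \<inter> A) + haar_outer ((K - Q) \<inter> A)"
    using A by (intro subadditiveD[of "Pow K"]) auto
  ultimately show "haar_outer A \<le> haar_outer (Q \<inter> A) + haar_outer ((K - Q) \<inter> A)" by simp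
qed

section \<open>Haar measure, its regularity and its automorphisms\<close>

definition haar :: "'a measure" where
  "haar = measure_of K {Q. openin TK Q} haar_outer"

lemma opens_Pow: "{Q. openin TK Q} \<subseteq> Pow K"
  using openin_TK_subset by auto

lemma sets_haar: "sets haar = sigma_sets K {Q. openin TK Q}"
  using opens_Pow by (simp add: haar_def)

lemma space_haar [simp]: "space haar = K"
  using opens_Pow by (simp add: haar_def space_measure_of)

text \<open>\<open>measure_of\<close> falls back to the zero measure unless it is given a measure on
  the generated sigma-algebra; Caratheodory's theorem provides this since the open sets lie in the
  lambda system.\<close>

lemma emeasure_haar:
  assumes "A \<in> sets haar" shows "emeasure haar A = haar_outer A"
proof (rule emeasure_measure_of[OF haar_def opens_Pow _ _ assms])
  interpret P: sigma_algebra K "Pow K" by (rule sigma_algebra_Pow)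
  have "measure_space K (lambda_system K (Pow K) haar_outer) haar_outer"
    by (rule P.caratheodory_lemma[OF outer_measure_space_haar_outer])
  moreover have "sigma_sets K {Q. openin TK Q} \<subseteq> lambda_system K (Pow K) haar_outer"
    using calculation open_in_lambda_system
    by (intro sigma_algebra.sigma_sets_subset) (auto simp: measure_space_def)
  ultimately have "measure_space K (sigma_sets K {Q. openin TK Q}) haar_outer"
    by (rule measure_down[OF _ sigma_algebra_sigma_sets[OF opens_Pow]])
  then show "positive (sets haar) haar_outer" "countably_additive (sets haar) haar_outer"
    by (auto simp: measure_space_def sets_haar)
qed

lemma open_sets_haar: "openin TK Q \<Longrightarrow> Q \<in> sets haar"
  by (auto simp: sets_haar)

lemma clopen_sets_haar: "clopen C \<Longrightarrow> C \<in> sets haar"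
  by (simp add: clopen_def open_sets_haar)

lemma emeasure_haar_clopen: "clopen C \<Longrightarrow> emeasure haar C = ennreal (cvol C)"
  by (simp add: emeasure_haar clopen_sets_haar haar_outer_open lam_clopen clopen_def[of C, THEN iffD1])

lemma emeasure_haar_open: "openin TK Q \<Longrightarrow> emeasure haar Q = lam Q"
  by (simp add: emeasure_haar open_sets_haar haar_outer_open)

lemma emeasure_haar_K: "emeasure haar K = 1"
  using emeasure_haar_clopen[OF clopen_K] by (simp add: cvol_K)

lemma finite_measure_haar: "finite_measure haar"
  by (rule finite_measureI) (simp add: emeasure_haar_K)

text \<open>Abstracts what left translations and conjugations share. \<open>V\<close> is
  existentially quantified because a conjugation sends cosets of \<open>U\<close> to cosets of a
  conjugate subgroup.\<close>

definition "haar_automorphism f \<longleftrightarrow> bij_betw f K K \<and> (\<forall>Q\<subseteq>K. openin TK Q \<longleftrightarrow> openin TK (f ` Q)) \<and>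
  (\<forall>U. open_subgroup U \<longrightarrow> (\<exists>V. open_subgroup V \<and> (\<forall>x\<in>K. f ` (x <# U) = f x <# V)))"

text \<open>\<open>f\<close> permutes the open and the clopen sets and preserves
  \<open>cvol\<close>, so the supremum defining \<open>lam\<close> and the infimum defining
  \<open>haar_outer\<close> are merely reindexed.\<close>

lemma haar_image:
  assumes f: "haar_automorphism f" and A: "A \<in> sets haar"
  shows "f ` A \<in> sets haar" "emeasure haar (f ` A) = emeasure haar A"
proof -
  have inj: "inj_on f K" and fK: "f ` K = K" using f unfolding haar_automorphism_def bij_betw_def by blast+
  have op: "openin TK Q \<longleftrightarrow> openin TK (f ` Q)" if "Q \<subseteq> K" for Q
    using f that unfolding haar_automorphism_def by blast
  have cosets: "\<exists>V. open_subgroup V \<and> (\<forall>x\<in>K. f ` (x <# U) = f x <# V)" if "open_subgroup U" for U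
    using f that unfolding haar_automorphism_def by blast
  have diff: "f ` (K - Q) = K - f ` Q" if "Q \<subseteq> K" for Q
    using inj_on_image_set_diff[OF inj, of K Q] that fK by auto
  have cl: "clopen C \<longleftrightarrow> clopen (f ` C)" if "C \<subseteq> K" for C
  proof -
    have "f ` C \<subseteq> K" using that fK by blast
    then have "openin TK (K - C) \<longleftrightarrow> openin TK (K - f ` C)" using op[of "K - C"] diff[OF that] by simp
    then show ?thesis using op[OF that] that \<open>f ` C \<subseteq> K\<close> by (simp add: clopen_def closedin_def)
  qed
  have cv: "cvol (f ` C) = cvol C" if "clopen C" for C
    by (rule cvol_image[OF that _ inj fK cosets]) (use cl[OF clopen_subset[OF that]] that in blast)
  have pre: "\<exists>C\<subseteq>K. B = f ` C" if "B \<subseteq> K" for B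
    using that fK by (metis subset_imageE)
  have lam_eq: "lam (f ` Q) = lam Q" if Q: "Q \<subseteq> K" for Q
  proof -
    have "{C. clopen C \<and> C \<subseteq> f ` Q} = (\<lambda>C. f ` C) ` {C. clopen C \<and> C \<subseteq> Q}"
    proof (intro equalityI subsetI)
      fix B assume "B \<in> {C. clopen C \<and> C \<subseteq> f ` Q}"
      then have B: "clopen B" "B \<subseteq> f ` Q" by auto
      then obtain C where C: "C \<subseteq> Q" "B = f ` C" by (metis subset_imageE)
      then show "B \<in> (\<lambda>C. f ` C) ` {C. clopen C \<and> C \<subseteq> Q}" using B cl[of C] Q by auto
    qed (use cl Q in auto)
    then show ?thesis
      unfolding lam_def by (simp add: image_image cv cong: image_cong_simp)
  qed
  show "f ` A \<in> sets haar"
    using A unfolding sets_haar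
  proof (induction rule: sigma_sets.induct)
    case (Basic Q)
    then show ?case using op[of Q] openin_TK_subset[of Q] by (intro sigma_sets.Basic) auto
  next
    case (Compl B)
    have "B \<subseteq> K" using sigma_sets_into_sp[OF opens_Pow Compl.hyps] .
    then show ?case using diff Compl.IH sigma_sets.Compl by metis
  next
    case (Union B)
    then show ?case by (simp add: image_UN sigma_sets.Union)
  qed (simp add: sigma_sets.Empty)
  moreover have "haar_outer (f ` A) = haar_outer A"
  proof -
    have AK: "A \<subseteq> K" using sets.sets_into_space[OF A] by simp
    have "{Q. openin TK Q \<and> f ` A \<subseteq> Q} = (\<lambda>Q. f ` Q) ` {Q. openin TK Q \<and> A \<subseteq> Q}"
    proof (intro equalityI subsetI)
      fix B assume "B \<in> {Q. openin TK Q \<and> f ` A \<subseteq> Q}"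
      then have B: "openin TK B" "f ` A \<subseteq> B" by auto
      then obtain Q where Q: "Q \<subseteq> K" "B = f ` Q" using pre openin_TK_subset by metis
      then have "A \<subseteq> Q" using B AK inj by (metis inj_on_image_subset_iff)
      then show "B \<in> (\<lambda>Q. f ` Q) ` {Q. openin TK Q \<and> A \<subseteq> Q}" using B Q op[of Q] by auto
    next
      fix B assume "B \<in> (\<lambda>Q. f ` Q) ` {Q. openin TK Q \<and> A \<subseteq> Q}"
      then show "B \<in> {Q. openin TK Q \<and> f ` A \<subseteq> Q}" using op openin_TK_subset by blast
    qed
    then show ?thesis
      unfolding haar_outer_def using lam_eq openin_TK_subset by (simp add: image_image cong: image_cong_simp)
  qed
  ultimately show "emeasure haar (f ` A) = emeasure haar A" using A by (simp add: emeasure_haar)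
qed

lemma haar_automorphism_lmult:
  assumes x: "x \<in> K" shows "haar_automorphism (\<lambda>y. x \<otimes> y)"
  unfolding haar_automorphism_def
proof (intro conjI allI impI)
  show "bij_betw (\<lambda>y. x \<otimes> y) K K"
    by (rule bij_betwI[of _ _ _ "\<lambda>y. inv x \<otimes> y"]) (use x in \<open>auto simp: m_assoc[symmetric]\<close>)
  show "openin TK Q \<longleftrightarrow> openin TK ((\<lambda>y. x \<otimes> y) ` Q)" if Q: "Q \<subseteq> K" for Q
  proof
    assume "openin TK Q"
    then show "openin TK ((\<lambda>y. x \<otimes> y) ` Q)" by (rule openin_lmult[OF x])
  next
    assume "openin TK ((\<lambda>y. x \<otimes> y) ` Q)"
    then have "openin TK ((\<lambda>y. inv x \<otimes> y) ` (\<lambda>y. x \<otimes> y) ` Q)"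
      by (rule openin_lmult[OF K_inv[OF x]])
    moreover have "(\<lambda>y. inv x \<otimes> y) ` (\<lambda>y. x \<otimes> y) ` Q = (\<lambda>y. y) ` Q"
      unfolding image_image using Q x by (intro image_cong refl) auto
    ultimately show "openin TK Q" by (simp only: image_ident)
  qed
  fix U assume U: "open_subgroup U"
  show "\<exists>V. open_subgroup V \<and> (\<forall>y\<in>K. (\<lambda>y. x \<otimes> y) ` (y <# U) = (x \<otimes> y) <# V)"
  proof (intro exI conjI ballI)
    fix y assume "y \<in> K"
    then show "(\<lambda>y. x \<otimes> y) ` (y <# U) = (x \<otimes> y) <# U"
      using lcos_m_assoc[OF open_subgroupD(5)[OF U], of x y] x by (simp add: l_coset_eq_image)
  qed (rule U)
qed

lemma l_coset_haar:
  assumes "x \<in> K" "A \<in> sets haar"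
  shows "x <# A \<in> sets haar" "emeasure haar (x <# A) = emeasure haar A"
  using haar_image[OF haar_automorphism_lmult[OF assms(1)] assms(2)] by (simp_all add: l_coset_eq_image)

lemma normalized_haar: "normalized_haar_measure G T K haar"
  unfolding normalized_haar_measure_def
proof (intro conjI ballI allI impI)
  show "sets haar = sets (sigma K {U. openin (subtopology T K) U})"
    using opens_Pow by (simp add: sets_haar)
  show "emeasure haar K = 1" by (rule emeasure_haar_K)
  show "emeasure haar (x <# A) = emeasure haar A" if "x \<in> K" "A \<in> sets haar" for x A
    using that by (rule l_coset_haar)
  show "emeasure haar A = (INF U\<in>{U. openin TK U \<and> A \<subseteq> U}. emeasure haar U)" if "A \<in> sets haar" for A
    using that by (simp add: emeasure_haar haar_outer_def emeasure_haar_open cong: image_cong_simp)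
  fix Q assume Q: "openin TK Q"
  show "emeasure haar Q = (SUP C\<in>{C. compactin TK C \<and> C \<subseteq> Q}. emeasure haar C)"
  proof (rule antisym)
    show "emeasure haar Q \<le> (SUP C\<in>{C. compactin TK C \<and> C \<subseteq> Q}. emeasure haar C)"
      unfolding emeasure_haar_open[OF Q] lam_def
    proof (rule SUP_mono)
      fix C assume C: "C \<in> {C. clopen C \<and> C \<subseteq> Q}"
      then have "C \<in> {C. compactin TK C \<and> C \<subseteq> Q}" by (simp add: clopen_def closed_compactin_K)
      moreover have "ennreal (cvol C) \<le> emeasure haar C" using C emeasure_haar_clopen by simp
      ultimately show "\<exists>D\<in>{C. compactin TK C \<and> C \<subseteq> Q}. ennreal (cvol C) \<le> emeasure haar D" by blast
    qed
    show "(SUP C\<in>{C. compactin TK C \<and> C \<subseteq> Q}. emeasure haar C) \<le> emeasure haar Q"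
      by (rule SUP_least) (auto intro!: emeasure_mono open_sets_haar Q)
  qed
qed

end

section \<open>Ergodicity\<close>

context profinite_subgroup
begin

text \<open>The pseudometric of the measure algebra: distance 0 means equality up to a null
  set.\<close>

definition "sdist A B = measure haar (sym_diff A B)"

lemma sdist_commute: "sdist A B = sdist B A"
  by (simp add: sdist_def Un_commute)

lemma sdist_triangle:
  assumes "A \<in> sets haar" "B \<in> sets haar" "C \<in> sets haar"
  shows "sdist A C \<le> sdist A B + sdist B C"
proof -
  interpret finite_measure haar by (rule finite_measure_haar)
  have "sdist A C \<le> measure haar (sym_diff A B \<union> sym_diff B C)"
    unfolding sdist_def using assms by (intro finite_measure_mono) auto
  also have "\<dots> \<le> sdist A B + sdist B C"
    unfolding sdist_def using assms by (intro measure_Un_le) auto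
  finally show ?thesis .
qed

lemma sdist_image:
  assumes f: "haar_automorphism f" and A: "A \<in> sets haar" "B \<in> sets haar"
  shows "sdist (f ` A) (f ` B) = sdist A B"
proof -
  have inj: "inj_on f K" using f unfolding haar_automorphism_def bij_betw_def by blast
  have "A \<subseteq> K" "B \<subseteq> K" using A sets.sets_into_space by fastforce+
  then have "sym_diff (f ` A) (f ` B) = f ` sym_diff A B"
    using inj_on_image_set_diff[OF inj, of A B] inj_on_image_set_diff[OF inj, of B A] by (auto simp: image_Un)
  moreover have "emeasure haar (f ` sym_diff A B) = emeasure haar (sym_diff A B)"
    by (rule haar_image[OF f]) (use A in auto)
  ultimately show ?thesis by (simp add: sdist_def measure_def)
qed

lemma sdist_l_coset:
  assumes "x \<in> K" "A \<in> sets haar" "B \<in> sets haar"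
  shows "sdist (x <# A) (x <# B) = sdist A B"
  using sdist_image[OF haar_automorphism_lmult[OF assms(1)] assms(2,3)] by (simp add: l_coset_eq_image)

lemma measure_diff_le_sdist:
  assumes "A \<in> sets haar" "B \<in> sets haar" "E \<in> sets haar"
  shows "\<bar>measure haar (A \<inter> E) - measure haar (B \<inter> E)\<bar> \<le> sdist A B"
proof -
  interpret finite_measure haar by (rule finite_measure_haar)
  have *: "measure haar (P \<inter> E) \<le> measure haar (Q \<inter> E) + sdist P Q" if "P \<in> sets haar" "Q \<in> sets haar" for P Q
  proof -
    have "measure haar (P \<inter> E) \<le> measure haar ((Q \<inter> E) \<union> sym_diff P Q)"
      using that assms by (intro finite_measure_mono) auto
    also have "\<dots> \<le> measure haar (Q \<inter> E) + sdist P Q"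
      unfolding sdist_def using that assms by (intro measure_Un_le) auto
    finally show ?thesis .
  qed
  show ?thesis using *[of A B] *[of B A] assms by (simp add: sdist_commute[of B A] abs_le_iff)
qed

lemma measure_haar_clopen: "clopen C \<Longrightarrow> measure haar C = cvol C"
  by (simp add: measure_def emeasure_haar_clopen cvol_nonneg)

text \<open>Outer regularity gives an open \<open>Q\<close> around \<open>A\<close>, inner
  approximation a clopen \<open>C\<close> inside \<open>Q\<close>. Both \<open>A\<close> and
  \<open>C\<close> lie in \<open>Q\<close>, so their difference is covered by \<open>Q - A\<close>
  and \<open>Q - C\<close>, each of measure below \<open>e / 2\<close>.\<close>

lemma clopen_approx:
  assumes A: "A \<in> sets haar" and e: "0 < e"
  obtains C where "clopen C" "sdist A C < e"
proof -
  interpret finite_measure haar by (rule finite_measure_haar)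
  have "haar_outer A < haar_outer A + ennreal (e / 2)"
    using emeasure_finite[of A] e by (simp add: emeasure_haar[OF A] less_top[symmetric])
  then obtain Q where Q: "openin TK Q" "A \<subseteq> Q" "lam Q < haar_outer A + ennreal (e / 2)"
    by (rule haar_outer_close)
  have Qs: "Q \<in> sets haar" using Q(1) by (rule open_sets_haar)
  have "ennreal (measure haar Q) < ennreal (measure haar A + e / 2)"
    using Q e by (simp add: emeasure_haar_open[symmetric] emeasure_haar[OF A, symmetric] emeasure_eq_measure)
  then have 1: "measure haar Q < measure haar A + e / 2"
    by (simp add: ennreal_less_iff)
  have "\<exists>C. clopen C \<and> C \<subseteq> Q \<and> measure haar Q - e / 2 < cvol C"
  proof (rule ccontr)
    assume no: "\<not> ?thesis"
    have *: "cvol C \<le> measure haar Q - e / 2" if "clopen C" "C \<subseteq> Q" for C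
      by (rule leI, rule notI) (use no that in blast)
    have "lam Q \<le> ennreal (measure haar Q - e / 2)"
      unfolding lam_def by (rule SUP_least) (use * in \<open>auto intro!: ennreal_leI\<close>)
    then have "ennreal (measure haar Q) \<le> ennreal (measure haar Q - e / 2)"
      by (simp add: emeasure_haar_open[OF Q(1), symmetric] emeasure_eq_measure)
    \<comment> \<open>The empty clopen set shows that \<open>measure haar Q - e / 2\<close> is
      nonnegative, so \<open>ennreal\<close> does not truncate it.\<close>
    then show False using *[OF clopen_empty] e by (simp add: ennreal_le_iff)
  qed
  then obtain C where C: "clopen C" "C \<subseteq> Q" "measure haar Q - e / 2 < cvol C" by blast
  have Cs: "C \<in> sets haar" using C(1) by (rule clopen_sets_haar)
  have 2: "measure haar (Q - C) < e / 2"
    using C finite_measure_Diff[OF Qs Cs C(2)] by (simp add: measure_haar_clopen)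
  have 3: "measure haar (Q - A) < e / 2"
    using 1 finite_measure_Diff[OF Qs A Q(2)] by simp
  have "sdist A C \<le> measure haar ((Q - A) \<union> (Q - C))"
    unfolding sdist_def using Q(2) C(2) Qs A Cs by (intro finite_measure_mono) auto
  also have "\<dots> \<le> measure haar (Q - A) + measure haar (Q - C)"
    using Qs A Cs by (intro measure_Un_le) auto
  also have "\<dots> < e" using 2 3 by simp
  finally show ?thesis using that C by blast
qed

lemma measure_haar_open_pos:
  assumes "openin TK Q" "x \<in> Q" shows "0 < measure haar Q"
proof -
  interpret finite_measure haar by (rule finite_measure_haar)
  obtain C where C: "openin TK C" "compactin T C" "x \<in> C" "C \<subseteq> Q" using clopen_nbhd[OF assms] .
  have cl: "clopen C" using C openin_TK_subset[of C] compactin_closed_K[of C] by (auto simp: clopen_def compactin_TK)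
  define U where "U = right_stab C"
  have U: "open_subgroup U" unfolding U_def by (rule open_subgroup_right_stab[OF cl])
  have "0 < ncosets U C"
    using finite_cosets[OF U clopen_subset[OF cl]] C(3) unfolding ncosets_def card_gt_0_iff by blast
  then have "0 < cvol C" using ncosets_K_pos[OF U] by (simp add: cvol_def coset_density_def U_def)
  also have "cvol C = measure haar C" using measure_haar_clopen[OF cl] by simp
  also have "\<dots> \<le> measure haar Q" using C(4) open_sets_haar[OF assms(1)] by (rule finite_measure_mono)
  finally show ?thesis .
qed

text \<open>All cosets of an open subgroup meet \<open>A\<close> in the same measure, so counting
  cosets makes \<open>A\<close> independent of every clopen set.\<close>

lemma measure_translation_invariant:
  assumes A: "A \<in> sets haar" and inv: "\<And>x. x \<in> K \<Longrightarrow> sdist (x <# A) A = 0"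
  shows "measure haar A = 0 \<or> measure haar A = 1"
proof -
  interpret finite_measure haar by (rule finite_measure_haar)
  let ?a = "measure haar A"
  have AK: "A \<subseteq> K" using sets.sets_into_space[OF A] by simp
  have indep: "measure haar (A \<inter> C) = ?a * measure haar C" if C: "clopen C" for C
  proof -
    define U where "U = right_stab C"
    have U: "open_subgroup U" unfolding U_def by (rule open_subgroup_right_stab[OF C])
    have Us: "U \<in> sets haar" using open_subgroupD(2)[OF U] by (rule open_sets_haar)
    have coset: "measure haar (A \<inter> (z <# U)) = measure haar (A \<inter> U)" if z: "z \<in> K" for z
    proof -
      have zU: "z <# U \<in> sets haar" using z Us by (rule l_coset_haar)
      have zA: "z <# A \<in> sets haar" using z A by (rule l_coset_haar)
      have "inj_on (\<lambda>y. z \<otimes> y) K"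
        using haar_automorphism_lmult[OF z] unfolding haar_automorphism_def bij_betw_def by blast
      then have "z <# (A \<inter> U) = (z <# A) \<inter> (z <# U)"
        unfolding l_coset_eq_image using AK open_subgroupD(3)[OF U] by (rule inj_on_image_Int)
      then have "measure haar ((z <# A) \<inter> (z <# U)) = measure haar (A \<inter> U)"
        using l_coset_haar(2)[OF z, of "A \<inter> U"] A Us by (simp add: measure_def)
      moreover have "\<bar>measure haar ((z <# A) \<inter> (z <# U)) - measure haar (A \<inter> (z <# U))\<bar> \<le> 0"
        using measure_diff_le_sdist[OF zA A zU] inv[OF z] by simp
      ultimately show ?thesis by simp
    qed
    have count: "measure haar (A \<inter> B) = real (ncosets U B) * measure haar (A \<inter> U)"
      if B: "B \<subseteq> K" "saturated U B" for B
    proof -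
      have "A \<inter> B = (\<Union>c\<in>(\<lambda>x. x <# U) ` B. A \<inter> c)"
        using B coset_self[OF U] by (auto simp: saturated_def subset_iff)
      then have "measure haar (A \<inter> B) = measure haar (\<Union>c\<in>(\<lambda>x. x <# U) ` B. A \<inter> c)" by simp
      also have "\<dots> = (\<Sum>c\<in>(\<lambda>x. x <# U) ` B. measure haar (A \<inter> c))"
      proof (rule finite_measure_finite_Union)
        show "finite ((\<lambda>x. x <# U) ` B)" by (rule finite_cosets[OF U B(1)])
        have "x <# U \<in> sets haar" if "x \<in> B" for x using l_coset_haar(1)[OF _ Us] B(1) that by blast
        then show "(\<lambda>c. A \<inter> c) ` (\<lambda>x. x <# U) ` B \<subseteq> sets haar" using A by auto
        show "disjoint_family_on (\<lambda>c. A \<inter> c) ((\<lambda>x. x <# U) ` B)"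
          unfolding disjoint_family_on_def
        proof (intro ballI impI, rule ccontr)
          fix c d assume cd: "c \<in> (\<lambda>x. x <# U) ` B" "d \<in> (\<lambda>x. x <# U) ` B" "c \<noteq> d"
            and ne: "(A \<inter> c) \<inter> (A \<inter> d) \<noteq> {}"
          obtain x y where xy: "x \<in> K" "c = x <# U" "y \<in> K" "d = y <# U" using cd B(1) by blast
          obtain a where a: "a \<in> c" "a \<in> d" using ne by blast
          have "a <# U = c" using coset_eq[OF U xy(1), of a] a(1) xy(2) by simp
          moreover have "a <# U = d" using coset_eq[OF U xy(3), of a] a(2) xy(4) by simp
          ultimately show False using cd(3) by simp
        qed
      qed
      also have "\<dots> = (\<Sum>c\<in>(\<lambda>x. x <# U) ` B. measure haar (A \<inter> U))"
        using coset B(1) by (intro sum.cong) auto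
      also have "\<dots> = real (ncosets U B) * measure haar (A \<inter> U)" by (simp add: ncosets_def)
      finally show ?thesis .
    qed
    have "A \<inter> K = A" using AK by blast
    then have a: "?a = real (ncosets U K) * measure haar (A \<inter> U)"
      using count[OF order_refl saturated_K[OF U]] by simp
    have "measure haar (A \<inter> C) = real (ncosets U C) * measure haar (A \<inter> U)"
      by (rule count[OF clopen_subset[OF C]]) (simp add: U_def saturated_right_stab)
    also have "\<dots> = ?a * measure haar C"
      using ncosets_K_pos[OF U] unfolding a measure_haar_clopen[OF C] cvol_def coset_density_def U_def[symmetric]
      by simp
    finally show ?thesis .
  qed
  have a1: "?a \<le> 1"
    using finite_measure_mono[OF AK] clopen_sets_haar[OF clopen_K] measure_haar_clopen[OF clopen_K]
    by (simp add: cvol_K)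
  \<comment> \<open>If \<open>C\<close> is within \<open>e / 2\<close> of \<open>A\<close>, then
    \<open>?a * measure haar C\<close> is within \<open>e / 2\<close> of \<open>?a\<close>, being
    the measure of \<open>A \<inter> C\<close>, and within \<open>e / 2\<close> of
    \<open>?a * ?a\<close>, because \<open>?a \<le> 1\<close>.\<close>
  have "\<bar>?a - ?a * ?a\<bar> \<le> e" if e: "0 < e" for e
  proof -
    obtain C where C: "clopen C" "sdist A C < e / 2" by (rule clopen_approx[OF A, of "e / 2"]) (use e in auto)
    have Cs: "C \<in> sets haar" using C(1) by (rule clopen_sets_haar)
    have CK: "C \<subseteq> K" using C(1) by (rule clopen_subset)
    have "\<bar>measure haar (C \<inter> A) - measure haar (A \<inter> A)\<bar> \<le> sdist C A"
      by (rule measure_diff_le_sdist[OF Cs A A])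
    then have 1: "\<bar>?a * measure haar C - ?a\<bar> \<le> e / 2"
      using indep[OF C(1)] C(2) by (simp add: Int_commute sdist_commute)
    have "\<bar>measure haar (C \<inter> K) - measure haar (A \<inter> K)\<bar> \<le> sdist C A"
      by (rule measure_diff_le_sdist[OF Cs A clopen_sets_haar[OF clopen_K]])
    then have "\<bar>measure haar C - ?a\<bar> \<le> e / 2"
      using C(2) AK CK by (simp add: Int_absorb2 sdist_commute)
    then have "?a * \<bar>measure haar C - ?a\<bar> \<le> 1 * (e / 2)"
      using a1 by (intro mult_mono) auto
    moreover have "\<bar>?a * measure haar C - ?a * ?a\<bar> = ?a * \<bar>measure haar C - ?a\<bar>"
      by (simp add: abs_mult right_diff_distrib[symmetric])
    ultimately have "\<bar>?a * measure haar C - ?a * ?a\<bar> \<le> e / 2" by simp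
    then show ?thesis using 1 by linarith
  qed
  then have "\<bar>?a - ?a * ?a\<bar> \<le> 0 + e" if "0 < e" for e using that by simp
  then have "\<bar>?a - ?a * ?a\<bar> \<le> 0" by (rule field_le_epsilon)
  then have "?a * (1 - ?a) = 0" by (simp add: right_diff_distrib)
  then show ?thesis by simp
qed

text \<open>The intersection of all \<open>K\<close>-conjugates of \<open>U\<close> is open by the
  tube lemma, \<open>K\<close> being compact. Normality will make its product with a closed subgroup
  a group.\<close>

lemma normal_open_subgroup:
  assumes V: "openin TK V" "\<one> \<in> V"
  obtains M where "open_subgroup M" "M \<subseteq> V" "\<forall>x\<in>K. \<forall>m\<in>M. conj_by G x m \<in> M"
proof -
  obtain U where U: "U \<in> compact_open_subgroups G T K" "U \<subseteq> V" using van_Dantzig[OF V] .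
  note U' = compact_open_subgroupsD[OF U(1)]
  have conjK: "conj_by G x m \<in> K" if "x \<in> K" "m \<in> K" for x m using that by (simp add: conj_by_def)
  define M where "M = {m \<in> K. \<forall>x\<in>K. conj_by G x m \<in> U}"
  have "openin TK {m \<in> K. \<forall>x\<in>K. (\<lambda>(x, m). conj_by G x m) (x, m) \<in> U}"
    by (rule openin_tube_TK[OF cont_conj_by K_comp _ U'(2)]) (use conjK in auto)
  then have Mo: "openin TK M" by (simp add: M_def)
  have "subgroup M G"
  proof (rule subgroupI)
    show "M \<subseteq> carrier G" using K_sub by (auto simp: M_def)
    have "\<one> \<in> M" using U'(5) by (simp add: M_def)
    then show "M \<noteq> {}" by blast
    fix a assume a: "a \<in> M"
    show "inv a \<in> M" using a U'(1) by (simp add: M_def conj_by_inv subgroup.m_inv_closed)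
    fix b assume b: "b \<in> M"
    show "a \<otimes> b \<in> M" using a b U'(1) by (simp add: M_def conj_by_mult subgroup.m_closed)
  qed
  then have "open_subgroup M" using Mo by (simp add: open_subgroup_def)
  moreover have "M \<subseteq> V"
  proof
    fix m assume m: "m \<in> M"
    then have "conj_by G \<one> m \<in> U" "m \<in> K" using K_one unfolding M_def by blast+
    then show "m \<in> V" using U(2) by auto
  qed
  moreover have "conj_by G x m \<in> M" if x: "x \<in> K" and m: "m \<in> M" for x m
  proof -
    have mK: "m \<in> K" using m by (simp add: M_def)
    have "conj_by G y (conj_by G x m) \<in> U" if y: "y \<in> K" for y
    proof -
      have "conj_by G (y \<otimes> x) m \<in> U" using m K_mult[OF y x] by (simp add: M_def)
      then show ?thesis using conj_by_comp[of y x m] x y mK by simp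
    qed
    then show ?thesis using conjK[OF x mK] by (simp add: M_def)
  qed
  ultimately show ?thesis using that by blast
qed

end

section \<open>Ergodic actions on a profinite group\<close>

locale profinite_action = profinite_subgroup G T K + conj_action G T K H
  for G :: "('a, 'b) monoid_scheme" (structure) and T K H
begin

lemma haar_automorphism_conj_by:
  assumes h: "h \<in> H" shows "haar_automorphism (conj_by G h)"
  unfolding haar_automorphism_def
proof (intro conjI allI impI)
  show "bij_betw (conj_by G h) K K"
    by (rule bij_betwI[of _ _ _ "conj_by G (inv h)"]) (use h in auto)
  show "openin TK Q \<longleftrightarrow> openin TK (conj_by G h ` Q)" if Q: "Q \<subseteq> K" for Q
  proof
    assume "openin TK Q"
    then show "openin TK (conj_by G h ` Q)" by (rule openin_conj_by[OF h])
  next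
    assume "openin TK (conj_by G h ` Q)"
    then have "openin TK (conj_by G (inv h) ` conj_by G h ` Q)" by (rule openin_conj_by[OF H_inv[OF h]])
    moreover have "conj_by G (inv h) ` conj_by G h ` Q = (\<lambda>y. y) ` Q"
      unfolding image_image using Q h by (intro image_cong refl) auto
    ultimately show "openin TK Q" by (simp only: image_ident)
  qed
  fix U assume U: "open_subgroup U"
  note U' = open_subgroupD[OF U]
  show "\<exists>V. open_subgroup V \<and> (\<forall>x\<in>K. conj_by G h ` (x <# U) = conj_by G h x <# V)"
  proof (intro exI conjI ballI)
    have "subgroup (conj_by G h ` U) G"
    proof (rule subgroupI)
      show "conj_by G h ` U \<subseteq> carrier G" using U'(5) h by auto
      show "conj_by G h ` U \<noteq> {}" using U'(4) by blast
      fix a assume "a \<in> conj_by G h ` U"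
      then obtain v where v: "v \<in> U" "a = conj_by G h v" by blast
      then have "inv a = conj_by G h (inv v)" using h U'(5) by (auto simp: conj_by_inv subset_iff)
      then show "inv a \<in> conj_by G h ` U" using v subgroup.m_inv_closed[OF U'(1)] by simp
      fix b assume "b \<in> conj_by G h ` U"
      then obtain w where w: "w \<in> U" "b = conj_by G h w" by blast
      then have "a \<otimes> b = conj_by G h (v \<otimes> w)" using v h U'(5) by (auto simp: conj_by_mult subset_iff)
      then show "a \<otimes> b \<in> conj_by G h ` U" using v w subgroup.m_closed[OF U'(1)] by simp
    qed
    then show "open_subgroup (conj_by G h ` U)"
      using openin_conj_by[OF h U'(2)] by (simp add: open_subgroup_def)
    show "conj_by G h ` (x <# U) = conj_by G h x <# (conj_by G h ` U)" if "x \<in> K" for x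
      using conj_by_set_mult[of h "{x}" U] h that U'(5) by (simp add: l_coset_eq_set_mult)
  qed
qed

text \<open>The function \<open>\<phi> x = \<mu>(xA \<triangle> A)\<close> is an \<open>H\<close>-invariant continuous length function. If its
  kernel \<open>Z\<close> were not \<open>K\<close>, some open subgroup \<open>W \<supseteq> Z\<close> would be proper; by compactness it contains
  an \<open>H\<close>-invariant neighbourhood \<open>{\<phi> < \<epsilon>}\<close> of the identity, so the core of \<open>W\<close> would be a proper
  open \<open>H\<close>-invariant subgroup.\<close>

lemma invariant_imp_translation_invariant:
  assumes noprop: "\<And>V. V \<in> open_inv_subgroups G T H K \<Longrightarrow> V = K"
    and A: "A \<in> sets haar" and Ainv: "\<And>h. h \<in> H \<Longrightarrow> sdist (conj_by G h ` A) A = 0"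
    and x0: "x0 \<in> K"
  shows "sdist (x0 <# A) A = 0"
proof (rule ccontr)
  interpret finite_measure haar by (rule finite_measure_haar)
  define \<phi> where "\<phi> x = sdist (x <# A) A" for x
  assume "sdist (x0 <# A) A \<noteq> 0"
  then have x0': "\<phi> x0 \<noteq> 0" by (simp add: \<phi>_def)
  have AK: "A \<subseteq> K" using sets.sets_into_space[OF A] by simp
  have Ac: "A \<subseteq> carrier G" using AK K_sub by blast
  have cA: "x <# A \<in> sets haar" if "x \<in> K" for x using that A by (rule l_coset_haar)
  have nonneg: "0 \<le> \<phi> x" for x by (simp add: \<phi>_def sdist_def)
  have mult: "\<phi> (x \<otimes> y) \<le> \<phi> x + \<phi> y" if x: "x \<in> K" and y: "y \<in> K" for x y
  proof -
    have eq: "(x \<otimes> y) <# A = x <# (y <# A)" using lcos_m_assoc[OF Ac, of x y] x y by simp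
    have "sdist (x <# (y <# A)) A \<le> sdist (x <# (y <# A)) (x <# A) + sdist (x <# A) A"
      using l_coset_haar(1)[OF x cA[OF y]] cA[OF x] A by (rule sdist_triangle)
    also have "sdist (x <# (y <# A)) (x <# A) = sdist (y <# A) A"
      by (rule sdist_l_coset[OF x cA[OF y] A])
    finally show ?thesis by (simp add: \<phi>_def eq)
  qed
  have inv: "\<phi> (inv x) = \<phi> x" if x: "x \<in> K" for x
  proof -
    have "\<phi> (inv x) = sdist (x <# (inv x <# A)) (x <# A)"
      unfolding \<phi>_def by (rule sdist_l_coset[symmetric, OF x cA A]) (use x in simp)
    also have "x <# (inv x <# A) = A" using x Ac by (simp add: lcos_m_assoc lcos_mult_one)
    finally show ?thesis by (simp add: \<phi>_def sdist_commute)
  qed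
  \<comment> \<open>Conjugation carries the pair \<open>x <# A\<close>, \<open>A\<close> to
    \<open>?y <# ?B\<close>, \<open>?B\<close> isometrically, and \<open>?B\<close> may be replaced
    by \<open>A\<close> because they differ by a null set.\<close>
  have conj: "\<phi> (conj_by G h x) \<le> \<phi> x" if h: "h \<in> H" and x: "x \<in> K" for h x
  proof -
    let ?y = "conj_by G h x" and ?B = "conj_by G h ` A"
    have yK: "?y \<in> K" using h x by simp
    have B: "?B \<in> sets haar" by (rule haar_image(1)[OF haar_automorphism_conj_by[OF h] A])
    have eq: "conj_by G h ` (x <# A) = ?y <# ?B"
      using conj_by_set_mult[of h "{x}" A] h x Ac by (simp add: l_coset_eq_set_mult)
    have yB: "?y <# ?B \<in> sets haar" using yK B by (rule l_coset_haar)
    have "sdist (?y <# A) A \<le> sdist (?y <# A) (?y <# ?B) + sdist (?y <# ?B) A"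
      by (rule sdist_triangle[OF cA[OF yK] yB A])
    moreover have "sdist (?y <# ?B) A \<le> sdist (?y <# ?B) ?B + sdist ?B A"
      by (rule sdist_triangle[OF yB B A])
    moreover have "sdist (?y <# A) (?y <# ?B) = 0"
      using sdist_l_coset[OF yK A B] Ainv[OF h] by (simp add: sdist_commute)
    moreover have "sdist (?y <# ?B) ?B = \<phi> x"
      unfolding eq[symmetric] \<phi>_def by (rule sdist_image[OF haar_automorphism_conj_by[OF h] cA[OF x] A])
    ultimately show ?thesis using Ainv[OF h] by (simp add: \<phi>_def)
  qed
  \<comment> \<open>A clopen \<open>C\<close> close to \<open>A\<close> is fixed by left translation
    with all elements of a small subgroup, so \<open>\<phi> u\<close> is at most twice the distance
    of \<open>A\<close> and \<open>C\<close>.\<close>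
  have small: "\<exists>U. U \<in> compact_open_subgroups G T K \<and> (\<forall>u\<in>U. \<phi> u < e)" if e: "0 < e" for e
  proof -
    obtain C where C: "clopen C" "sdist A C < e / 2" by (rule clopen_approx[OF A, of "e / 2"]) (use e in auto)
    have CK: "C \<subseteq> K" using C(1) by (rule clopen_subset)
    have Cs: "C \<in> sets haar" using C(1) by (rule clopen_sets_haar)
    have Cc: "compactin T C" using C(1) closed_compactin_K by (simp add: clopen_def compactin_TK)
    have "openin TK {u \<in> K. \<forall>c\<in>C. (\<lambda>(c, u). u \<otimes> c) (c, u) \<in> C}"
    proof (rule openin_tube_TK[OF _ Cc])
      show "continuous_map (prod_topology T T) T (\<lambda>(c, u). u \<otimes> c)"
        unfolding case_prod_unfold by (intro cont_mult' continuous_map_fst continuous_map_snd)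
      show "openin TK C" using C(1) by (simp add: clopen_def)
    qed (use CK in auto)
    then obtain U where U: "U \<in> compact_open_subgroups G T K" "U \<subseteq> {u \<in> K. \<forall>c\<in>C. u \<otimes> c \<in> C}"
      by (rule van_Dantzig) (use CK K_sub in \<open>auto simp: subset_iff\<close>)
    note U' = compact_open_subgroupsD[OF U(1)]
    have sub: "u <# C \<subseteq> C" if "u \<in> U" for u using U(2) that by (auto simp: l_coset_def)
    have "\<phi> u < e" if u: "u \<in> U" for u
    proof -
      have uK: "u \<in> K" using u U'(4) by blast
      have "inv u \<in> U" using u U'(1) by (simp add: subgroup.m_inv_closed)
      then have "u <# (inv u <# C) \<subseteq> u <# C" using sub by (auto simp: l_coset_def)
      moreover have "u <# (inv u <# C) = C"
        using uK CK K_sub by (simp add: lcos_m_assoc lcos_mult_one subset_trans[OF CK K_sub])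
      ultimately have uC: "u <# C = C" using sub[OF u] by blast
      have "\<phi> u \<le> sdist (u <# A) (u <# C) + sdist (u <# C) A"
        unfolding \<phi>_def by (rule sdist_triangle[OF cA[OF uK] _ A]) (simp add: uC Cs)
      also have "sdist (u <# A) (u <# C) = sdist A C" by (rule sdist_l_coset[OF uK A Cs])
      also have "sdist A C + sdist (u <# C) A < e" using C(2) by (simp add: uC sdist_commute)
      finally show ?thesis .
    qed
    then show ?thesis using U(1) by blast
  qed
  have op: "openin TK {x \<in> K. e < \<phi> x}" for e
  proof (subst openin_subopen, intro ballI)
    fix x assume x: "x \<in> {x \<in> K. e < \<phi> x}"
    then obtain U where U: "U \<in> compact_open_subgroups G T K" "\<And>u. u \<in> U \<Longrightarrow> \<phi> u < \<phi> x - e"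
      using small[of "\<phi> x - e"] by auto
    note U' = compact_open_subgroupsD[OF U(1)]
    have "x <# U \<subseteq> {x \<in> K. e < \<phi> x}"
    proof
      fix y assume "y \<in> x <# U"
      then obtain u where u: "u \<in> U" "y = x \<otimes> u" by (auto simp: l_coset_def)
      have uK: "u \<in> K" using u U'(4) by blast
      then have yK: "y \<in> K" using x u by simp
      have "x = y \<otimes> inv u" using u x uK by (simp add: m_assoc)
      then have "\<phi> x \<le> \<phi> y + \<phi> (inv u)" using mult[OF yK, of "inv u"] uK by simp
      then show "y \<in> {x \<in> K. e < \<phi> x}" using inv[OF uK] U(2)[OF u(1)] yK by simp
    qed
    moreover have "openin TK (x <# U)" using openin_lmult[of x U] x U'(2) by (simp add: l_coset_eq_image)
    moreover have "x \<in> x <# U" using x U'(1) by (intro lcos_self) auto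
    ultimately show "\<exists>S. openin TK S \<and> x \<in> S \<and> S \<subseteq> {x \<in> K. e < \<phi> x}" by blast
  qed
  have cl: "closedin TK {x \<in> K. \<phi> x \<le> e}" for e
  proof -
    have "closedin TK (topspace TK - {x \<in> K. e < \<phi> x})" by (rule closedin_diff[OF closedin_topspace op])
    moreover have "topspace TK - {x \<in> K. e < \<phi> x} = {x \<in> K. \<phi> x \<le> e}" by auto
    ultimately show ?thesis by simp
  qed
  define Z where "Z = {x \<in> K. \<phi> x \<le> 0}"
  have ZK: "Z \<subseteq> K" by (auto simp: Z_def)
  have x0Z: "x0 \<notin> Z" using x0' nonneg[of x0] by (simp add: Z_def)
  have one: "\<phi> \<one> = 0" using Ac by (simp add: \<phi>_def lcos_mult_one sdist_def)
  have Zc: "compactin T Z" using closed_compactin_K[OF cl[of 0]] by (simp add: Z_def compactin_TK)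
  have x0o: "openin TK (K - {x0})"
    using closedin_Hausdorff_singleton[OF Hausdorff_TK, of x0] x0 by (simp add: closedin_def)
  \<comment> \<open>\<open>M\<close> is taken so small that \<open>M Z\<close> misses
    \<open>x0\<close>, and normalized by \<open>K\<close> so that \<open>M Z\<close> is a
    group.\<close>
  have "openin TK {u \<in> K. \<forall>z\<in>Z. (\<lambda>(z, u). u \<otimes> z) (z, u) \<in> K - {x0}}"
  proof (rule openin_tube_TK[OF _ Zc _ x0o])
    show "continuous_map (prod_topology T T) T (\<lambda>(z, u). u \<otimes> z)"
      unfolding case_prod_unfold by (intro cont_mult' continuous_map_fst continuous_map_snd)
  qed (use ZK in auto)
  moreover have "\<one> \<in> {u \<in> K. \<forall>z\<in>Z. (\<lambda>(z, u). u \<otimes> z) (z, u) \<in> K - {x0}}"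
    using ZK x0Z by auto
  ultimately obtain M where M: "open_subgroup M" "M \<subseteq> {u \<in> K. \<forall>z\<in>Z. (\<lambda>(z, u). u \<otimes> z) (z, u) \<in> K - {x0}}"
      "\<forall>x\<in>K. \<forall>m\<in>M. conj_by G x m \<in> M"
    by (rule normal_open_subgroup)
  note M' = open_subgroupD[OF M(1)]
  define W where "W = M <#> Z"
  have x0W: "x0 \<notin> W" using M(2) by (auto simp: W_def set_mult_def)
  have Wo: "openin TK W" unfolding W_def by (rule openin_set_mult_left[OF M'(2) ZK])
  have WK: "W \<subseteq> K" using Wo by (rule openin_TK_subset)
  have Z_inv: "inv z \<in> Z" if "z \<in> Z" for z using that inv by (simp add: Z_def)
  have Z_mult: "z \<otimes> w \<in> Z" if "z \<in> Z" "w \<in> Z" for z w using that mult[of z w] by (simp add: Z_def)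
  have ZW: "Z \<subseteq> W"
  proof
    fix z assume z: "z \<in> Z"
    then have "z = \<one> \<otimes> z" using ZK by auto
    then show "z \<in> W" using z M'(4) unfolding W_def set_mult_def by blast
  qed
  have W: "subgroup W G"
  proof (rule subgroupI)
    show "W \<subseteq> carrier G" using WK K_sub by blast
    have "\<one> \<in> Z" using one by (simp add: Z_def)
    then show "W \<noteq> {}" using ZW by blast
    fix a assume "a \<in> W"
    then obtain m z where mz: "m \<in> M" "z \<in> Z" "a = m \<otimes> z" by (auto simp: W_def set_mult_def)
    have mK: "m \<in> K" "z \<in> K" using mz M'(3) ZK by auto
    have "inv a = conj_by G (inv z) (inv m) \<otimes> inv z" using mz(3) mK by (simp add: conj_by_def inv_mult_group m_assoc)
    moreover have "conj_by G (inv z) (inv m) \<in> M"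
      using M(3) mK subgroup.m_inv_closed[OF M'(1) mz(1)] by simp
    ultimately show "inv a \<in> W" using Z_inv[OF mz(2)] unfolding W_def set_mult_def by blast
    fix b assume "b \<in> W"
    then obtain n w where nw: "n \<in> M" "w \<in> Z" "b = n \<otimes> w" by (auto simp: W_def set_mult_def)
    have nK: "n \<in> K" "w \<in> K" using nw M'(3) ZK by auto
    have "a \<otimes> b = (m \<otimes> conj_by G z n) \<otimes> (z \<otimes> w)" using mz(3) nw(3) mK nK by (simp add: conj_by_def m_assoc)
    moreover have "m \<otimes> conj_by G z n \<in> M" using M(3)[rule_format, OF mK(2) nw(1)] mz(1) M'(1) by (simp add: subgroup.m_closed)
    ultimately show "a \<otimes> b \<in> W" using Z_mult[OF mz(2) nw(2)] unfolding W_def set_mult_def by blast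
  qed
  have "\<exists>n::nat. {x \<in> K. \<phi> x \<le> inverse (real (Suc n))} \<subseteq> W"
  proof (rule ccontr)
    assume no: "\<not> ?thesis"
    define F where "F n = {x \<in> K. \<phi> x \<le> inverse (real (Suc n))} - W" for n :: nat
    have "(\<Inter>n. F n) \<noteq> {}"
    proof (rule compactin_nest_nonempty[OF Hausdorff_TK])
      show "compactin TK (F n)" for n
        unfolding F_def by (intro closed_compactin_K closedin_diff cl Wo)
      show "F n \<noteq> {}" for n using no by (auto simp: F_def)
      have "inverse (real (Suc (Suc n))) \<le> inverse (real (Suc n))" for n by (simp add: le_imp_inverse_le)
      then show "F (Suc n) \<subseteq> F n" for n unfolding F_def by (auto intro: order_trans)
    qed
    then obtain x where x: "\<And>n. x \<in> F n" by blast
    have "\<phi> x \<le> 0"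
    proof (rule field_le_epsilon)
      fix e :: real assume "0 < e"
      then obtain n where "inverse (real (Suc n)) < e" using reals_Archimedean by blast
      then show "\<phi> x \<le> 0 + e" using x[of n] by (simp add: F_def)
    qed
    then show False using x[of 0] ZW by (auto simp: F_def Z_def)
  qed
  then obtain n :: nat where n: "{x \<in> K. \<phi> x \<le> inverse (real (Suc n))} \<subseteq> W" by blast
  obtain U where U: "U \<in> compact_open_subgroups G T K" "\<And>u. u \<in> U \<Longrightarrow> \<phi> u < inverse (real (Suc n))"
    using small[of "inverse (real (Suc n))"] by auto
  note U' = compact_open_subgroupsD[OF U(1)]
  have UcW: "U \<subseteq> core W"
  proof
    fix u assume u: "u \<in> U"
    have uK: "u \<in> K" using u U'(4) by blast
    have "conj_by G h u \<in> W" if h: "h \<in> H" for h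
    proof -
      have "\<phi> (conj_by G h u) \<le> inverse (real (Suc n))" using conj[OF h uK] U(2)[OF u] by simp
      then show ?thesis using n h uK by auto
    qed
    then show "u \<in> core W" using uK by (simp add: core_def)
  qed
  have cK: "core W \<subseteq> K" by (auto simp: core_def)
  have cW: "subgroup (core W) G"
  proof (rule subgroupI)
    show "core W \<subseteq> carrier G" using cK K_sub by blast
    show "core W \<noteq> {}" using UcW U'(5) by blast
    fix a assume a: "a \<in> core W"
    then show "inv a \<in> core W" using subgroup.m_inv_closed[OF W] by (simp add: core_def conj_by_inv)
    fix b assume "b \<in> core W"
    then show "a \<otimes> b \<in> core W" using a subgroup.m_closed[OF W] by (simp add: core_def conj_by_mult)
  qed
  have "core W <#> U = core W"
  proof
    show "core W <#> U \<subseteq> core W" using UcW subgroup.m_closed[OF cW] by (auto simp: set_mult_def)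
    show "core W \<subseteq> core W <#> U"
    proof
      fix x assume x: "x \<in> core W"
      then have "x = x \<otimes> \<one>" using cK by auto
      then show "x \<in> core W <#> U" using x U'(5) unfolding set_mult_def by blast
    qed
  qed
  then have "openin TK (core W)" using openin_set_mult_right[OF U'(2) cK] by simp
  then have "core W \<in> open_inv_subgroups G T H K"
    using cW core_invariant by (simp add: open_inv_subgroups_def)
  then have "core W = K" by (rule noprop)
  then show False using core_subset[of W] x0W x0 by blast
qed

lemma ergodic:
  assumes noprop: "\<And>V. V \<in> open_inv_subgroups G T H K \<Longrightarrow> V = K"
    and A: "A \<in> sets haar" and Ainv: "\<And>h. h \<in> H \<Longrightarrow> emeasure haar (sym_diff (conj_by G h ` A) A) = 0"
  shows "emeasure haar A = 0 \<or> emeasure haar A = 1"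
proof -
  interpret finite_measure haar by (rule finite_measure_haar)
  have "sdist (conj_by G h ` A) A = 0" if "h \<in> H" for h
    using Ainv[OF that] by (simp add: sdist_def measure_def)
  then have "sdist (x <# A) A = 0" if "x \<in> K" for x
    using invariant_imp_translation_invariant[OF noprop A _ that] by blast
  then have "measure haar A = 0 \<or> measure haar A = 1" by (rule measure_translation_invariant[OF A])
  then show ?thesis by (auto simp: emeasure_eq_measure)
qed

lemma acts_ergodically:
  assumes "\<And>V. V \<in> open_inv_subgroups G T H K \<Longrightarrow> V = K"
  shows "acts_ergodically G T H K"
  unfolding acts_ergodically_def using normalized_haar ergodic[OF assms] by blast

text \<open>Almost every point has an \<open>H\<close>-orbit accumulating at the identity.\<close>

lemma recurrent_closed_subgroup:
  assumes noprop: "\<And>V. V \<in> open_inv_subgroups G T H K \<Longrightarrow> V = K"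
    and metr: "metrizable_space TK" and D: "closedin TK D"
    and rec: "\<And>x. x \<in> K \<Longrightarrow> (\<And>V. openin TK V \<Longrightarrow> \<one> \<in> V \<Longrightarrow> \<exists>h\<in>H. conj_by G h x \<in> V) \<Longrightarrow> x \<in> D"
  shows "K \<subseteq> D"
proof (rule ccontr)
  interpret finite_measure haar by (rule finite_measure_haar)
  assume "\<not> K \<subseteq> D"
  then obtain x0 where x0: "x0 \<in> K - D" by blast
  obtain M d where md: "Metric_space M d" "TK = Metric_space.mtopology M d"
    using metr unfolding metrizable_space_def by blast
  interpret m: Metric_space M d by (rule md(1))
  have MK: "M = K" using md(2) m.topspace_mtopology topspace_TK by metis
  \<comment> \<open>A countable neighbourhood base at the identity, so that the exceptional points
    form a countable union of null sets.\<close>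
  define V where "V n = m.mball \<one> (inverse (real (Suc n)))" for n :: nat
  have Vo: "openin TK (V n)" for n unfolding md(2) V_def by (rule m.openin_mball)
  have "\<one> \<in> M" using MK by simp
  then have V1: "\<one> \<in> V n" for n by (simp add: V_def)
  \<comment> \<open>The points whose orbit meets \<open>V n\<close>: an open invariant set of
    positive measure, hence of full measure by ergodicity.\<close>
  define Q where "Q n = (\<Union>h\<in>H. conj_by G h ` V n)" for n
  have Qo: "openin TK (Q n)" for n
    unfolding Q_def using openin_conj_by[OF _ Vo] by blast
  have Vn: "V n \<subseteq> K" for n using Vo by (rule openin_TK_subset)
  have Qmem: "conj_by G h x \<in> Q n" if h: "h \<in> H" and x: "x \<in> Q n" for h x n
  proof -
    obtain k v where kv: "k \<in> H" "v \<in> V n" "x = conj_by G k v" using x by (auto simp: Q_def)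
    then have "conj_by G h x = conj_by G (h \<otimes> k) v" using h Vn[of n] conj_by_comp[of h k v] by auto
    then show ?thesis using H_mult[OF h kv(1)] kv(2) unfolding Q_def by blast
  qed
  have QK: "Q n \<subseteq> K" for n using Qo by (rule openin_TK_subset)
  have "conj_invariant G H (Q n)" for n
    by (rule conj_invariantI[OF H subset_trans[OF QK K_sub] Qmem])
  then have Qinv: "conj_by G h ` Q n = Q n" if "h \<in> H" for h n
    using that unfolding conj_invariant_def by blast
  have Qfull: "measure haar (Q n) = 1" for n
  proof -
    have "conj_by G \<one> \<one> \<in> Q n" using V1 H_one unfolding Q_def by blast
    then have "\<one> \<in> Q n" by simp
    then have "0 < measure haar (Q n)" using measure_haar_open_pos[OF Qo] by blast
    moreover have "emeasure haar (Q n) = 0 \<or> emeasure haar (Q n) = 1"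
      using ergodic[OF noprop open_sets_haar[OF Qo]] Qinv by simp
    ultimately show ?thesis by (auto simp: measure_def)
  qed
  have null: "emeasure haar (K - Q n) = 0" for n
  proof -
    have "measure haar (K - Q n) = 0"
      using finite_measure_compl[OF open_sets_haar[OF Qo]] Qfull[of n] measure_haar_clopen[OF clopen_K]
      by (simp add: cvol_K)
    then show ?thesis by (simp add: emeasure_eq_measure)
  qed
  have sets: "K - Q n \<in> sets haar" for n using open_sets_haar[OF Qo[of n]] clopen_sets_haar[OF clopen_K] by blast
  have "emeasure haar (\<Union>n. K - Q n) = 0"
    by (rule emeasure_UN_eq_0[OF null]) (use sets in blast)
  moreover have "K - D \<subseteq> (\<Union>n. K - Q n)"
  proof
    fix x assume x: "x \<in> K - D"
    show "x \<in> (\<Union>n. K - Q n)"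
    proof (rule ccontr)
      assume "x \<notin> (\<Union>n. K - Q n)"
      then have xQ: "x \<in> Q n" for n using x by blast
      have "\<exists>h\<in>H. conj_by G h x \<in> P" if P: "openin TK P" "\<one> \<in> P" for P
      proof -
        obtain r where r: "0 < r" "m.mball \<one> r \<subseteq> P"
          using P unfolding md(2) m.openin_mtopology by blast
        obtain n where "inverse (real (Suc n)) < r" using r(1) reals_Archimedean by blast
        then have VP: "V n \<subseteq> P" using r(2) unfolding V_def by auto
        obtain h v where hv: "h \<in> H" "v \<in> V n" "x = conj_by G h v" using xQ[of n] by (auto simp: Q_def)
        then have "conj_by G (inv h) x = v" using Vn[of n] by auto
        then show ?thesis using hv VP H_inv by blast
      qed
      then show False using rec[of x] x by blast
    qed
  qed
  moreover have "K - D \<in> sets haar" using D by (intro open_sets_haar) (simp add: closedin_def)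
  moreover have "(\<Union>n. K - Q n) \<in> sets haar" using sets by blast
  ultimately have "emeasure haar (K - D) = 0"
    using emeasure_mono[of "K - D" "\<Union>n. K - Q n" haar] by (simp del: UN_simps)
  then have "measure haar (K - D) = 0" by (simp add: measure_def)
  \<comment> \<open>A nonempty open set is never null, whereas points outside \<open>D\<close> were
    shown to miss some \<open>Q n\<close>.\<close>
  moreover have "0 < measure haar (K - D)"
    using measure_haar_open_pos[of "K - D" x0] D x0 by (simp add: closedin_def)
  ultimately show False by simp
qed

end

context cg_conj_action
begin

lemma Res_profinite_action:
  assumes "compactin T (Res G T H K)"
  shows "profinite_action G T (Res G T H K) H"
proof -
  have R: "Res G T H K \<in> closed_inv_subgroups G T H K"
    using Res_in_distal_family by (auto simp: distal_family_def)
  note R' = closed_inv_subgroupsD[OF R]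
  have "tdlc_subgroup G T (Res G T H K)"
    using closedin_trans_full[OF R'(2) K_closed]
    by (intro tdlc_subgroup.intro top_group_axioms tdlc_subgroup_axioms.intro td lc R'(1))
  then show ?thesis
    by (intro profinite_action.intro profinite_subgroup.intro profinite_subgroup_axioms.intro
        conj_action.intro conj_action_axioms.intro assms H R'(3))
qed

text \<open>A point of the residual whose orbit accumulates at the identity also accumulates at the
  trivial coset in \<open>K/D\<close>, so distality there puts it into \<open>D\<close>. By
  recurrence the closed set \<open>D \<inter> Res\<close> then is the whole residual.\<close>

lemma Res_subset_Dist_star:
  assumes comp: "compactin T (Res G T H K)" and metr: "metrizable_space (subtopology T (Res G T H K))"
  shows "Res G T H K \<subseteq> Dist_star G T H K"
  unfolding Dist_star_def
proof (rule Inter_greatest)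
  let ?R = "Res G T H K"
  interpret R: profinite_action G T ?R H by (rule Res_profinite_action[OF comp])
  fix D assume "D \<in> {D \<in> closed_inv_subgroups G T H K.
    distal_action_at (coset_space G T K D) H (conj_coset G) D}"
  then have D: "D \<in> closed_inv_subgroups G T H K"
    and d: "distal_action_at (coset_space G T K D) H (conj_coset G) D" by auto
  note D' = closed_inv_subgroupsD[OF D]
  have RK: "?R \<subseteq> K" using Res_subset[OF whole_open_inv] .
  have "?R \<subseteq> D \<inter> ?R"
  proof (rule R.recurrent_closed_subgroup[OF _ metr])
    show "V = ?R" if "V \<in> open_inv_subgroups G T H ?R" for V
      by (rule Res_no_proper_open_inv_subgroup[OF comp that])
    have "closedin T D" using closedin_trans_full[OF D'(2) K_closed] .
    then show "closedin R.TK (D \<inter> ?R)" by (auto simp: closedin_subtopology)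
    fix x assume x: "x \<in> ?R"
      and *: "\<And>V. openin R.TK V \<Longrightarrow> \<one> \<in> V \<Longrightarrow> \<exists>h\<in>H. conj_by G h x \<in> V"
    have "\<exists>h\<in>H. conj_by G h x \<in> V <#> D" if V: "openin TK V" "\<one> \<in> V" for V
    proof -
      obtain V' where V': "openin T V'" "V = V' \<inter> K" using V(1) by (auto simp: openin_subtopology)
      have "openin R.TK (V' \<inter> ?R)" using V'(1) by (auto simp: openin_subtopology)
      moreover have "\<one> \<in> V' \<inter> ?R" using V(2) V'(2) R.K_one by blast
      ultimately obtain h where h: "h \<in> H" "conj_by G h x \<in> V' \<inter> ?R" using * by blast
      then have "conj_by G h x \<in> V" using V'(2) RK by blast
      moreover have "conj_by G h x = conj_by G h x \<otimes> \<one>" using h(2) RK by auto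
      ultimately have "conj_by G h x \<in> V <#> D"
        using subgroup.one_closed[OF D'(1)] unfolding set_mult_def by blast
      then show ?thesis using h(1) by blast
    qed
    then have "x \<in> D" using d x RK unfolding distal_action_at_iff[OF D] by blast
    then show "x \<in> D \<inter> ?R" using x by blast
  qed
  then show "?R \<subseteq> D" by blast
qed

end

theorem theorem1p8:
  fixes G :: "('a, 'b) monoid_scheme" and T :: "'a topology" and H K :: "'a set"
  assumes "tdlc_group G T"
    and "subgroup H G" "closedin T H" "compactly_generated G T H"
    and "subgroup K G" "closedin T K" "conj_invariant G H K"
  shows "(compactin T (Dist G T H K) \<longleftrightarrow> compactin T (Res G T H K)) \<and>
         (compactin T (Res G T H K) \<longleftrightarrow>
            (\<exists>U \<in> compact_open_subgroups G T K. conj_invariant G H U)) \<and>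
         (compactin T (Dist G T H K) \<or> compactin T (Res G T H K) \<or>
            (\<exists>U \<in> compact_open_subgroups G T K. conj_invariant G H U) \<longrightarrow>
          flat_on G T H K \<and>
          nub G T H K = Res G T H K \<and>
          Res G T H K = Res_infty G T H K \<and>
          Res_infty G T H K = Dist G T H K \<and>
          acts_ergodically G T H (nub G T H K) \<and>
          (metrizable_space (subtopology T (nub G T H K)) \<longrightarrow>
             nub G T H K = Dist_star G T H K))"
proof -
  have "top_group G T"
    using assms(1) unfolding tdlc_group_def top_group_def top_group_axioms_def hausdorff_topological_group_def
    by blast
  then have "tdlc_subgroup G T K"
    using assms(1,5,6) unfolding tdlc_group_def tdlc_subgroup_def tdlc_subgroup_axioms_def by blast
  then interpret cg_conj_action G T K H
    using assms(2,4,7)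
    by (intro cg_conj_action.intro conj_action.intro conj_action_axioms.intro cg_conj_action_axioms.intro)
  let ?small = "\<exists>U \<in> compact_open_subgroups G T K. conj_invariant G H U"
  \<comment> \<open>The equivalences form a cycle: compact \<open>Res\<close> to compact
    \<open>Dist\<close>, to an invariant compact open subgroup, and back to compact
    \<open>Res\<close>.\<close>
  have DR: "compactin T (Dist G T H K)" if "compactin T (Res G T H K)"
    using closed_inv_compact[OF _ Dist_subset_Res that] Dist_in_distal_family
    by (auto simp: distal_family_def)
  have Ds: ?small if "compactin T (Dist G T H K)" using small_of_compact_Dist(1)[OF that] .
  have sR: "compactin T (Res G T H K)" if ?small using that compact_Res_of_small by blast
  have main: "flat_on G T H K \<and>
          nub G T H K = Res G T H K \<and>
          Res G T H K = Res_infty G T H K \<and>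
          Res_infty G T H K = Dist G T H K \<and>
          acts_ergodically G T H (nub G T H K) \<and>
          (metrizable_space (subtopology T (nub G T H K)) \<longrightarrow>
             nub G T H K = Dist_star G T H K)" if s: ?small
  proof -
    have R: "compactin T (Res G T H K)" using sR[OF s] .
    have RD: "Res G T H K = Dist G T H K" by (rule small_of_compact_Dist(2)[OF DR[OF R]])
    obtain U where U: "U \<in> compact_open_subgroups G T K" "conj_invariant G H U" using s by blast
    note nub = flat_and_nub_eq_Res[OF U]
    have "acts_ergodically G T H (Res G T H K)"
      by (rule profinite_action.acts_ergodically[OF Res_profinite_action[OF R]
            Res_no_proper_open_inv_subgroup[OF R]])
    moreover have "Res G T H K = Dist_star G T H K" if "metrizable_space (subtopology T (Res G T H K))"
      using Res_subset_Dist_star[OF R that] Dist_star_subset_Dist RD by blast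
    ultimately show ?thesis using nub Res_eq_Res_infty[OF R] RD by simp
  qed
  show ?thesis using DR Ds sR main by blast
qed

end
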